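(* Let $n\ge 3$, $0<r<R$, $0<r_*<R_*$, and let $\alpha,\beta>0$ with $\alpha+\beta=1$. Let $\mathbb{A}=A(r,R)$ and $\mathbb{A}_*=A(r_*,R_* )$ be the corresponding annuli in $\mathbf{R}^n$, and let $\mathcal{P}(\mathbb{A},\mathbb{A}_* )$ be the family of radial mappings of $\mathbb{A}$ onto $\mathbb{A}_*$ with finite total energy. Then there is a radial diffeomorphism $h=h_{\lambda_*}\in\mathcal{P}(\mathbb{A},\mathbb{A}_* )$ that minimizes the total energy functional $\mathcal{E}:\mathcal{P}(\mathbb{A},\mathbb{A}_* )\to\mathbf{R}$, i.e. $\mathcal{E}[h_{\lambda_*}]\le \mathcal{E}[g]$ for every $g\in\mathcal{P}(\mathbb{A},\mathbb{A}_* )$.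
   Context: Annuli: $A(r,R)=\{x\in\mathbf{R}^n: r<|x|<R\}$; $|\cdot|$ of a set denotes Lebesgue measure. Total energy: for a homeomorphism $h:\mathbb{A}\to\mathbb{A}_*$ with $h\in W^{1,n}(\mathbb{A})$ (and $h^{-1}$ weakly differentiable), $$\mathcal{E}[h]=\frac{\alpha}{|\mathbb{A}_*|}\int_{\mathbb{A}}\|Dh\|^n\,dx+\frac{\beta}{|\mathbb{A}|}\int_{\mathbb{A}_*}\|Dh^{-1}\|^n\,dy,$$ where $\|X\|=(\mathrm{tr}\,X^{*}X)^{1/2}$ is the Hilbert–Schmidt norm. Finite total energy means $h\in W^{1,n}(\mathbb{A})$, $h^{-1}\in W^{1,n}(\mathbb{A}_* )$, so that $\mathcal{E}[h]<\infty$. Radial mapping (radial stretching): a mapping $h(x)=H(|x|)\frac{x}{|x|}$, where $H:[r,R]\to[r_*,R_*]$ is a homeomorphism with $H(r)=r_*$, $H(R)=R_*$. Definition of $h_{\lambda_*}$: put $a=\alpha/|\mathbb{A}_*|$, $b=\beta/|\mathbb{A}|$ and, for $t,y>0$, $$U(t,y)=a[(n-1)t^2+y^2]^{\frac{n-4}{2}}[(n-1)t^2+(n-2)ty+y^2],$$ $$V(t,y)=b\,\frac{[(n-1)y^2+t^2]^{\frac{n-4}{2}}[t^2+(n-2)ty+(n-1)y^2]}{t\,y^{n-1}},$$ $$W(t,y)=(t^2+y^2)\Big\{a[(n-1)t^2+y^2]^{\frac{n-4}{2}}+b\,\frac{t[(n-1)y^2+t^2]^{\frac{n-4}{2}}}{y^{n+1}}\Big\},$$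 $$G(t,y)=-\frac{U(t,y)+V(t,y)}{W(t,y)}.$$ For $\lambda>0$ let $F_\lambda:(0,\infty)\to(0,\infty)$ be the solution of $F'(t)=G(t,F(t))$ with $F_\lambda(\lambda)=\lambda$ (it exists on all of $(0,\infty)$ and is unique). Let $H_\lambda$ be the solution of $H'(s)=F_\lambda(H(s)/s)$, $s\ge r$, with $H(r)=r_*$. There is exactly one $\lambda_*>0$ with $H_{\lambda_*}(R)=R_*$; then $H_{\lambda_*}$ maps $[r,R]$ onto $[r_*,R_*]$, and $h_{\lambda_*}(x)=H_{\lambda_*}(|x|)\frac{x}{|x|}$. *)

theory Defs
  imports "HOL-Analysis.Analysis"
begin

definition annulus :: "real \<Rightarrow> real \<Rightarrow> 'a::real_normed_vector set" where
  "annulus r R = {x. r < norm x \<and> norm x < R}"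


text \<open>For a function on a finite-dimensional space and an open set \<open>S\<close>, \<open>C_on k S f\<close> says that
  \<open>f\<close> is of class \<open>C\<^sup>k\<close> on \<open>S\<close>; \<open>v\<close> ranges over the directions of differentiation.\<close>

primrec C_on :: "nat \<Rightarrow> 'a::real_normed_vector set \<Rightarrow> ('a \<Rightarrow> 'b::real_normed_vector) \<Rightarrow> bool" where
  "C_on 0 S f \<longleftrightarrow> continuous_on S f"
| "C_on (Suc k) S f \<longleftrightarrow>
     (\<forall>x\<in>S. f differentiable (at x)) \<and> (\<forall>v. C_on k S (\<lambda>x. frechet_derivative f (at x) v))"

definition smooth_on :: "'a::real_normed_vector set \<Rightarrow> ('a \<Rightarrow> 'b::real_normed_vector) \<Rightarrow> bool" where
  "smooth_on S f \<longleftrightarrow> (\<forall>k. C_on k S f)"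

definition diffeomorphism :: "'a::real_normed_vector set \<Rightarrow> 'b::real_normed_vector set \<Rightarrow> ('a \<Rightarrow> 'b) \<Rightarrow> bool"
  where
  "diffeomorphism S T h \<longleftrightarrow> bij_betw h S T \<and> smooth_on S h \<and> smooth_on T (inv_into S h)"


definition test_function :: "(real^'n) set \<Rightarrow> (real^'n \<Rightarrow> real) \<Rightarrow> bool" where
  "test_function S \<phi> \<longleftrightarrow>
     smooth_on UNIV \<phi> \<and> compact (closure {x. \<phi> x \<noteq> 0}) \<and> closure {x. \<phi> x \<noteq> 0} \<subseteq> S"

definition locally_integrable ::
    "(real^'n) set \<Rightarrow> (real^'n \<Rightarrow> 'b::{banach, second_countable_topology}) \<Rightarrow> bool" where
  "locally_integrable S f \<longleftrightarrow> (\<forall>K. compact K \<and> K \<subseteq> S \<longrightarrow> integrable (lebesgue_on K) f)"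

text \<open>The entry \<open>D x $ i $ j\<close> is the weak \<open>j\<close>-th partial derivative of the \<open>i\<close>-th component.\<close>

definition is_weak_derivative ::
    "(real^'n) set \<Rightarrow> (real^'n \<Rightarrow> real^'n) \<Rightarrow> (real^'n \<Rightarrow> real^'n^'n) \<Rightarrow> bool" where
  "is_weak_derivative S f D \<longleftrightarrow>
     locally_integrable S f \<and> locally_integrable S D \<and>
     (\<forall>\<phi> i j. test_function S \<phi> \<longrightarrow>
        (LINT x|lebesgue_on S. f x $ i * frechet_derivative \<phi> (at x) (axis j 1)) =
        - (LINT x|lebesgue_on S. D x $ i $ j * \<phi> x))"

text \<open>A weak derivative on \<open>S\<close> is determined only almost everywhere on \<open>S\<close>; \<open>weak_derivative\<close> is a
  representative.\<close>

definition weak_derivative ::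
    "(real^'n) set \<Rightarrow> (real^'n \<Rightarrow> real^'n) \<Rightarrow> real^'n \<Rightarrow> real^'n^'n" where
  "weak_derivative S f = (SOME D. is_weak_derivative S f D)"

definition L_space ::
    "nat \<Rightarrow> (real^'n) set \<Rightarrow> (real^'n \<Rightarrow> 'b::{real_normed_vector, second_countable_topology}) set" where
  "L_space p S = {f. f \<in> borel_measurable (lebesgue_on S) \<and>
                     integrable (lebesgue_on S) (\<lambda>x. norm (f x) ^ p)}"

definition W1_space :: "nat \<Rightarrow> (real^'n) set \<Rightarrow> (real^'n \<Rightarrow> real^'n) set" where
  "W1_space p S = {f. f \<in> L_space p S \<and> (\<exists>D. is_weak_derivative S f D \<and> D \<in> L_space p S)}"


definition hs_norm :: "real^'n^'n \<Rightarrow> real" where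
  "hs_norm X = sqrt (trace (transpose X ** X))"

text \<open>Only used for maps \<open>h\<close> for which both integrals are finite.\<close>

definition total_energy ::
    "real \<Rightarrow> real \<Rightarrow> (real^'n) set \<Rightarrow> (real^'n) set \<Rightarrow> (real^'n \<Rightarrow> real^'n) \<Rightarrow> real" where
  "total_energy \<alpha> \<beta> S T h =
     \<alpha> / measure lebesgue T *
       (LINT x|lebesgue_on S. hs_norm (weak_derivative S h x) ^ CARD('n)) +
     \<beta> / measure lebesgue S *
       (LINT y|lebesgue_on T. hs_norm (weak_derivative T (inv_into S h) y) ^ CARD('n))"

definition radial_map :: "(real \<Rightarrow> real) \<Rightarrow> real^'n \<Rightarrow> real^'n" where
  "radial_map H x = (H (norm x) / norm x) *\<^sub>R x"

text \<open>The class \<open>\<P>(A(r,R), A(r\<^sub>*,R\<^sub>*))\<close>. Its members are maps on the annulus; their values outside it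
  are irrelevant.\<close>

definition radial_maps :: "real \<Rightarrow> real \<Rightarrow> real \<Rightarrow> real \<Rightarrow> (real^'n \<Rightarrow> real^'n) set" where
  "radial_maps r R rs Rs =
     {h. (\<exists>H K. homeomorphism {r..R} {rs..Rs} H K \<and> H r = rs \<and> H R = Rs \<and>
                (\<forall>x\<in>annulus r R. h x = radial_map H x)) \<and>
         h \<in> W1_space CARD('n) (annulus r R) \<and>
         inv_into (annulus r R) h \<in> W1_space CARD('n) (annulus rs Rs)}"


definition U_coef :: "nat \<Rightarrow> real \<Rightarrow> real \<Rightarrow> real \<Rightarrow> real" where
  "U_coef n a t y =
     a * ((real n - 1) * t^2 + y^2) powr ((real n - 4) / 2)
       * ((real n - 1) * t^2 + (real n - 2) * t * y + y^2)"

definition V_coef :: "nat \<Rightarrow> real \<Rightarrow> real \<Rightarrow> real \<Rightarrow> real" where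
  "V_coef n b t y =
     b * (((real n - 1) * y^2 + t^2) powr ((real n - 4) / 2)
          * (t^2 + (real n - 2) * t * y + (real n - 1) * y^2)) / (t * y ^ (n - 1))"

definition W_coef :: "nat \<Rightarrow> real \<Rightarrow> real \<Rightarrow> real \<Rightarrow> real \<Rightarrow> real" where
  "W_coef n a b t y =
     (t^2 + y^2) *
       (a * ((real n - 1) * t^2 + y^2) powr ((real n - 4) / 2)
        + b * (t * ((real n - 1) * y^2 + t^2) powr ((real n - 4) / 2)) / y ^ (n + 1))"

definition G_rhs :: "nat \<Rightarrow> real \<Rightarrow> real \<Rightarrow> real \<Rightarrow> real \<Rightarrow> real" where
  "G_rhs n a b t y = - (U_coef n a t y + V_coef n b t y) / W_coef n a b t y"

text \<open>The extensional function spaces \<open>\<rightarrow>\<^sub>E\<close> make solutions on \<open>(0,\<infinity>)\<close> and \<open>[r,\<infinity>)\<close>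
  unique as total functions.\<close>

definition F_sol :: "nat \<Rightarrow> real \<Rightarrow> real \<Rightarrow> real \<Rightarrow> real \<Rightarrow> real" where
  "F_sol n a b l = (THE F. F \<in> {0<..} \<rightarrow>\<^sub>E {0<..} \<and> F l = l \<and>
     (\<forall>t>0. (F has_real_derivative G_rhs n a b t (F t)) (at t)))"

definition H_sol :: "nat \<Rightarrow> real \<Rightarrow> real \<Rightarrow> real \<Rightarrow> real \<Rightarrow> real \<Rightarrow> real \<Rightarrow> real" where
  "H_sol n a b r rs l = (THE H. H \<in> {r..} \<rightarrow>\<^sub>E {0<..} \<and> H r = rs \<and>
     (\<forall>s\<ge>r. (H has_real_derivative F_sol n a b l (H s / s)) (at s within {r..})))"

definition lambda_star :: "nat \<Rightarrow> real \<Rightarrow> real \<Rightarrow> real \<Rightarrow> real \<Rightarrow> real \<Rightarrow> real \<Rightarrow> real" where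
  "lambda_star n a b r R rs Rs = (THE l. l > 0 \<and> H_sol n a b r rs l R = Rs)"

definition h_star :: "real \<Rightarrow> real \<Rightarrow> real \<Rightarrow> real \<Rightarrow> real \<Rightarrow> real \<Rightarrow> real^'n \<Rightarrow> real^'n" where
  "h_star \<alpha> \<beta> r R rs Rs =
     (let n = CARD('n);
          a = \<alpha> / measure lebesgue (annulus rs Rs :: (real^'n) set);
          b = \<beta> / measure lebesgue (annulus r R :: (real^'n) set)
      in radial_map (H_sol n a b r rs (lambda_star n a b r R rs Rs)))"

end

(* The energies of a radial map and of its inverse are integrals over [r,R] and [rs,Rs]; both integrands are
   convex in the slope, so each energy is bounded below by its linearisation at the slope F(H(s)/s) prescribed by
   the solution F = F_lambda.  The sum of the two linearised energies is the line integral along the graph of H of a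
   one-form in (s, H).  The differential equation F' = G(t, F) says exactly that this form is closed (with the
   potential s^n eikonal(H/s)), so the lower bound depends only on the end points of the graph.  It is attained by
   H_lambda for the lambda that fits the boundary values.  Competitors enter only through their weak derivatives,
   which are tested against fields of the form psi2(|x|^2) I + psi1(|x|^2) x x^T. *)

theory Submission
  imports Defs
begin

section \<open>Scalar ordinary differential equations\<close>

text \<open>Dilations of the \<open>(s, H)\<close>-plane preserve the equation of the extremals. One
  solution \<open>F l\<close> on the half-line therefore gives a slope field
  \<open>F l (H / s)\<close> on the whole quadrant \<open>s, H > 0\<close>, and every competitor's
  graph lies in its domain; this is why \<open>F l\<close> must exist globally. The obstacle is that
  \<open>G\<close> is singular at the edges of the quadrant. In the coordinates \<open>ln t\<close>
  and \<open>ln y\<close> the solutions decrease, and each half of a decreasing solution stays in a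
  region where its slope is bounded. No derivative of a competitor's profile \<open>H\<close> is
  ever formed. What multiplies \<open>H'\<close> is integrated over the target interval after
  composition with the inverse profile \<open>K\<close>, a Stieltjes integral in disguise. The
  linearisation is essential for this, because it leaves only terms affine in the derivative. For
  the inverse map \<open>ds\<close> and \<open>dH\<close> exchange their roles, and pulling back to
  the source exchanges the slope of a tangent with its value at zero; so both energies contribute to
  the same one-form.\<close>

lemma at_within_Ici_interior:
  fixes v :: real assumes "r < v" shows "at v within {r..} = at v"
  by (rule at_within_interior) (use assms in \<open>auto simp: interior_real_atLeast\<close>)

text \<open>Picard iteration on the whole half-line in one step: writing the solution as
  \<open>x0 + exp (c * s) * z s\<close> with \<open>z\<close> bounded, the integral operator
  contracts by \<open>L / c\<close> in the sup norm, whatever the length of time. The bound at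
  \<open>x0\<close> makes the image of \<open>z = 0\<close> a bounded function.\<close>

lemma ode_exists_forward:
  fixes k :: "real \<Rightarrow> real \<Rightarrow> real"
  assumes cont: "continuous_on ({0..} \<times> UNIV) (\<lambda>z. k (fst z) (snd z))"
    and lip: "\<And>v x y. 0 \<le> v \<Longrightarrow> \<bar>k v x - k v y\<bar> \<le> L * \<bar>x - y\<bar>"
    and bnd: "\<And>v. 0 \<le> v \<Longrightarrow> \<bar>k v x0\<bar> \<le> B"
  obtains x where "x 0 = x0"
    "\<And>v. 0 \<le> v \<Longrightarrow> (x has_real_derivative k v (x v)) (at v within {0..})"
proof -
  have L0: "0 \<le> L" using lip[of 0 0 1] by auto
  have B0: "0 \<le> B" using bnd[of 0] by auto
  \<comment> \<open>Any weight above \<open>L\<close> gives a contraction; \<open>L + 1\<close> is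
    also positive when \<open>L = 0\<close>.\<close>
  define c where "c = L + 1"
  have c0: "0 < c" using L0 by (simp add: c_def)
  define f where "f z s = k s (x0 + exp (c * s) * apply_bcontfun z s)" for z :: "real \<Rightarrow>\<^sub>C real" and s
  have fcont: "continuous_on {0..} (f z)" for z
    unfolding f_def
    by (rule continuous_on_compose2[OF cont, of _ "\<lambda>s. (s, x0 + exp (c * s) * apply_bcontfun z s)", simplified])
       (auto intro!: continuous_intros)
  have fcont': "continuous_on {0..v} (f z)" for z v
    by (rule continuous_on_subset[OF fcont]) auto
  have fint: "f z integrable_on {0..v}" for z v
    by (rule integrable_continuous_interval[OF fcont'])
  define J where "J z v = integral {0..v} (f z)" for z v
  have Jder: "(J z has_real_derivative f z v) (at v within {0..})" if "0 \<le> v" for z v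
  proof -
    have "(J z has_real_derivative f z v) (at v within {0..v+1})"
      unfolding J_def using integral_has_real_derivative[OF fcont', of v "v+1"] that by auto
    moreover have "at v within {0..v+1} = at v within {0..}"
      by (rule at_within_nhd[of _ "{..<v+1}"]) auto
    ultimately show ?thesis by simp
  qed
  have expint: "((\<lambda>s. exp (c * s)) has_integral (exp (c * v) - 1) / c) {0..v}" if "0 \<le> v" for v
  proof -
    have "((\<lambda>s. exp (c * s)) has_integral (exp (c * v) / c - exp (c * 0) / c)) {0..v}"
      by (rule fundamental_theorem_of_calculus[OF that])
         (use c0 in \<open>auto intro!: derivative_eq_intros simp: has_real_derivative_iff_has_vector_derivative[symmetric]\<close>)
    then show ?thesis by (simp add: diff_divide_distrib)
  qed
  have Jdiff: "\<bar>J z v - J z' v\<bar> \<le> L * dist z z' * ((exp (c * v) - 1) / c)" if "0 \<le> v" for z z' v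
  proof -
    have "norm (integral {0..v} (\<lambda>s. f z s - f z' s)) \<le> integral {0..v} (\<lambda>s. L * dist z z' * exp (c * s))"
    proof (rule Henstock_Kurzweil_Integration.integral_norm_bound_integral)
      show "(\<lambda>s. f z s - f z' s) integrable_on {0..v}" by (intro integrable_diff fint)
      show "(\<lambda>s. L * dist z z' * exp (c * s)) integrable_on {0..v}"
        by (intro integrable_continuous_interval continuous_intros)
      fix s assume s: "s \<in> {0..v}"
      have "\<bar>f z s - f z' s\<bar> \<le> L * (exp (c * s) * \<bar>apply_bcontfun z s - apply_bcontfun z' s\<bar>)"
        using lip[of s "x0 + exp (c * s) * apply_bcontfun z s" "x0 + exp (c * s) * apply_bcontfun z' s"] s
        by (simp add: f_def abs_mult flip: right_diff_distrib)
      also have "\<dots> \<le> L * (exp (c * s) * dist z z')"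
        using dist_bounded[of z s z'] L0 by (intro mult_left_mono) (auto simp: dist_real_def)
      finally show "norm (f z s - f z' s) \<le> L * dist z z' * exp (c * s)" by (simp add: mult_ac)
    qed
    also have "integral {0..v} (\<lambda>s. L * dist z z' * exp (c * s)) = L * dist z z' * ((exp (c * v) - 1) / c)"
      using integral_unique[OF expint[OF that]] by simp
    finally show ?thesis using fint by (simp add: J_def Henstock_Kurzweil_Integration.integral_diff)
  qed
  have J0: "\<bar>J 0 v\<bar> \<le> B * v" if "0 \<le> v" for v
  proof -
    have "norm (integral {0..v} (f 0)) \<le> integral {0..v} (\<lambda>s. B)"
      by (rule Henstock_Kurzweil_Integration.integral_norm_bound_integral)
         (use fint bnd in \<open>auto simp: f_def\<close>)
    then show ?thesis using that by (simp add: J_def mult_ac)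
  qed
  \<comment> \<open>Bounded continuous functions form a complete space here only on the whole line
    as domain, so \<open>max v 0\<close> continues the operator by a constant to negative
    times.\<close>
  define q where "q z v = exp (- c * max v 0) * J z (max v 0)" for z v
  have q_diff: "\<bar>q z v - q z' v\<bar> \<le> L / c * dist z z'" for z z' v
  proof -
    let ?m = "max v 0"
    have "\<bar>q z v - q z' v\<bar> = exp (- c * ?m) * \<bar>J z ?m - J z' ?m\<bar>"
      by (simp add: q_def abs_mult flip: right_diff_distrib)
    also have "\<dots> \<le> exp (- c * ?m) * (L * dist z z' * ((exp (c * ?m) - 1) / c))"
      by (intro mult_left_mono Jdiff) auto
    also have "\<dots> = L * dist z z' / c * (1 - exp (- c * ?m))"
      using c0 by (simp add: field_simps flip: exp_add)
    also have "\<dots> \<le> L * dist z z' / c * 1"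
      using c0 L0 by (intro mult_left_mono) auto
    finally show ?thesis by simp
  qed
  have q_0: "\<bar>q 0 v\<bar> \<le> B / c" for v
  proof -
    let ?m = "max v 0"
    have "\<bar>q 0 v\<bar> \<le> exp (- c * ?m) * (B * ?m)"
      unfolding q_def abs_mult abs_exp_cancel by (intro mult_left_mono J0) auto
    also have "\<dots> = B / c * (c * ?m * exp (- (c * ?m)))" using c0 by simp
    also have "\<dots> \<le> B / c * 1"
    proof (intro mult_left_mono)
      have "c * ?m \<le> exp (c * ?m)" using exp_ge_add_one_self[of "c * ?m"] by linarith
      then show "c * ?m * exp (- (c * ?m)) \<le> 1" by (simp add: exp_minus field_simps)
    qed (use B0 c0 in auto)
    finally show ?thesis by simp
  qed
  have q_bc: "q z \<in> bcontfun" for z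
  proof (rule bcontfun_normI)
    have "continuous_on {0..} (J z)" by (rule DERIV_continuous_on) (use Jder in auto)
    then show "continuous_on UNIV (q z)" unfolding q_def
      by (intro continuous_intros continuous_on_compose2[of "{0..}" "J z" UNIV "\<lambda>v. max v 0"]) auto
    show "norm (q z v) \<le> B / c + L / c * dist z 0" for v
      using q_0[of v] q_diff[of z v 0] by (simp add: abs_le_iff)
  qed
  have Qap: "apply_bcontfun (Bcontfun (q z)) = q z" for z by (rule Bcontfun_inverse[OF q_bc])
  have "\<exists>!z. Bcontfun (q z) = z"
  proof (rule banach_fix_type)
    show "0 \<le> L / c" "L / c < 1" using L0 c0 by (auto simp: c_def)
    show "\<forall>z z'. dist (Bcontfun (q z)) (Bcontfun (q z')) \<le> L / c * dist z z'"
    proof (intro allI)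
      fix z z'
      show "dist (Bcontfun (q z)) (Bcontfun (q z')) \<le> L / c * dist z z'"
        by (rule dist_bound) (use q_diff in \<open>simp add: Qap dist_real_def\<close>)
    qed
  qed
  then obtain z where z: "Bcontfun (q z) = z" by blast
  then have zq: "apply_bcontfun z v = q z v" for v using Qap[of z] by simp
  show thesis
  proof
    show "x0 + J z 0 = x0" by (simp add: J_def)
    fix v :: real assume v: "0 \<le> v"
    have "exp (c * v) * q z v = J z v" using v by (simp add: q_def flip: exp_add mult.assoc)
    then have "f z v = k v (x0 + J z v)" by (simp add: f_def zq)
    then have "(J z has_real_derivative k v (x0 + J z v)) (at v within {0..})"
      using Jder[OF v, of z] by simp
    from DERIV_add[OF DERIV_const this, of x0]
    show "((\<lambda>v. x0 + J z v) has_real_derivative k v (x0 + J z v)) (at v within {0..})" by simp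
  qed
qed

lemma nonpos_derivative_antimono_forward:
  fixes f :: "real \<Rightarrow> real"
  assumes "\<And>v. r \<le> v \<Longrightarrow> (f has_real_derivative f' v) (at v within {r..})"
    and "\<And>v. x < v \<Longrightarrow> v < y \<Longrightarrow> f' v \<le> 0" and "r \<le> x" "x \<le> y"
  shows "f y \<le> f x"
proof (rule DERIV_nonpos_imp_decreasing_open[OF \<open>x \<le> y\<close>])
  have "continuous_on {r..} f" by (rule DERIV_continuous_on) (use assms in auto)
  then show "continuous_on {x..y} f" by (rule continuous_on_subset) (use assms in auto)
  show "\<exists>d. (f has_real_derivative d) (at v) \<and> d \<le> 0" if "x < v" "v < y" for v
    using assms(1)[of v] assms(2)[of v] that \<open>r \<le> x\<close> at_within_Ici_interior[of r v] by auto
qed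

text \<open>Gronwall's argument in one-sided form: the weight \<open>exp (- 2 * L * v)\<close> makes
  the squared distance nonincreasing. Stating the hypothesis for the product also covers decreasing
  right-hand sides, with \<open>L = 0\<close>.\<close>

lemma ode_unique_forward:
  fixes x y :: "real \<Rightarrow> real"
  assumes x: "\<And>v. r \<le> v \<Longrightarrow> (x has_real_derivative x' v) (at v within {r..})"
    and y: "\<And>v. r \<le> v \<Longrightarrow> (y has_real_derivative y' v) (at v within {r..})"
    and lip: "\<And>v. r \<le> v \<Longrightarrow> (x v - y v) * (x' v - y' v) \<le> L * (x v - y v)\<^sup>2"
    and "x r = y r" "r \<le> v"
  shows "x v = y v"
proof -
  define d where "d v = exp (- 2 * L * v) * (x v - y v)\<^sup>2" for v
  define d' where "d' s = exp (- 2 * L * s) * (2 * ((x s - y s) * (x' s - y' s)) - 2 * L * (x s - y s)\<^sup>2)" for s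
  have "d v \<le> d r"
  proof (rule nonpos_derivative_antimono_forward[of r d d'])
    show "(d has_real_derivative d' s) (at s within {r..})" if "r \<le> s" for s
      unfolding d_def d'_def by (rule derivative_eq_intros x y that refl | simp add: algebra_simps)+
    show "d' s \<le> 0" if "r < s" "s < v" for s
      using lip[of s] that unfolding d'_def by (intro mult_nonneg_nonpos) auto
  qed (use assms in auto)
  also have "d r = 0" using assms by (simp add: d_def)
  finally have "(x v - y v)\<^sup>2 \<le> 0" by (simp add: d_def mult_le_0_iff)
  then show ?thesis by simp
qed

text \<open>After the last time at which \<open>x\<close> is at most \<open>m\<close>, the function
  lies above \<open>m\<close> and so cannot grow; hence it never gets above
  \<open>m\<close>.\<close>

lemma barrier_forward:
  fixes x :: "real \<Rightarrow> real"
  assumes x: "\<And>v. r \<le> v \<Longrightarrow> (x has_real_derivative x' v) (at v within {r..})"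
    and neg: "\<And>v. r \<le> v \<Longrightarrow> m \<le> x v \<Longrightarrow> x' v \<le> 0"
    and "x r \<le> m" "r \<le> v"
  shows "x v \<le> m"
proof (rule ccontr)
  assume v: "\<not> x v \<le> m"
  have c: "continuous_on {r..v} x"
    by (rule continuous_on_subset[OF DERIV_continuous_on[OF x]]) auto
  define S where "S = {r..v} \<inter> x -` {..m}"
  have "closed S" unfolding S_def by (rule continuous_closed_preimage[OF c]) auto
  moreover have "bounded S" unfolding S_def by (rule bounded_subset[of "{r..v}"]) auto
  ultimately have "compact S" by (simp add: compact_eq_bounded_closed)
  moreover have "S \<noteq> {}" using assms by (auto simp: S_def)
  ultimately have "\<exists>u\<in>S. \<forall>s\<in>S. s \<le> u" by (rule compact_attains_sup)
  then obtain u where u: "u \<in> S" "\<And>s. s \<in> S \<Longrightarrow> s \<le> u" by auto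
  have "x v \<le> x u"
  proof (rule nonpos_derivative_antimono_forward[OF x])
    show "x' s \<le> 0" if "u < s" "s < v" for s
      using neg[of s] u(1) u(2)[of s] that by (force simp: S_def)
  qed (use u in \<open>auto simp: S_def\<close>)
  then show False using u v by (auto simp: S_def)
qed

section \<open>The slope field of the extremals\<close>

text \<open>This class is closed under sums, products, quotients and powers, so the right-hand side of the equation
  belongs to it; where that is bounded, it is therefore globally Lipschitz, and solutions exist for all times.\<close>

definition log_Lipschitz :: "real \<Rightarrow> (real \<Rightarrow> real) \<Rightarrow> bool" where
  "log_Lipschitz k f \<longleftrightarrow> (\<forall>w. 0 < f w) \<and> (\<forall>w w'. f w \<le> exp (k * \<bar>w - w'\<bar>) * f w')"

lemma log_Lipschitz_mono:
  assumes "log_Lipschitz k f" "k \<le> l" shows "log_Lipschitz l f"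
proof -
  have "f w \<le> exp (l * \<bar>w - w'\<bar>) * f w'" for w w'
  proof -
    have "f w \<le> exp (k * \<bar>w - w'\<bar>) * f w'" using assms by (auto simp: log_Lipschitz_def)
    also have "\<dots> \<le> exp (l * \<bar>w - w'\<bar>) * f w'"
      using assms by (intro mult_right_mono) (auto simp: log_Lipschitz_def less_imp_le mult_right_mono)
    finally show ?thesis .
  qed
  then show ?thesis using assms by (auto simp: log_Lipschitz_def)
qed

lemma log_Lipschitz_const: "0 < c \<Longrightarrow> 0 \<le> k \<Longrightarrow> log_Lipschitz k (\<lambda>_. c)"
  by (auto simp: log_Lipschitz_def)

lemma log_Lipschitz_exp_power:
  assumes "real m \<le> k" shows "log_Lipschitz k (\<lambda>w. exp w ^ m)"
proof -
  have "exp w ^ m \<le> exp (k * \<bar>w - w'\<bar>) * exp w' ^ m" for w w' :: real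
  proof -
    have "real m * (w - w') \<le> real m * \<bar>w - w'\<bar>" by (intro mult_left_mono) auto
    also have "\<dots> \<le> k * \<bar>w - w'\<bar>" by (intro mult_right_mono assms) auto
    finally show ?thesis by (simp add: exp_of_nat_mult[symmetric] flip: exp_add) (simp add: algebra_simps)
  qed
  then show ?thesis by (auto simp: log_Lipschitz_def)
qed

lemma log_Lipschitz_add:
  assumes "log_Lipschitz k f" "log_Lipschitz k g" shows "log_Lipschitz k (\<lambda>w. f w + g w)"
  using assms by (auto simp: log_Lipschitz_def add_pos_pos ring_distribs add_mono)

lemma log_Lipschitz_mult:
  assumes "log_Lipschitz k f" "log_Lipschitz l g" shows "log_Lipschitz (k + l) (\<lambda>w. f w * g w)"
proof -
  have "f w * g w \<le> exp ((k + l) * \<bar>w - w'\<bar>) * (f w' * g w')" for w w'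
  proof -
    have "f w * g w \<le> (exp (k * \<bar>w - w'\<bar>) * f w') * (exp (l * \<bar>w - w'\<bar>) * g w')"
      using assms by (intro mult_mono) (auto simp: log_Lipschitz_def less_imp_le)
    then show ?thesis by (simp add: distrib_right exp_add mult_ac)
  qed
  then show ?thesis using assms by (auto simp: log_Lipschitz_def)
qed

lemma log_Lipschitz_inverse:
  assumes "log_Lipschitz k f" shows "log_Lipschitz k (\<lambda>w. inverse (f w))"
proof -
  have "inverse (f w) \<le> exp (k * \<bar>w - w'\<bar>) * inverse (f w')" for w w'
  proof -
    have "f w' \<le> exp (k * \<bar>w - w'\<bar>) * f w" "0 < f w" "0 < f w'"
      using assms by (auto simp: log_Lipschitz_def abs_minus_commute)
    then show ?thesis by (simp add: field_simps)
  qed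
  then show ?thesis using assms by (auto simp: log_Lipschitz_def)
qed

lemma log_Lipschitz_divide:
  assumes "log_Lipschitz k f" "log_Lipschitz l g" shows "log_Lipschitz (k + l) (\<lambda>w. f w / g w)"
  unfolding divide_inverse by (intro log_Lipschitz_mult log_Lipschitz_inverse assms)

text \<open>A negative exponent reverses the inequality and then uses the other of the two bounds,
  whence the absolute value. Both signs occur, since \<open>expo\<close> is negative in dimension
  three.\<close>

lemma powr_comparable:
  fixes x y m c :: real
  assumes "0 < x" "0 < y" "0 < m" "x \<le> m * y" "y \<le> m * x"
  shows "x powr c \<le> m powr \<bar>c\<bar> * y powr c"
proof (cases "0 \<le> c")
  case True
  then have "x powr c \<le> (m * y) powr c" using assms by (intro powr_mono2) auto
  then show ?thesis using True assms by (simp add: powr_mult)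
next
  case False
  have "x powr c \<le> (y / m) powr c" using assms False by (intro powr_mono2') (auto simp: field_simps)
  also have "\<dots> = m powr \<bar>c\<bar> * y powr c"
    using assms False by (simp add: powr_divide powr_minus_divide field_simps)
  finally show ?thesis .
qed

lemma log_Lipschitz_powr:
  assumes "log_Lipschitz k f" shows "log_Lipschitz (k * \<bar>c\<bar>) (\<lambda>w. f w powr c)"
proof -
  have "f w powr c \<le> exp (k * \<bar>c\<bar> * \<bar>w - w'\<bar>) * f w' powr c" for w w'
  proof -
    have "f w powr c \<le> exp (k * \<bar>w - w'\<bar>) powr \<bar>c\<bar> * f w' powr c"
    proof (rule powr_comparable)
      show "f w' \<le> exp (k * \<bar>w - w'\<bar>) * f w"
        using assms abs_minus_commute[of w w'] by (simp add: log_Lipschitz_def)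
    qed (use assms in \<open>auto simp: log_Lipschitz_def\<close>)
    then show ?thesis by (simp add: powr_def mult_ac)
  qed
  then show ?thesis using assms by (auto simp: log_Lipschitz_def) (metis less_irrefl)
qed

text \<open>A relative change of at most \<open>1 - exp (- d) \<le> d\<close> becomes an absolute
  one as soon as the values are bounded above.\<close>

lemma log_Lipschitz_imp_Lipschitz:
  assumes f: "log_Lipschitz k f" and "0 \<le> k" "f w \<le> B" "f w' \<le> B"
  shows "\<bar>f w - f w'\<bar> \<le> k * B * \<bar>w - w'\<bar>"
proof -
  have *: "f x - f y \<le> k * B * \<bar>x - y\<bar>" if "f x \<le> B" for x y
  proof -
    have pos: "0 < f x" using f by (auto simp: log_Lipschitz_def)
    have "f x \<le> exp (k * \<bar>x - y\<bar>) * f y" using f by (auto simp: log_Lipschitz_def)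
    then have "exp (- (k * \<bar>x - y\<bar>)) * f x \<le> f y" by (simp add: exp_minus field_simps)
    then have "f x - f y \<le> (1 - exp (- (k * \<bar>x - y\<bar>))) * f x" by (simp add: algebra_simps)
    also have "\<dots> \<le> (k * \<bar>x - y\<bar>) * f x"
      using exp_ge_add_one_self[of "- (k * \<bar>x - y\<bar>)"] pos by (intro mult_right_mono) auto
    also have "\<dots> \<le> (k * \<bar>x - y\<bar>) * B"
      using \<open>0 \<le> k\<close> that by (intro mult_left_mono) auto
    finally show ?thesis by (simp add: mult_ac)
  qed
  show ?thesis using *[of w w'] *[of w' w] assms by (auto simp: abs_le_iff abs_minus_commute)
qed


section \<open>Bounds for the slope of the extremal field\<close>

locale energy_coefficients =
  fixes n :: nat and a b :: real
  assumes n3: "3 \<le> n" and a_pos: "0 < a" and b_pos: "0 < b"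
begin

abbreviation "G \<equiv> G_rhs n a b"

text \<open>This is the squared Hilbert-Schmidt norm of the differential of a radial map whose
  stretch is \<open>t\<close> in the \<open>n - 1\<close> tangential directions and \<open>y\<close>
  in the radial one. The inverse map has the stretches \<open>1 / t\<close> and
  \<open>1 / y\<close>, and its squared norm is \<open>quad_form y t / (t * y)^2\<close>; hence the
  second occurrence with exchanged arguments.\<close>

definition "quad_form t y = (real n - 1) * t\<^sup>2 + y\<^sup>2"
definition "expo = (real n - 4) / 2"
definition "mixed_form t y = quad_form t y + (real n - 2) * t * y"

lemma quad_form_pos: "0 < t \<Longrightarrow> 0 < y \<Longrightarrow> 0 < quad_form t y"
  using n3 unfolding quad_form_def by (auto intro!: add_pos_pos mult_pos_pos)

lemma mixed_form_pos: "0 < t \<Longrightarrow> 0 < y \<Longrightarrow> 0 < mixed_form t y"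
  using n3 quad_form_pos[of t y] unfolding mixed_form_def by (auto intro!: add_pos_nonneg mult_nonneg_nonneg)

lemma U_eq: "U_coef n a t y = a * quad_form t y powr expo * mixed_form t y"
  by (simp add: U_coef_def quad_form_def expo_def mixed_form_def algebra_simps)

lemma V_eq: "V_coef n b t y = b * quad_form y t powr expo * mixed_form y t / (t * y ^ (n - 1))"
  by (simp add: V_coef_def quad_form_def expo_def mixed_form_def algebra_simps)

text \<open>Up to the factor \<open>n * (n - 1)\<close> these are the second derivatives in
  \<open>y\<close> of the two weighted Lagrangians \<open>a * lag_A\<close> and
  \<open>b * lag_B\<close> below. Their positivity is strict convexity in the slope.\<close>

definition "Wa t y = (t\<^sup>2 + y\<^sup>2) * (a * quad_form t y powr expo)"
definition "Wb t y = (t\<^sup>2 + y\<^sup>2) * (b * (t * quad_form y t powr expo) / y ^ (n + 1))"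

lemma W_eq: "W_coef n a b t y = Wa t y + Wb t y"
  by (simp add: W_coef_def quad_form_def expo_def Wa_def Wb_def algebra_simps)

lemma U_pos: "0 < t \<Longrightarrow> 0 < y \<Longrightarrow> 0 < U_coef n a t y"
  and V_pos: "0 < t \<Longrightarrow> 0 < y \<Longrightarrow> 0 < V_coef n b t y"
  and Wa_pos: "0 < t \<Longrightarrow> 0 < y \<Longrightarrow> 0 < Wa t y"
  and Wb_pos: "0 < t \<Longrightarrow> 0 < y \<Longrightarrow> 0 < Wb t y"
  using quad_form_pos[of t y] quad_form_pos[of y t] mixed_form_pos[of t y] mixed_form_pos[of y t] a_pos b_pos
  by (auto simp: U_eq V_eq Wa_def Wb_def intro!: mult_pos_pos divide_pos_pos add_pos_pos)

lemma W_pos: "0 < t \<Longrightarrow> 0 < y \<Longrightarrow> 0 < W_coef n a b t y"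
  using Wa_pos Wb_pos by (auto simp: W_eq add_pos_pos)

lemma G_eq: "G t y = - ((U_coef n a t y + V_coef n b t y) / W_coef n a b t y)"
  by (simp only: G_rhs_def minus_divide_left)

lemma G_neg: "0 < t \<Longrightarrow> 0 < y \<Longrightarrow> G t y < 0"
  using U_pos[of t y] V_pos[of t y] W_pos[of t y] unfolding G_rhs_def by (intro divide_neg_pos) auto

lemma mixed_form_le: "0 < t \<Longrightarrow> 0 < y \<Longrightarrow> mixed_form t y \<le> 2 * real n * (t\<^sup>2 + y\<^sup>2)"
proof -
  assume "0 < t" "0 < y"
  have "(real n - 2) * (2 * (t * y)) \<le> (real n - 2) * (t\<^sup>2 + y\<^sup>2)"
    using n3 sum_squares_bound[of t y] by (intro mult_left_mono) auto
  moreover have "2 * real n * (t\<^sup>2 + y\<^sup>2) - mixed_form t y = ((real n - 2) * (t\<^sup>2 + y\<^sup>2) - (real n - 2) * (2 * (t * y))) / 2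
      + ((real n - 2) * y\<^sup>2 + (real n + 4) / 2 * (t\<^sup>2 + y\<^sup>2))"
    by (simp add: mixed_form_def quad_form_def field_simps)
  moreover have "0 \<le> \<dots>"
    using n3 calculation(1) by (intro add_nonneg_nonneg divide_nonneg_pos mult_nonneg_nonneg) auto
  ultimately have "0 \<le> 2 * real n * (t\<^sup>2 + y\<^sup>2) - mixed_form t y" by (simp only:)
  then show ?thesis by simp
qed

text \<open>Minus the slope of the extremal field in the coordinates \<open>(ln t, ln y)\<close>.\<close>

definition "slope t y = - G t y * t / y"

lemma slope_pos: "0 < t \<Longrightarrow> 0 < y \<Longrightarrow> 0 < slope t y"
  using G_neg[of t y] unfolding slope_def by (intro divide_pos_pos mult_pos_pos) auto

definition "\<kappa> = real n powr \<bar>expo\<bar>"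

text \<open>The two squares carry the coefficients \<open>n - 1\<close> and \<open>1\<close>, so
  exchanging the arguments changes the form by at most the factor \<open>n\<close>. As a consequence
  \<open>Wa\<close> and \<open>Wb\<close> differ, up to constants, only by the power
  \<open>y ^ (n + 1) / t\<close>.\<close>

lemma quad_form_comparable: "0 < t \<Longrightarrow> 0 < y \<Longrightarrow> quad_form t y powr expo \<le> \<kappa> * quad_form y t powr expo"
  unfolding \<kappa>_def
proof (rule powr_comparable)
  have *: "quad_form t y \<le> n * quad_form y t" for t y
  proof -
    have "0 \<le> t\<^sup>2 + y\<^sup>2 * ((real n)\<^sup>2 - n - 1)"
    proof -
      have "real n * 3 \<le> real n * n" using n3 by (intro mult_left_mono) auto
      moreover have "3 \<le> real n" using n3 by simp
      ultimately have "0 \<le> (real n)\<^sup>2 - n - 1" unfolding power2_eq_square by linarith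
      then show ?thesis by simp
    qed
    then show ?thesis by (simp add: quad_form_def algebra_simps power2_eq_square)
  qed
  show "quad_form t y \<le> n * quad_form y t" "quad_form y t \<le> n * quad_form t y" by (rule *)+
qed (use n3 quad_form_pos in auto)

lemma U_le_Wa: "0 < t \<Longrightarrow> 0 < y \<Longrightarrow> U_coef n a t y \<le> 2 * real n * Wa t y"
proof -
  assume ty: "0 < t" "0 < y"
  have "a * quad_form t y powr expo * mixed_form t y \<le> a * quad_form t y powr expo * (2 * real n * (t\<^sup>2 + y\<^sup>2))"
    using ty a_pos by (intro mult_left_mono mixed_form_le) auto
  then show ?thesis by (simp add: U_eq Wa_def algebra_simps)
qed

lemma V_le_Wb: "0 < t \<Longrightarrow> 0 < y \<Longrightarrow> V_coef n b t y \<le> 2 * real n * (y / t)\<^sup>2 * Wb t y"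
proof -
  assume ty: "0 < t" "0 < y"
  have "V_coef n b t y \<le> b * quad_form y t powr expo * (2 * real n * (y\<^sup>2 + t\<^sup>2)) / (t * y ^ (n - 1))"
    unfolding V_eq using ty b_pos by (intro divide_right_mono mult_left_mono mixed_form_le) auto
  also have "\<dots> = 2 * real n * (y / t)\<^sup>2 * Wb t y"
  proof -
    have "y ^ (n + 1) = y ^ (n - 1) * y\<^sup>2" using n3 by (simp flip: power_add)
    then show ?thesis using ty by (simp add: Wb_def field_simps power2_eq_square)
  qed
  finally show ?thesis .
qed

lemma Wa_le_Wb: "0 < t \<Longrightarrow> 0 < y \<Longrightarrow> Wa t y \<le> \<kappa> * (a / b) * y ^ (n + 1) / t * Wb t y"
proof -
  assume ty: "0 < t" "0 < y"
  have "Wa t y \<le> (t\<^sup>2 + y\<^sup>2) * (a * (\<kappa> * quad_form y t powr expo))"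
    unfolding Wa_def using ty a_pos by (intro mult_left_mono quad_form_comparable) auto
  also have "\<dots> = \<kappa> * (a / b) * y ^ (n + 1) / t * Wb t y"
    using ty b_pos by (simp add: Wb_def)
  finally show ?thesis .
qed

lemma Wb_le_Wa: "0 < t \<Longrightarrow> 0 < y \<Longrightarrow> Wb t y \<le> \<kappa> * (b / a) * t / y ^ (n + 1) * Wa t y"
proof -
  assume ty: "0 < t" "0 < y"
  have "Wb t y \<le> (t\<^sup>2 + y\<^sup>2) * (b * (t * (\<kappa> * quad_form t y powr expo)) / y ^ (n + 1))"
    unfolding Wb_def using ty b_pos by (intro mult_left_mono divide_right_mono quad_form_comparable) auto
  also have "\<dots> = \<kappa> * (b / a) * t / y ^ (n + 1) * Wa t y"
    using ty a_pos by (simp add: Wa_def)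
  finally show ?thesis .
qed

text \<open>Only one of the two parts of \<open>W\<close> is kept in the denominator; which part is
  large enough depends on the region of the quadrant.\<close>

lemma slope_le:
  assumes "0 < t" "0 < y" "0 < w" "w \<le> W_coef n a b t y"
    "U_coef n a t y \<le> c * w" "V_coef n b t y \<le> d * w"
  shows "slope t y \<le> (c + d) * t / y"
proof -
  have "(U_coef n a t y + V_coef n b t y) / W_coef n a b t y \<le> (U_coef n a t y + V_coef n b t y) / w"
    using assms U_pos[of t y] V_pos[of t y] by (intro divide_left_mono) auto
  also have "\<dots> \<le> c + d" using assms by (simp add: divide_le_eq algebra_simps)
  finally have "- G t y \<le> c + d" by (simp only: G_eq minus_minus)
  then have "- G t y * (t / y) \<le> (c + d) * (t / y)" using assms by (intro mult_right_mono) auto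
  then show ?thesis by (simp add: slope_def)
qed

text \<open>A decreasing solution through \<open>(t0, y0)\<close> lies in this region for all later
  arguments. Keeping \<open>Wb\<close> in the denominator, the contributions of \<open>U\<close> and
  \<open>V\<close> reduce to multiples of \<open>y ^ n\<close> and \<open>y / t\<close>, which are
  bounded there.\<close>

lemma slope_le_right:
  assumes "0 < t0" "0 < y" "t0 \<le> t" "y \<le> y0"
  shows "slope t y \<le> 2 * real n * (\<kappa> * (a / b) * y0 ^ n + y0 / t0)"
proof -
  have ty: "0 < t" "0 < y" "0 < y0" using assms by auto
  have "U_coef n a t y \<le> 2 * real n * (\<kappa> * (a / b) * y ^ (n + 1) / t * Wb t y)"
    using U_le_Wa[OF ty(1,2)] mult_left_mono[OF Wa_le_Wb[OF ty(1,2)], of "2 * real n"] by simp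
  then have U: "U_coef n a t y \<le> (2 * real n * (\<kappa> * (a / b) * y ^ (n + 1) / t)) * Wb t y" by (simp add: mult_ac)
  have "slope t y \<le> (2 * real n * (\<kappa> * (a / b) * y ^ (n + 1) / t) + 2 * real n * (y / t)\<^sup>2) * t / y"
    by (rule slope_le[OF ty(1,2) Wb_pos[OF ty(1,2)] _ U V_le_Wb[OF ty(1,2)]])
       (use Wa_pos[OF ty(1,2)] in \<open>simp add: W_eq\<close>)
  also have "\<dots> = 2 * real n * (\<kappa> * (a / b) * y ^ n + y / t)"
    using ty by (simp add: field_simps power2_eq_square)
  also have "\<dots> \<le> 2 * real n * (\<kappa> * (a / b) * y0 ^ n + y0 / t0)"
    using assms a_pos b_pos unfolding \<kappa>_def by (intro mult_left_mono add_mono power_mono frac_le) auto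
  finally show ?thesis .
qed

text \<open>The region to which the same solution is confined for earlier arguments. Here
  \<open>Wa\<close> is kept, and \<open>V\<close> and \<open>U\<close> contribute multiples of
  \<open>1 / y ^ n\<close> and \<open>t / y\<close>.\<close>

lemma slope_le_left:
  assumes "0 < t" "0 < y0" "t \<le> t0" "y0 \<le> y"
  shows "slope t y \<le> 2 * real n * (\<kappa> * (b / a) / y0 ^ n + t0 / y0)"
proof -
  have ty: "0 < t" "0 < y" "0 < t0" using assms by auto
  have "V_coef n b t y \<le> 2 * real n * (y / t)\<^sup>2 * (\<kappa> * (b / a) * t / y ^ (n + 1) * Wa t y)"
    using V_le_Wb[OF ty(1,2)] mult_left_mono[OF Wb_le_Wa[OF ty(1,2)], of "2 * real n * (y / t)\<^sup>2"] by simp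
  then have V: "V_coef n b t y \<le> (2 * real n * (y / t)\<^sup>2 * (\<kappa> * (b / a) * t / y ^ (n + 1))) * Wa t y"
    by (simp only: mult_ac)
  have "slope t y \<le> (2 * real n + 2 * real n * (y / t)\<^sup>2 * (\<kappa> * (b / a) * t / y ^ (n + 1))) * t / y"
    by (rule slope_le[OF ty(1,2) Wa_pos[OF ty(1,2)] _ U_le_Wa[OF ty(1,2)] V])
       (use Wb_pos[OF ty(1,2)] in \<open>simp add: W_eq\<close>)
  also have "\<dots> = 2 * real n * (\<kappa> * (b / a) / y ^ n + t / y)"
    using ty by (simp add: field_simps power2_eq_square)
  also have "\<dots> \<le> 2 * real n * (\<kappa> * (b / a) / y0 ^ n + t0 / y0)"
    using assms a_pos b_pos unfolding \<kappa>_def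
    by (intro mult_left_mono add_mono divide_left_mono power_mono frac_le) auto
  finally show ?thesis .
qed

text \<open>The constants of the three factors of the slope added up:
  \<open>2 * \<bar>expo\<bar> + n + 1\<close> for the numerator \<open>U + V\<close>,
  \<open>2 * \<bar>expo\<bar> + n + 3\<close> for \<open>W\<close>, and \<open>1\<close> for the
  division by \<open>y\<close>.\<close>

definition "slope_lip = 4 * \<bar>expo\<bar> + 2 * n + 5"

lemma log_Lipschitz_slope:
  assumes t: "0 < t" shows "log_Lipschitz slope_lip (\<lambda>w. slope t (exp w))"
proof -
  let ?p = "2 * \<bar>expo\<bar>"
  have nr: "real n - 2 > 0" "real n - 1 > 0" using n3 by auto
  have e1: "log_Lipschitz 2 exp" using log_Lipschitz_exp_power[of 1 2] by simp
  have e2: "log_Lipschitz 2 (\<lambda>w. (exp w)\<^sup>2)" using log_Lipschitz_exp_power[of 2 2] by simp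
  have c2: "log_Lipschitz 2 (\<lambda>w. c)" if "0 < c" for c using that by (simp add: log_Lipschitz_const)
  have c0: "log_Lipschitz 0 (\<lambda>w. c)" if "0 < c" for c using that by (simp add: log_Lipschitz_const)
  have cm: "log_Lipschitz k (\<lambda>w. c * f w)" if "log_Lipschitz k f" "0 < c" for k c f
    using log_Lipschitz_mult[OF c0[OF that(2)] that(1)] by simp
  have P1: "log_Lipschitz 2 (\<lambda>w. quad_form t (exp w))"
    unfolding quad_form_def using t nr by (intro log_Lipschitz_add e2 c2) auto
  have P2: "log_Lipschitz 2 (\<lambda>w. quad_form (exp w) t)"
    unfolding quad_form_def using t nr by (intro log_Lipschitz_add cm e2 c2) auto
  have R1: "log_Lipschitz 2 (\<lambda>w. mixed_form t (exp w))"
    unfolding mixed_form_def using t nr by (intro log_Lipschitz_add P1 cm e1) auto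
  have "log_Lipschitz 2 (\<lambda>w. quad_form (exp w) t + (real n - 2) * t * exp w)"
    using t nr by (intro log_Lipschitz_add P2 cm e1) auto
  then have R2: "log_Lipschitz 2 (\<lambda>w. mixed_form (exp w) t)"
    unfolding mixed_form_def by (simp add: mult_ac)
  have U: "log_Lipschitz (?p + 2) (\<lambda>w. U_coef n a t (exp w))"
    unfolding U_eq using a_pos by (intro log_Lipschitz_mult[OF cm] log_Lipschitz_powr P1 R1)
  have V: "log_Lipschitz (?p + 2 + real (n - 1)) (\<lambda>w. V_coef n b t (exp w))"
    unfolding V_eq using b_pos t
    by (intro log_Lipschitz_divide log_Lipschitz_mult[OF cm] log_Lipschitz_powr P2 R2 cm log_Lipschitz_exp_power) auto
  have UV: "log_Lipschitz (?p + real n + 1) (\<lambda>w. U_coef n a t (exp w) + V_coef n b t (exp w))"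
    using n3 by (intro log_Lipschitz_add log_Lipschitz_mono[OF U] log_Lipschitz_mono[OF V]) auto
  have S: "log_Lipschitz 2 (\<lambda>w. t\<^sup>2 + (exp w)\<^sup>2)" using t by (intro log_Lipschitz_add e2 c2) auto
  have Wa: "log_Lipschitz (2 + ?p) (\<lambda>w. Wa t (exp w))"
    unfolding Wa_def using a_pos by (intro log_Lipschitz_mult S cm log_Lipschitz_powr P1)
  have Wb: "log_Lipschitz (2 + (?p + real (n + 1))) (\<lambda>w. Wb t (exp w))"
    unfolding Wb_def using b_pos t by (intro log_Lipschitz_mult S log_Lipschitz_divide cm log_Lipschitz_powr P2 log_Lipschitz_exp_power) auto
  have W: "log_Lipschitz (?p + real n + 3) (\<lambda>w. W_coef n a b t (exp w))"
    unfolding W_eq using n3 by (intro log_Lipschitz_add log_Lipschitz_mono[OF Wa] log_Lipschitz_mono[OF Wb]) auto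
  have "log_Lipschitz (((?p + real n + 1) + (?p + real n + 3)) + 1)
     (\<lambda>w. t * ((U_coef n a t (exp w) + V_coef n b t (exp w)) / W_coef n a b t (exp w)) / exp w)"
    using t log_Lipschitz_exp_power[of 1 1] by (intro log_Lipschitz_divide cm UV W) auto
  moreover have "((?p + real n + 1) + (?p + real n + 3)) + 1 = slope_lip" by (simp add: slope_lip_def)
  ultimately show ?thesis by (simp only: slope_def G_eq minus_minus mult.commute)
qed

lemma slope_lip_nonneg: "0 \<le> slope_lip" by (simp add: slope_lip_def)

lemma slope_Lipschitz:
  assumes "0 < t" "slope t (exp w) \<le> B" "slope t (exp w') \<le> B"
  shows "\<bar>slope t (exp w) - slope t (exp w')\<bar> \<le> slope_lip * B * \<bar>w - w'\<bar>"
  using log_Lipschitz_imp_Lipschitz[OF log_Lipschitz_slope[OF assms(1)] slope_lip_nonneg] assms by auto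

lemma continuous_on_slope:
  assumes "continuous_on A f" "continuous_on A g" "\<And>z. z \<in> A \<Longrightarrow> 0 < f z" "\<And>z. z \<in> A \<Longrightarrow> 0 < g z"
  shows "continuous_on A (\<lambda>z. slope (f z) (g z))"
proof -
  have *: "f z \<noteq> 0" "g z \<noteq> 0" "quad_form (f z) (g z) \<noteq> 0" "quad_form (g z) (f z) \<noteq> 0" "Wa (f z) (g z) + Wb (f z) (g z) \<noteq> 0" if "z \<in> A" for z
    using assms that quad_form_pos[of "f z" "g z"] quad_form_pos[of "g z" "f z"] Wa_pos[of "f z" "g z"] Wb_pos[of "f z" "g z"]
    by (force, force, force, force, force)
  have quad_form: "continuous_on A (\<lambda>z. quad_form (f z) (g z))" "continuous_on A (\<lambda>z. quad_form (g z) (f z))"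
    unfolding quad_form_def by (intro continuous_intros assms)+
  have expo: "continuous_on A (\<lambda>z. quad_form (f z) (g z) powr expo)" "continuous_on A (\<lambda>z. quad_form (g z) (f z) powr expo)"
    by (rule continuous_on_powr[OF quad_form(1) continuous_on_const] continuous_on_powr[OF quad_form(2) continuous_on_const], use * in blast)+
  have W: "continuous_on A (\<lambda>z. Wa (f z) (g z))" "continuous_on A (\<lambda>z. Wb (f z) (g z))"
    unfolding Wa_def Wb_def using * by (intro continuous_intros assms expo; simp)+
  show ?thesis
    unfolding slope_def G_rhs_def W_eq U_eq V_eq mixed_form_def using * by (intro continuous_intros assms expo quad_form W; simp)
qed

end

text \<open>Glues a solution that runs forward from \<open>u0\<close> to one that runs backward. The
  latter is traversed in reverse, which accounts for the sign in the matching condition on the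
  slopes.\<close>

lemma has_real_derivative_join:
  fixes x1 x2 d1 d2 :: "real \<Rightarrow> real"
  assumes 1: "\<And>v. 0 \<le> v \<Longrightarrow> (x1 has_real_derivative d1 v) (at v within {0..})"
    and 2: "\<And>v. 0 \<le> v \<Longrightarrow> (x2 has_real_derivative d2 v) (at v within {0..})"
    and "x1 0 = x2 0" "d1 0 = - d2 0"
  shows "((\<lambda>u. if u0 \<le> u then x1 (u - u0) else x2 (u0 - u)) has_real_derivative
    (if u0 \<le> u then d1 (u - u0) else - d2 (u0 - u))) (at u)" (is "(?W has_real_derivative _) _")
proof -
  have r: "(?W has_real_derivative d1 (u - u0)) (at u within {u0..})" if "u0 \<le> u"
  proof -
    have "(x1 has_real_derivative d1 (u - u0)) (at (u - u0) within (\<lambda>u. u - u0) ` {u0..})"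
      by (rule has_field_derivative_subset[OF 1]) (use that in auto)
    moreover have "((\<lambda>u. u - u0) has_real_derivative 1) (at u within {u0..})" by (auto intro!: derivative_eq_intros)
    ultimately have "((\<lambda>u. x1 (u - u0)) has_real_derivative d1 (u - u0)) (at u within {u0..})"
      using DERIV_image_chain[of x1 _ "\<lambda>u. u - u0" u "{u0..}" 1] by (simp add: o_def)
    then show ?thesis
      by (rule has_field_derivative_transform_within[OF _ zero_less_one]) (use that in auto)
  qed
  have l: "(?W has_real_derivative - d2 (u0 - u)) (at u within {..u0})" if "u \<le> u0"
  proof -
    have "(x2 has_real_derivative d2 (u0 - u)) (at (u0 - u) within (\<lambda>u. u0 - u) ` {..u0})"
      by (rule has_field_derivative_subset[OF 2]) (use that in auto)
    moreover have "((\<lambda>u. u0 - u) has_real_derivative - 1) (at u within {..u0})" by (auto intro!: derivative_eq_intros)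
    ultimately have "((\<lambda>u. x2 (u0 - u)) has_real_derivative - d2 (u0 - u)) (at u within {..u0})"
      using DERIV_image_chain[of x2 _ "\<lambda>u. u0 - u" u "{..u0}" "-1"] by (simp add: o_def)
    then show ?thesis
      by (rule has_field_derivative_transform_within[OF _ zero_less_one]) (use that assms in \<open>auto split: if_splits\<close>)
  qed
  consider "u0 < u" | "u < u0" | "u = u0" by linarith
  then show ?thesis
  proof cases
    case 1
    then show ?thesis using r at_within_Ici_interior[OF 1] by simp
  next
    case 2
    then have "at u within {..u0} = at u" by (intro at_within_interior) (auto simp: interior_real_atMost)
    with l 2 show ?thesis by simp
  next
    case 3
    have "at u = sup (at u within {u0..}) (at u within {..u0})"
    proof -
      have "{u0..} \<union> {..u0} = UNIV" by auto
      then show ?thesis using at_within_union[of u "{u0..}" "{..u0}"] by simp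
    qed
    then show ?thesis using r l 3 assms
      unfolding has_field_derivative_iff by (simp add: filterlim_sup)
  qed
qed

section \<open>Global solutions of the slope equation and their dependence on the parameter\<close>

context energy_coefficients
begin

definition "solution F \<longleftrightarrow> (\<forall>t>0. 0 < F t \<and> (F has_real_derivative G t (F t)) (at t))"

lemma solution_decreasing:
  assumes "solution F" "0 < s" "s < t" shows "F t < F s"
proof (rule DERIV_neg_imp_decreasing[OF \<open>s < t\<close>])
  fix x assume "s \<le> x" "x \<le> t"
  then have x: "0 < x" using assms by simp
  then show "\<exists>d. (F has_real_derivative d) (at x) \<and> d < 0"
    using assms G_neg[OF x, of "F x"] by (intro exI[of _ "G x (F x)"]) (auto simp: solution_def)
qed

lemma solution_antimono: "solution F \<Longrightarrow> 0 < s \<Longrightarrow> s \<le> t \<Longrightarrow> F t \<le> F s"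
  using solution_decreasing[of F s t] by (cases "s = t") auto

lemma solution_continuous_on: "solution F \<Longrightarrow> continuous_on {0<..} F"
  by (rule DERIV_continuous_on[of _ _ "\<lambda>t. G t (F t)"]) (auto simp: solution_def intro: has_field_derivative_at_within)

text \<open>With \<open>u = ln t\<close> and \<open>w = ln y\<close> the equation reads
  \<open>w' = - slope\<close>. To the right of \<open>u0\<close> the drop \<open>x1 = w0 - w\<close>
  is solved for, to the left the rise \<open>x2 = w - w0\<close> in reversed time. Both stay
  nonnegative, so each half remains where the slope is bounded; by log-Lipschitz continuity the
  equation is then globally Lipschitz in \<open>w\<close>.\<close>

lemma solution_exists:
  assumes t0: "0 < t0" and y0: "0 < y0"
  shows "\<exists>F. solution F \<and> F t0 = y0"
proof -
  define u0 w0 where "u0 = ln t0" and "w0 = ln y0"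
  have e0: "exp u0 = t0" "exp w0 = y0" using assms by (auto simp: u0_def w0_def)
  define B1 where "B1 = 2 * real n * (\<kappa> * (a / b) * y0 ^ n + y0 / t0)"
  define k1 where "k1 v x = slope (exp (u0 + v)) (exp (w0 - max x 0))" for v x
  have k1_pos: "0 < k1 v x" for v x by (simp add: k1_def slope_pos)
  have k1_le: "k1 v x \<le> B1" if "0 \<le> v" for v x
    unfolding k1_def B1_def by (rule slope_le_right) (use that assms in \<open>auto simp: exp_add exp_diff e0 field_simps\<close>)
  obtain x1 where x1: "x1 0 = 0" "\<And>v. 0 \<le> v \<Longrightarrow> (x1 has_real_derivative k1 v (x1 v)) (at v within {0..})"
  proof (rule ode_exists_forward[of k1 "slope_lip * B1" 0 B1])
    show "continuous_on ({0..} \<times> UNIV) (\<lambda>z. k1 (fst z) (snd z))"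
      unfolding k1_def by (intro continuous_on_slope continuous_intros) auto
    show "\<bar>k1 v x - k1 v y\<bar> \<le> slope_lip * B1 * \<bar>x - y\<bar>" if "0 \<le> v" for v x y
    proof -
      have "\<bar>k1 v x - k1 v y\<bar> \<le> slope_lip * B1 * \<bar>(w0 - max x 0) - (w0 - max y 0)\<bar>"
        using k1_le[OF that, of x] k1_le[OF that, of y] unfolding k1_def by (intro slope_Lipschitz) auto
      also have "\<dots> \<le> slope_lip * B1 * \<bar>x - y\<bar>"
        using k1_pos[of 0 0] k1_le[of 0 0] slope_lip_nonneg by (intro mult_left_mono mult_nonneg_nonneg) auto
      finally show ?thesis .
    qed
    show "\<bar>k1 v 0\<bar> \<le> B1" if "0 \<le> v" for v using k1_pos[of v 0] k1_le[OF that, of 0] by simp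
  qed auto
  define B2 where "B2 = 2 * real n * (\<kappa> * (b / a) / y0 ^ n + t0 / y0)"
  define k2 where "k2 v x = slope (exp (u0 - v)) (exp (w0 + max x 0))" for v x
  have k2_pos: "0 < k2 v x" for v x by (simp add: k2_def slope_pos)
  have k2_le: "k2 v x \<le> B2" if "0 \<le> v" for v x
    unfolding k2_def B2_def by (rule slope_le_left) (use that assms in \<open>auto simp: exp_add exp_diff e0 field_simps\<close>)
  obtain x2 where x2: "x2 0 = 0" "\<And>v. 0 \<le> v \<Longrightarrow> (x2 has_real_derivative k2 v (x2 v)) (at v within {0..})"
  proof (rule ode_exists_forward[of k2 "slope_lip * B2" 0 B2])
    show "continuous_on ({0..} \<times> UNIV) (\<lambda>z. k2 (fst z) (snd z))"
      unfolding k2_def by (intro continuous_on_slope continuous_intros) auto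
    show "\<bar>k2 v x - k2 v y\<bar> \<le> slope_lip * B2 * \<bar>x - y\<bar>" if "0 \<le> v" for v x y
    proof -
      have "\<bar>k2 v x - k2 v y\<bar> \<le> slope_lip * B2 * \<bar>(w0 + max x 0) - (w0 + max y 0)\<bar>"
        using k2_le[OF that, of x] k2_le[OF that, of y] unfolding k2_def by (intro slope_Lipschitz) auto
      also have "\<dots> \<le> slope_lip * B2 * \<bar>x - y\<bar>"
        using k2_pos[of 0 0] k2_le[of 0 0] slope_lip_nonneg by (intro mult_left_mono mult_nonneg_nonneg) auto
      finally show ?thesis .
    qed
    show "\<bar>k2 v 0\<bar> \<le> B2" if "0 \<le> v" for v using k2_pos[of v 0] k2_le[OF that, of 0] by simp
  qed auto
  have nonneg: "0 \<le> x v" if "\<And>v. 0 \<le> v \<Longrightarrow> (x has_real_derivative k v (x v)) (at v within {0..})"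
    "\<And>v z. 0 < k v z" "x 0 = 0" "0 \<le> v" for x :: "real \<Rightarrow> real" and k v
    using nonpos_derivative_antimono_forward[of 0 "\<lambda>v. - x v" "\<lambda>v. - k v (x v)" 0 v] that
    by (auto simp: DERIV_minus less_imp_le)
  define W where "W u = (if u0 \<le> u then w0 - x1 (u - u0) else w0 + x2 (u0 - u))" for u
  have W': "(W has_real_derivative - slope (exp u) (exp (W u))) (at u)" for u
  proof -
    have "(W has_real_derivative (if u0 \<le> u then - k1 (u - u0) (x1 (u - u0)) else - k2 (u0 - u) (x2 (u0 - u)))) (at u)"
      unfolding W_def
      by (rule has_real_derivative_join[of "\<lambda>v. w0 - x1 v" "\<lambda>v. - k1 v (x1 v)" "\<lambda>v. w0 + x2 v" "\<lambda>v. k2 v (x2 v)"])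
         (auto intro!: derivative_eq_intros x1 x2 simp: x1 x2, simp add: k1_def k2_def)
    moreover have "0 \<le> x1 (u - u0)" if "u0 \<le> u" using nonneg[of x1 k1, OF x1(2) k1_pos x1(1)] that by simp
    moreover have "0 \<le> x2 (u0 - u)" if "u \<le> u0" using nonneg[of x2 k2, OF x2(2) k2_pos x2(1)] that by simp
    ultimately show ?thesis by (auto simp: W_def k1_def k2_def split: if_splits)
  qed
  have "((\<lambda>t. exp (W (ln t))) has_real_derivative G t (exp (W (ln t)))) (at t)" if "0 < t" for t
  proof -
    have "((\<lambda>t. exp (W (ln t))) has_real_derivative exp (W (ln t)) * (- slope (exp (ln t)) (exp (W (ln t))) * (1 / t))) (at t)"
      by (rule DERIV_chain2[OF DERIV_exp DERIV_chain2[OF W']])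
         (use that in \<open>auto intro!: derivative_eq_intros\<close>)
    moreover have "exp (W (ln t)) * (- slope (exp (ln t)) (exp (W (ln t))) * (1 / t)) = G t (exp (W (ln t)))"
      using that by (simp add: slope_def)
    ultimately show ?thesis by simp
  qed
  then have "solution (\<lambda>t. exp (W (ln t)))" by (simp add: solution_def)
  moreover have "exp (W (ln t0)) = y0" by (simp add: W_def x1 flip: u0_def) (simp add: e0)
  ultimately show ?thesis by blast
qed

lemma solution_ln_deriv:
  assumes "solution F"
  shows "((\<lambda>u. ln (F (exp u))) has_real_derivative - slope (exp u) (exp (ln (F (exp u))))) (at u)"
proof -
  have F: "0 < F (exp u)" "(F has_real_derivative G (exp u) (F (exp u))) (at (exp u))"
    using assms by (auto simp: solution_def)
  have "((\<lambda>u. ln (F (exp u))) has_real_derivative 1 / F (exp u) * (G (exp u) (F (exp u)) * exp u)) (at u)"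
    by (rule DERIV_chain2[OF DERIV_ln_divide[OF F(1)] DERIV_chain2[OF F(2) DERIV_exp]])
  then show ?thesis using F(1) by (simp add: slope_def)
qed

text \<open>Being decreasing, both solutions lie in the same region on either side of
  \<open>t0\<close>; there the slope bounds supply the Lipschitz constant for the forward uniqueness
  argument.\<close>

lemma solution_unique:
  assumes F1: "solution F1" and F2: "solution F2" and eq: "F1 t0 = F2 t0" and "0 < t0" "0 < t"
  shows "F1 t = F2 t"
proof -
  define w where "w F u = ln (F (exp u))" for F :: "real \<Rightarrow> real" and u
  define u0 where "u0 = ln t0"
  have e0: "exp u0 = t0" using assms by (simp add: u0_def)
  define y0 where "y0 = F1 t0"
  have y0: "0 < y0" using F1 \<open>0 < t0\<close> by (simp add: solution_def y0_def)
  have ew: "exp (w F u) = F (exp u)" if "solution F" for F u using that by (simp add: w_def solution_def)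
  have w': "(w F has_real_derivative - slope (exp u) (exp (w F u))) (at u)" if "solution F" for F u
    unfolding w_def by (rule solution_ln_deriv[OF that])
  have w0: "w F1 u0 = w F2 u0" by (simp add: w_def e0 eq)
  have lip: "\<bar>slope (exp u) (exp (w F1 u)) - slope (exp u) (exp (w F2 u))\<bar> \<le> slope_lip * B * \<bar>w F1 u - w F2 u\<bar>"
    if "\<And>F. solution F \<Longrightarrow> F t0 = y0 \<Longrightarrow> slope (exp u) (F (exp u)) \<le> B" for u B
    using that[OF F1] that[OF F2] eq by (intro slope_Lipschitz) (auto simp: ew F1 F2 y0_def)
  have sq: "(p - q) * c \<le> L * (p - q)\<^sup>2" if "\<bar>c\<bar> \<le> L * \<bar>p - q\<bar>" for p q c L :: real
  proof -
    have "(p - q) * c \<le> \<bar>p - q\<bar> * \<bar>c\<bar>" by (metis abs_ge_self abs_mult)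
    also have "\<dots> \<le> \<bar>p - q\<bar> * (L * \<bar>p - q\<bar>)" by (intro mult_left_mono that) auto
    also have "\<dots> = L * (p - q)\<^sup>2" by (simp add: power2_eq_square)
    finally show ?thesis .
  qed
  have "w F1 u = w F2 u" for u
  proof (cases "u0 \<le> u")
    case True
    define B where "B = 2 * real n * (\<kappa> * (a / b) * y0 ^ n + y0 / t0)"
    have B: "slope (exp u) (F (exp u)) \<le> B" if "solution F" "F t0 = y0" "u0 \<le> u" for F u
      unfolding B_def
    proof (rule slope_le_right)
      show "t0 \<le> exp u" using that(3) e0 by auto
      then show "F (exp u) \<le> y0" using solution_antimono[OF that(1) \<open>0 < t0\<close>] that(2) by auto
    qed (use that \<open>0 < t0\<close> in \<open>auto simp: solution_def\<close>)
    show ?thesis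
    proof (rule ode_unique_forward[where r = u0 and x = "w F1" and y = "w F2"
          and x' = "\<lambda>u. - slope (exp u) (exp (w F1 u))" and y' = "\<lambda>u. - slope (exp u) (exp (w F2 u))"
          and L = "slope_lip * B"])
      show "(w F1 has_real_derivative - slope (exp u) (exp (w F1 u))) (at u within {u0..})"
           "(w F2 has_real_derivative - slope (exp u) (exp (w F2 u))) (at u within {u0..})" for u
        using w' F1 F2 by (auto intro: has_field_derivative_at_within)
      show "(w F1 u - w F2 u) * (- slope (exp u) (exp (w F1 u)) - - slope (exp u) (exp (w F2 u)))
          \<le> slope_lip * B * (w F1 u - w F2 u)\<^sup>2" if "u0 \<le> u" for u
      proof (rule sq)
        have "\<bar>slope (exp u) (exp (w F1 u)) - slope (exp u) (exp (w F2 u))\<bar> \<le> slope_lip * B * \<bar>w F1 u - w F2 u\<bar>"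
          by (rule lip) (use B that in blast)
        then show "\<bar>- slope (exp u) (exp (w F1 u)) - - slope (exp u) (exp (w F2 u))\<bar> \<le> slope_lip * B * \<bar>w F1 u - w F2 u\<bar>"
          by (simp add: abs_minus_commute)
      qed
    qed (use w0 True in auto)
  next
    case False
    define B where "B = 2 * real n * (\<kappa> * (b / a) / y0 ^ n + t0 / y0)"
    have B: "slope (exp u) (F (exp u)) \<le> B" if "solution F" "F t0 = y0" "u \<le> u0" for F u
      unfolding B_def
    proof (rule slope_le_left)
      show "exp u \<le> t0" using that(3) e0 by auto
      then show "y0 \<le> F (exp u)" using solution_antimono[OF that(1), of "exp u" t0] that(2) by auto
    qed (use y0 in auto)
    \<comment> \<open>To the left of \<open>u0\<close> time is reversed by the substitution
      \<open>v = - u\<close>, which turns the claim into a forward one.\<close>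
    have "w F1 (- (- u)) = w F2 (- (- u))"
    proof (rule ode_unique_forward[where r = "- u0" and x = "\<lambda>v. w F1 (- v)" and y = "\<lambda>v. w F2 (- v)"
          and x' = "\<lambda>v. slope (exp (- v)) (exp (w F1 (- v)))" and y' = "\<lambda>v. slope (exp (- v)) (exp (w F2 (- v)))"
          and L = "slope_lip * B"])
      show "((\<lambda>v. w F1 (- v)) has_real_derivative slope (exp (- v)) (exp (w F1 (- v)))) (at v within {- u0..})"
           "((\<lambda>v. w F2 (- v)) has_real_derivative slope (exp (- v)) (exp (w F2 (- v)))) (at v within {- u0..})" for v
        using w'[OF F1, of "- v"] w'[OF F2, of "- v"]
        by (simp_all add: DERIV_mirror has_field_derivative_at_within)
      show "(w F1 (- v) - w F2 (- v)) * (slope (exp (- v)) (exp (w F1 (- v))) - slope (exp (- v)) (exp (w F2 (- v))))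
          \<le> slope_lip * B * (w F1 (- v) - w F2 (- v))\<^sup>2" if "- u0 \<le> v" for v
      proof (rule sq, rule lip)
        show "slope (exp (- v)) (g (exp (- v))) \<le> B" if "solution g" "g t0 = y0" for g
          using B[OF that] \<open>- u0 \<le> v\<close> by simp
      qed
    qed (use w0 False in auto)
    then show ?thesis by simp
  qed
  from this[of "ln t"] show ?thesis using F1 F2 \<open>0 < t\<close> by (simp add: w_def solution_def)
qed

abbreviation "F \<equiv> F_sol n a b"

lemma F_sol_props:
  assumes l: "0 < l"
  shows "F l \<in> {0<..} \<rightarrow>\<^sub>E {0<..}" "solution (F l)" "F l l = l"
proof -
  let ?P = "\<lambda>F. F \<in> {0<..} \<rightarrow>\<^sub>E {0<..} \<and> F l = l \<and> (\<forall>t>0. (F has_real_derivative G t (F t)) (at t))"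
  obtain f where f: "solution f" "f l = l" using solution_exists[OF l l] by blast
  have P_sol: "solution g" if "?P g" for g using that by (auto simp: solution_def Pi_iff PiE_def)
  have restr: "?P (restrict f {0<..})"
  proof (intro conjI allI impI)
    fix t :: real assume t: "0 < t"
    have "(f has_real_derivative G t (f t)) (at t)" using f t by (simp add: solution_def)
    then have "(restrict f {0<..} has_real_derivative G t (f t)) (at t)"
      by (rule has_field_derivative_transform_within_open[of _ _ _ "{0<..}"]) (use t in auto)
    then show "(restrict f {0<..} has_real_derivative G t (restrict f {0<..} t)) (at t)" using t by simp
  qed (use f l in \<open>auto simp: solution_def\<close>)
  have "\<exists>!g. ?P g"
  proof (rule ex1I[of ?P, OF restr])
    fix g assume g: "?P g"
    show "g = restrict f {0<..}"
    proof (rule extensionalityI[of _ "{0<..}"])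
      fix t :: real assume "t \<in> {0<..}"
      then show "g t = restrict f {0<..} t" using solution_unique[OF P_sol[OF g] f(1) _ l, of t] g f by auto
    qed (use g in \<open>auto simp: PiE_def\<close>)
  qed
  then have "?P (F l)" unfolding F_sol_def by (rule theI')
  then show "F l \<in> {0<..} \<rightarrow>\<^sub>E {0<..}" "solution (F l)" "F l l = l" using P_sol by auto
qed

lemma F_pos: "0 < l \<Longrightarrow> 0 < t \<Longrightarrow> 0 < F l t"
  using F_sol_props(2) by (auto simp: solution_def)

lemma F_deriv: "0 < l \<Longrightarrow> 0 < t \<Longrightarrow> (F l has_real_derivative G t (F l t)) (at t)"
  using F_sol_props(2) by (auto simp: solution_def)

lemma F_less: "0 < l \<Longrightarrow> 0 < s \<Longrightarrow> s < t \<Longrightarrow> F l t < F l s"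
  using F_sol_props(2) solution_decreasing by blast

lemma F_antimono: "0 < l \<Longrightarrow> 0 < s \<Longrightarrow> s \<le> t \<Longrightarrow> F l t \<le> F l s"
  using F_sol_props(2) solution_antimono by blast

lemma F_continuous_on: "0 < l \<Longrightarrow> continuous_on {0<..} (F l)"
  using F_sol_props(2) solution_continuous_on by blast

text \<open>Two solutions cannot meet without coinciding, so the sign of their difference is
  constant. It is read off at \<open>l\<close>, where
  \<open>F m l > F m m = m > l = F l l\<close>.\<close>

lemma F_strict_mono:
  assumes "0 < l" "l < m" "0 < t" shows "F l t < F m t"
proof -
  have m: "0 < m" using assms by simp
  have ne: "F m s - F l s \<noteq> 0" if "0 < s" for s
  proof
    assume "F m s - F l s = 0"
    then have "F m l = F l l"
      using solution_unique[OF F_sol_props(2)[OF m] F_sol_props(2)[OF assms(1)], of s l] that assms by simp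
    then show False using F_less[OF m assms(1,2)] F_sol_props(3)[OF m] F_sol_props(3)[OF assms(1)] assms by simp
  qed
  have pos: "0 < F m l - F l l"
    using F_less[OF m assms(1,2)] F_sol_props(3)[OF m] F_sol_props(3)[OF assms(1)] assms by simp
  have cont: "continuous_on {x..y} (\<lambda>s. F m s - F l s)" if "0 < x" for x y
    by (intro continuous_intros continuous_on_subset[OF F_continuous_on] m assms) (use that in auto)
  show ?thesis
  proof (rule ccontr)
    assume "\<not> F l t < F m t"
    then have "F m t - F l t \<le> 0" by simp
    then obtain s where "min t l \<le> s" "F m s - F l s = 0"
      using IVT'[of "\<lambda>s. F m s - F l s" t 0 l] IVT2'[of "\<lambda>s. F m s - F l s" t 0 l]
        cont[of t l] cont[of l t] pos assms by (cases "t \<le> l") auto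
    moreover from this have "0 < s" using assms by linarith
    ultimately show False using ne by blast
  qed
qed

text \<open>A decreasing curve through \<open>(t, y)\<close> crosses the diagonal between
  \<open>t\<close> and \<open>y\<close>, and the crossing point is its parameter.\<close>

lemma F_surj:
  assumes "0 < t" "0 < y" shows "\<exists>l>0. F l t = y"
proof -
  obtain f where f: "solution f" "f t = y" using solution_exists assms by blast
  have cont: "continuous_on {x..z} (\<lambda>s. f s - s)" if "0 < x" for x z
    by (intro continuous_intros continuous_on_subset[OF solution_continuous_on[OF f(1)]]) (use that in auto)
  have "\<exists>l>0. f l = l"
  proof (cases "t \<le> y")
    case True
    have "f y - y \<le> 0" "0 \<le> f t - t" using solution_antimono[OF f(1) assms(1) True] f True by auto
    then obtain l where "t \<le> l" "l \<le> y" "f l - l = 0"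
      using IVT2'[of "\<lambda>s. f s - s" y 0 t] True cont assms by auto
    then show ?thesis using assms by (intro exI[of _ l]) auto
  next
    case False
    have "f t - t \<le> 0" "0 \<le> f y - y" using solution_antimono[OF f(1) assms(2), of t] f False by auto
    then obtain l where "y \<le> l" "l \<le> t" "f l - l = 0"
      using IVT2'[of "\<lambda>s. f s - s" t 0 y] False cont assms by auto
    then show ?thesis using assms by (intro exI[of _ l]) auto
  qed
  then obtain l where l: "0 < l" "f l = l" by blast
  have "F l t = f t" by (rule solution_unique[OF F_sol_props(2)[OF l(1)] f(1) _ l(1) assms(1)]) (simp add: l F_sol_props)
  then show ?thesis using l f by auto
qed

text \<open>A monotone function whose image is open has no jumps; this replaces an estimate of the
  dependence on initial data.\<close>

lemma F_continuous_parameter: "0 < t \<Longrightarrow> continuous_on {0<..} (\<lambda>l. F l t)"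
proof (rule continuous_onI_mono)
  assume t: "0 < t"
  have "(\<lambda>l. F l t) ` {0<..} = {0<..}" using F_surj[OF t] F_pos[OF _ t] by (force simp: image_iff)
  then show "open ((\<lambda>l. F l t) ` {0<..})" by simp
  show "F l t \<le> F m t" if "l \<in> {0<..}" "m \<in> {0<..}" "l \<le> m" for l m
    using F_strict_mono[of l m t] that t by (cases "l = m") auto
qed

end

section \<open>Radial profiles generated by the slope field\<close>

context energy_coefficients
begin

definition "H_solution l r rs H \<longleftrightarrow> H r = rs \<and>
   (\<forall>s\<ge>r. 0 < H s \<and> (H has_real_derivative F l (H s / s)) (at s within {r..}))"

text \<open>The derivative of \<open>F l\<close> is \<open>- slope * F l t / t\<close>, and both
  factors are bounded on \<open>t \<ge> m\<close> because the graph of \<open>F l\<close> stays in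
  the region to the right of the point \<open>(m, F l m)\<close>.\<close>

lemma F_Lipschitz:
  assumes l: "0 < l" and m: "0 < m"
  obtains L where "\<And>x y. m \<le> x \<Longrightarrow> m \<le> y \<Longrightarrow> \<bar>F l x - F l y\<bar> \<le> L * \<bar>x - y\<bar>"
proof -
  let ?y = "F l m"
  define L where "L = 2 * real n * (\<kappa> * (a / b) * ?y ^ n + ?y / m) * (?y / m)"
  have y: "0 < ?y" using F_pos l m by simp
  have d: "norm (G t (F l t)) \<le> L" if "m \<le> t" for t
  proof -
    have t: "0 < t" "0 < F l t" "F l t \<le> ?y" using that m F_pos[OF l] F_antimono[OF l m that] by auto
    have "slope t (F l t) \<le> 2 * real n * (\<kappa> * (a / b) * ?y ^ n + ?y / m)"
      by (rule slope_le_right) (use m t that in auto)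
    moreover have "F l t / t \<le> ?y / m" using t m that by (intro frac_le) auto
    ultimately have "slope t (F l t) * (F l t / t) \<le> L"
      unfolding L_def using t slope_pos[of t "F l t"] by (intro mult_mono) (auto intro: order.trans[OF less_imp_le])
    moreover have "slope t (F l t) * (F l t / t) = - G t (F l t)" using t by (simp add: slope_def)
    ultimately show ?thesis using G_neg[of t "F l t"] t by simp
  qed
  have "norm (F l x - F l y) \<le> L * norm (x - y)" if "m \<le> x" "m \<le> y" for x y
  proof (rule field_differentiable_bound[of "{m..}" "F l" "\<lambda>t. G t (F l t)"])
    show "(F l has_field_derivative G t (F l t)) (at t within {m..})" if "t \<in> {m..}" for t
      by (rule has_field_derivative_at_within, rule F_deriv) (use that m l in auto)
  qed (use that d in auto)
  then show thesis by (intro that[of L]) auto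
qed

text \<open>The quotient \<open>T = H / s\<close>, as a function of \<open>v = ln (s / r)\<close>,
  satisfies the autonomous equation \<open>T' = F l T - T\<close>. The solution is built for
  \<open>T\<close>.\<close>

lemma H_solution_exists:
  assumes l: "0 < l" and r: "0 < r" and rs: "0 < rs"
  shows "\<exists>H. H_solution l r rs H"
proof -
  define t0 where "t0 = rs / r"
  \<comment> \<open>For \<open>T \<le> m\<close> the cut-off right-hand side is
    \<open>F l m - m\<close>, which is nonnegative because
    \<open>F l m \<ge> F l l = l \<ge> m\<close>. Hence \<open>T\<close> cannot fall below its
    admissible start \<open>t0 \<ge> m\<close>, and the cut-off \<open>max m x\<close> does not
    alter the equation along it.\<close>
  define m where "m = min t0 l"
  have m: "0 < m" "m \<le> l" "m \<le> t0" using assms by (auto simp: m_def t0_def)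
  define f where "f x = F l (max m x) - max m x" for x
  obtain L where L: "\<And>x y. m \<le> x \<Longrightarrow> m \<le> y \<Longrightarrow> \<bar>F l x - F l y\<bar> \<le> L * \<bar>x - y\<bar>"
    using F_Lipschitz[OF l m(1)] by blast
  have L0: "0 \<le> L" using L[of m "m + 1"] by auto
  have flip: "\<bar>f x - f y\<bar> \<le> (L + 1) * \<bar>x - y\<bar>" for x y
  proof -
    have "\<bar>f x - f y\<bar> \<le> \<bar>F l (max m x) - F l (max m y)\<bar> + \<bar>max m x - max m y\<bar>" unfolding f_def by linarith
    also have "\<dots> \<le> (L + 1) * \<bar>max m x - max m y\<bar>" using L[of "max m x" "max m y"] by (simp add: algebra_simps)
    also have "\<dots> \<le> (L + 1) * \<bar>x - y\<bar>" using L0 by (intro mult_left_mono) auto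
    finally show ?thesis .
  qed
  obtain T where T: "T 0 = t0" "\<And>v. 0 \<le> v \<Longrightarrow> (T has_real_derivative f (T v)) (at v within {0..})"
  proof (rule ode_exists_forward[of "\<lambda>v. f" "L + 1" t0 "\<bar>f t0\<bar>"])
    have "continuous_on UNIV (\<lambda>x. F l (max m x))"
      by (rule continuous_on_compose2[OF F_continuous_on[OF l]]) (use m in \<open>auto intro!: continuous_intros\<close>)
    then have "continuous_on UNIV f" unfolding f_def by (intro continuous_intros)
    then show "continuous_on ({0..} \<times> UNIV) (\<lambda>z. f (snd z))"
      by (rule continuous_on_compose2) (auto intro!: continuous_intros)
  qed (use flip in auto)
  have Tm: "m \<le> T v" if "0 \<le> v" for v
  proof -
    have "- T v \<le> - m"
    proof (rule barrier_forward[where r = 0 and x = "\<lambda>v. - T v" and x' = "\<lambda>v. - f (T v)"])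
      show "((\<lambda>v. - T v) has_real_derivative - f (T v)) (at v within {0..})" if "0 \<le> v" for v
        using T(2)[OF that] by (rule DERIV_minus)
      show "- f (T v) \<le> 0" if "- m \<le> - T v" for v
        using that m F_antimono[OF l m(1,2)] F_sol_props(3)[OF l] by (simp add: f_def)
    qed (use T m that in auto)
    then show ?thesis by simp
  qed
  define H where "H s = s * T (ln (s / r))" for s
  have "0 < H s \<and> (H has_real_derivative F l (H s / s)) (at s within {r..})" if s: "r \<le> s" for s
  proof -
    have s0: "0 < s" "0 \<le> ln (s / r)" using r s by auto
    have "(T has_real_derivative f (T (ln (s / r)))) (at (ln (s / r)) within (\<lambda>s. ln (s / r)) ` {r..})"
      by (rule has_field_derivative_subset[OF T(2)[OF s0(2)]]) (use r in auto)
    moreover have "((\<lambda>s. ln (s / r)) has_real_derivative 1 / s) (at s within {r..})"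
      using s0 r by (auto intro!: derivative_eq_intros simp: field_simps)
    ultimately have T': "((\<lambda>s. T (ln (s / r))) has_real_derivative f (T (ln (s / r))) * (1 / s)) (at s within {r..})"
      using DERIV_image_chain[of T _ "\<lambda>s. ln (s / r)" s "{r..}" "1 / s"] by (simp add: o_def)
    have "f (T (ln (s / r))) = F l (H s / s) - H s / s"
      using Tm[OF s0(2)] s0 by (simp add: f_def H_def max_def)
    with T' have "((\<lambda>s. T (ln (s / r))) has_real_derivative (F l (H s / s) - H s / s) * (1 / s)) (at s within {r..})" by simp
    then have "(H has_real_derivative 1 * T (ln (s / r)) + (F l (H s / s) - H s / s) * (1 / s) * s) (at s within {r..})"
      unfolding H_def by (intro DERIV_mult DERIV_ident)
    moreover have "1 * T (ln (s / r)) + (F l (H s / s) - H s / s) * (1 / s) * s = F l (H s / s)"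
      using s0 by (simp add: H_def)
    ultimately show ?thesis using Tm[OF s0(2)] m s0 by (simp add: H_def)
  qed
  moreover have "H r = rs" using r T by (simp add: H_def t0_def)
  ultimately show ?thesis unfolding H_solution_def by blast
qed

text \<open>Since \<open>F l\<close> decreases, the larger of two solutions has the smaller slope:
  the one-sided condition holds with constant zero.\<close>

lemma H_solution_unique:
  assumes l: "0 < l" and r: "0 < r" and 1: "H_solution l r rs H1" and 2: "H_solution l r rs H2" and "r \<le> s"
  shows "H1 s = H2 s"
proof (rule ode_unique_forward[where r = r and x = H1 and y = H2
      and x' = "\<lambda>s. F l (H1 s / s)" and y' = "\<lambda>s. F l (H2 s / s)" and L = 0])
  fix s assume s: "r \<le> s"
  have pos: "0 < H1 s / s" "0 < H2 s / s" using 1 2 s r by (auto simp: H_solution_def)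
  have "(H1 s - H2 s) * (F l (H1 s / s) - F l (H2 s / s)) \<le> 0"
  proof (cases "H1 s \<le> H2 s")
    case True
    then show ?thesis using F_antimono[OF l pos(1), of "H2 s / s"] s r
      by (intro mult_nonpos_nonneg) (auto simp: divide_right_mono)
  next
    case False
    then show ?thesis using F_antimono[OF l pos(2), of "H1 s / s"] s r
      by (intro mult_nonneg_nonpos) (auto simp: divide_right_mono)
  qed
  then show "(H1 s - H2 s) * (F l (H1 s / s) - F l (H2 s / s)) \<le> 0 * (H1 s - H2 s)\<^sup>2" by simp
qed (use assms in \<open>auto simp: H_solution_def\<close>)

lemma H_sol_solution:
  assumes l: "0 < l" and r: "0 < r" and rs: "0 < rs"
  shows "H_solution l r rs (H_sol n a b r rs l)"
proof -
  let ?P = "\<lambda>H. H \<in> {r..} \<rightarrow>\<^sub>E {0<..} \<and> H r = rs \<and>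
     (\<forall>s\<ge>r. (H has_real_derivative F l (H s / s)) (at s within {r..}))"
  obtain h where h: "H_solution l r rs h" using H_solution_exists[OF assms] by blast
  have P_sol: "H_solution l r rs g" if "?P g" for g using that by (auto simp: H_solution_def Pi_iff PiE_def)
  have restr: "?P (restrict h {r..})"
  proof (intro conjI allI impI)
    fix s :: real assume s: "r \<le> s"
    have "(h has_real_derivative F l (h s / s)) (at s within {r..})" using h s by (simp add: H_solution_def)
    then have "(restrict h {r..} has_real_derivative F l (h s / s)) (at s within {r..})"
      by (rule has_field_derivative_transform_within[OF _ zero_less_one]) (use s in auto)
    then show "(restrict h {r..} has_real_derivative F l (restrict h {r..} s / s)) (at s within {r..})" using s by simp
  qed (use h in \<open>auto simp: H_solution_def\<close>)
  have "\<exists>!g. ?P g"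
  proof (rule ex1I[of ?P, OF restr])
    fix g assume g: "?P g"
    show "g = restrict h {r..}"
    proof (rule extensionalityI[of _ "{r..}"])
      fix s :: real assume "s \<in> {r..}"
      then show "g s = restrict h {r..} s" using H_solution_unique[OF l r P_sol[OF g] h, of s] by auto
    qed (use g in \<open>auto simp: PiE_def\<close>)
  qed
  then have "?P (H_sol n a b r rs l)" unfolding H_sol_def by (rule theI')
  then show ?thesis by (rule P_sol)
qed

lemma H_solution_continuous_on: "H_solution l r rs H \<Longrightarrow> continuous_on {r..} H"
  by (rule DERIV_continuous_on[of _ _ "\<lambda>s. F l (H s / s)"]) (auto simp: H_solution_def)

lemma H_solution_strict_mono:
  assumes l: "0 < l" and r: "0 < r" and H: "H_solution l r rs H" and "r \<le> s" "s < t"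
  shows "H s < H t"
proof (rule DERIV_pos_imp_increasing_open[OF \<open>s < t\<close>])
  show "continuous_on {s..t} H" by (rule continuous_on_subset[OF H_solution_continuous_on[OF H]]) (use assms in auto)
  fix x assume "s < x" "x < t"
  then have x: "r < x" using assms by simp
  then show "\<exists>y. (H has_real_derivative y) (at x) \<and> 0 < y"
  proof (intro exI conjI)
    have "0 < H x" "(H has_real_derivative F l (H x / x)) (at x within {r..})"
      using H x by (simp_all add: H_solution_def)
    then show "(H has_real_derivative F l (H x / x)) (at x)" "0 < F l (H x / x)"
      using x r l at_within_Ici_interior[OF x] by (simp_all add: F_pos)
  qed
qed

text \<open>While \<open>H1\<close> exceeds \<open>H2\<close>, monotonicity of \<open>F l\<close>
  and \<open>F m\<close> bounds the difference of the slopes by the difference of the two functions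
  at one common argument. Either of the two quotients may serve as that argument, hence the
  disjunction; continuity in the parameter needs the defect along one fixed profile, whichever of
  the two profiles it is.\<close>

lemma H_solution_le:
  assumes l: "0 < l" and m: "0 < m" and r: "0 < r" and s: "r \<le> s"
    and 1: "H_solution l r rs H1" and 2: "H_solution m r rs H2"
    and \<Phi>: "\<And>s. r \<le> s \<Longrightarrow> (\<Phi> has_real_derivative \<phi> s) (at s within {r..})"
    and \<phi>: "\<And>s. r \<le> s \<Longrightarrow> 0 \<le> \<Phi> s \<and> (F l (H1 s / s) - F m (H1 s / s) \<le> \<phi> s \<or> F l (H2 s / s) - F m (H2 s / s) \<le> \<phi> s)" and "\<Phi> r = 0"
  shows "H1 s - H2 s \<le> \<Phi> s"
proof -
  have "H1 s - H2 s - \<Phi> s \<le> 0"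
  proof (rule barrier_forward[where r = r and x = "\<lambda>s. H1 s - H2 s - \<Phi> s" and x' = "\<lambda>s. F l (H1 s / s) - F m (H2 s / s) - \<phi> s"])
    fix s assume s: "r \<le> s"
    have H: "0 < H1 s" "(H1 has_real_derivative F l (H1 s / s)) (at s within {r..})"
      "0 < H2 s" "(H2 has_real_derivative F m (H2 s / s)) (at s within {r..})"
      using 1 2 s by (auto simp: H_solution_def)
    show "((\<lambda>s. H1 s - H2 s - \<Phi> s) has_real_derivative F l (H1 s / s) - F m (H2 s / s) - \<phi> s) (at s within {r..})"
      by (intro DERIV_diff H \<Phi> s)
    assume "0 \<le> H1 s - H2 s - \<Phi> s"
    then have "H2 s / s \<le> H1 s / s" using \<phi>[OF s] s r by (intro divide_right_mono) auto
    then have "F l (H1 s / s) \<le> F l (H2 s / s)" "F m (H1 s / s) \<le> F m (H2 s / s)"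
      using H s r by (auto intro!: F_antimono l m)
    then show "F l (H1 s / s) - F m (H2 s / s) - \<phi> s \<le> 0" using \<phi>[OF s] by linarith
  qed (use assms in \<open>auto simp: H_solution_def\<close>)
  then show ?thesis by simp
qed

text \<open>Comparison with zero defect gives the weak inequality. Equality at an interior point
  would make it a maximum of \<open>H1 - H2\<close>, where the slopes agree, contrary to the strict
  monotonicity of the field in its parameter.\<close>

lemma H_solution_parameter_less:
  assumes l: "0 < l" and lm: "l < m" and r: "0 < r" and s: "r < s"
    and 1: "H_solution l r rs H1" and 2: "H_solution m r rs H2"
  shows "H1 s < H2 s"
proof (rule ccontr)
  have m: "0 < m" using l lm by simp
  have H: "0 < H1 s" "(H1 has_real_derivative F l (H1 s / s)) (at s within {r..})"
      "0 < H2 s" "(H2 has_real_derivative F m (H2 s / s)) (at s within {r..})" if "r \<le> s" for s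
      using 1 2 that by (auto simp: H_solution_def)
  have le: "H1 s - H2 s \<le> 0" if "r \<le> s" for s
    by (rule H_solution_le[OF l m r that 1 2, of "\<lambda>_. 0" "\<lambda>_. 0"])
       (use H r F_strict_mono[OF l lm] in \<open>auto intro: less_imp_le\<close>)
  assume "\<not> H1 s < H2 s"
  then have eq: "H1 s = H2 s" using le[of s] s by simp
  have "((\<lambda>s. H1 s - H2 s) has_real_derivative F l (H1 s / s) - F m (H2 s / s)) (at s)"
    using DERIV_diff[OF H(2,4), of s] s at_within_Ici_interior[OF s] by simp
  then have "F l (H1 s / s) - F m (H2 s / s) = 0"
  proof (rule DERIV_local_max[where d = "s - r"])
    show "\<forall>y. \<bar>s - y\<bar> < s - r \<longrightarrow> H1 y - H2 y \<le> H1 s - H2 s" using le eq by auto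
  qed (use s in auto)
  then show False using F_strict_mono[OF l lm, of "H1 s / s"] H[of s] eq s r by simp
qed

text \<open>Continuous dependence of the end value on the parameter: the defect is controlled by the integral of the
  difference of the two slope functions along the unperturbed solution.\<close>

lemma H_solution_continuous_parameter:
  assumes r: "0 < r" and rR: "r < R" and rs: "0 < rs"
    and h: "\<And>l. 0 < l \<Longrightarrow> H_solution l r rs (h l)"
  shows "continuous_on {0<..} (\<lambda>l. h l R)"
  unfolding continuous_on_sequentially
proof (intro ballI allI impI)
  fix l and x :: "nat \<Rightarrow> real" assume l: "l \<in> {0<..}" and x: "(\<forall>k. x k \<in> {0<..}) \<and> x \<longlonglongrightarrow> l"
  have l0: "0 < l" using l by simp
  have xpos: "0 < x k" for k using x by auto
  define q where "q s = h l s / s" for s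
  have q: "0 < q s" if "r \<le> s" for s using h[OF l0] that r by (auto simp: H_solution_def q_def)
  have q_cont: "continuous_on {r..} q"
    unfolding q_def by (intro continuous_intros H_solution_continuous_on[OF h[OF l0]]) (use r in auto)
  define \<phi> where "\<phi> m s = \<bar>F m (q s) - F l (q s)\<bar>" for m s
  have \<phi>_cont: "continuous_on {r..} (\<phi> m)" if "0 < m" for m
    unfolding \<phi>_def
    by (intro continuous_intros continuous_on_compose2[OF F_continuous_on q_cont]) (use that l0 q in auto)
  define \<Phi> where "\<Phi> m s = integral {r..s} (\<phi> m)" for m s
  have \<Phi>_deriv: "(\<Phi> m has_real_derivative \<phi> m s) (at s within {r..})" if "0 < m" "r \<le> s" for m s
  proof -
    have "(\<Phi> m has_real_derivative \<phi> m s) (at s within {r..s+1})"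
      unfolding \<Phi>_def by (rule integral_has_real_derivative)
        (use that in \<open>auto intro: continuous_on_subset[OF \<phi>_cont]\<close>)
    moreover have "at s within {r..s+1} = at s within {r..}"
      by (rule at_within_nhd[of _ "{..<s+1}"]) auto
    ultimately show ?thesis by simp
  qed
  have \<Phi>_nonneg: "0 \<le> \<Phi> m s" if "0 < m" for m s
    unfolding \<Phi>_def
    by (intro Henstock_Kurzweil_Integration.integral_nonneg integrable_continuous_interval
        continuous_on_subset[OF \<phi>_cont[OF that]]) (auto simp: \<phi>_def)
  have bound: "\<bar>h m R - h l R\<bar> \<le> \<Phi> m R" if m: "0 < m" for m
  proof -
    have "h m R - h l R \<le> \<Phi> m R"
      by (rule H_solution_le[OF m l0 r _ h[OF m] h[OF l0] \<Phi>_deriv[OF m]])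
         (use rR \<Phi>_nonneg[OF m] in \<open>auto simp: \<phi>_def q_def \<Phi>_def\<close>)
    moreover have "h l R - h m R \<le> \<Phi> m R"
      by (rule H_solution_le[OF l0 m r _ h[OF l0] h[OF m] \<Phi>_deriv[OF m]])
         (use rR \<Phi>_nonneg[OF m] in \<open>auto simp: \<phi>_def q_def \<Phi>_def\<close>)
    ultimately show ?thesis by simp
  qed
  have "Bseq x" using x by (intro convergent_imp_Bseq convergentI) auto
  \<comment> \<open>Since the field increases with the parameter, an upper bound \<open>M\<close> of
    the parameters yields the majorant \<open>F M (q s)\<close> needed for dominated
    convergence.\<close>
  then obtain M where "\<And>k. norm (x k) \<le> M" unfolding Bseq_def by blast
  then have M: "x k \<le> M" for k using abs_le_D1 by (metis real_norm_def)
  then have M0: "0 < M" using xpos[of 0] order_less_le_trans by blast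
  have "(\<lambda>k. \<Phi> (x k) R) \<longlonglongrightarrow> integral {r..R} (\<lambda>s. 0)"
    unfolding \<Phi>_def
  proof (rule dominated_convergence(2))
    have q_cont': "continuous_on {r..R} q" by (rule continuous_on_subset[OF q_cont]) auto
    show "(\<lambda>s. F M (q s) + F l (q s)) integrable_on {r..R}"
      by (intro integrable_continuous_interval continuous_intros continuous_on_compose2[OF F_continuous_on q_cont'])
         (use M0 l0 q in auto)
    show "\<phi> (x k) integrable_on {r..R}" for k
      by (intro integrable_continuous_interval continuous_on_subset[OF \<phi>_cont[OF xpos]]) auto
    show "norm (\<phi> (x k) s) \<le> F M (q s) + F l (q s)" if "s \<in> {r..R}" for k s
    proof -
      have "0 < q s" using q that by auto
      moreover from this have "F (x k) (q s) \<le> F M (q s)"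
        using F_strict_mono[OF xpos[of k], of M "q s"] M[of k] by (cases "x k = M") auto
      ultimately show ?thesis using F_pos[OF xpos[of k], of "q s"] F_pos[OF l0, of "q s"] by (simp add: \<phi>_def)
    qed
    show "(\<lambda>k. \<phi> (x k) s) \<longlonglongrightarrow> 0" if "s \<in> {r..R}" for s
    proof -
      have "(\<lambda>k. F (x k) (q s)) \<longlonglongrightarrow> F l (q s)"
        using F_continuous_parameter[OF q[of s]] that l x unfolding continuous_on_sequentially by (auto simp: o_def)
      then have "(\<lambda>k. \<bar>F (x k) (q s) - F l (q s)\<bar>) \<longlonglongrightarrow> \<bar>F l (q s) - F l (q s)\<bar>"
        by (intro tendsto_intros)
      then show ?thesis by (simp add: \<phi>_def)
    qed
  qed
  then have "(\<lambda>k. \<Phi> (x k) R) \<longlonglongrightarrow> 0" by simp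
  then have "(\<lambda>k. h (x k) R - h l R) \<longlonglongrightarrow> 0"
    by (rule Lim_null_comparison[rotated]) (use bound xpos in auto)
  then show "((\<lambda>l. h l R) \<circ> x) \<longlonglongrightarrow> h l R" by (simp add: o_def LIM_zero_iff)
qed

text \<open>The quotient \<open>H / s\<close> starts at \<open>t0 = rs / r\<close> and never crosses
  the level \<open>l\<close>, on which the slope equals \<open>l\<close>. So the mean slope over
  \<open>[r, R]\<close> is at most \<open>l\<close> if \<open>l \<le> t0\<close> and at least
  \<open>l\<close> if \<open>t0 \<le> l\<close>. Strict monotonicity in the parameter gives
  uniqueness.\<close>

lemma H_solution_end_value:
  assumes r: "0 < r" and rR: "r < R" and rs: "0 < rs" and rsRs: "rs < Rs"
  shows "\<exists>!l. 0 < l \<and> H_sol n a b r rs l R = Rs"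
proof -
  define h where "h l = H_sol n a b r rs l" for l
  have h: "H_solution l r rs (h l)" if "0 < l" for l
    unfolding h_def by (rule H_sol_solution[OF that r rs])
  define t0 where "t0 = rs / r"
  have t0: "0 < t0" using r rs by (simp add: t0_def)
  have hd: "0 < h l s" "(h l has_real_derivative F l (h l s / s)) (at s within {r..})" "h l r = rs" if "0 < l" "r \<le> s" for l s
    using h that by (auto simp: H_solution_def)
  have low: "h l R \<le> rs + l * (R - r)" if l: "0 < l" "l \<le> t0" for l
  proof -
    have ge: "l \<le> h l s / s" if "r \<le> s" for s
    proof -
      have "l * s - h l s \<le> 0"
      proof (rule barrier_forward[where r = r and x = "\<lambda>s. l * s - h l s" and x' = "\<lambda>s. l - F l (h l s / s)"])
        fix s assume s: "r \<le> s"
        show "((\<lambda>s. l * s - h l s) has_real_derivative l - F l (h l s / s)) (at s within {r..})"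
          by (rule derivative_eq_intros hd l s refl | simp)+
        assume "0 \<le> l * s - h l s"
        then have "h l s / s \<le> l" using s r by (simp add: field_simps)
        then show "l - F l (h l s / s) \<le> 0"
          using F_antimono[OF l(1), of "h l s / s" l] F_sol_props(3)[OF l(1)] hd[OF l(1) s] s r by simp
      qed (use that l r hd(3)[OF l(1), of r] in \<open>auto simp: t0_def field_simps\<close>)
      then show ?thesis using that r by (simp add: field_simps)
    qed
    have "h l R - l * R \<le> h l r - l * r"
    proof (rule nonpos_derivative_antimono_forward[where r = r and f = "\<lambda>s. h l s - l * s" and f' = "\<lambda>s. F l (h l s / s) - l"])
      show "((\<lambda>s. h l s - l * s) has_real_derivative F l (h l s / s) - l) (at s within {r..})" if "r \<le> s" for s
        by (rule derivative_eq_intros hd l that refl | simp)+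
      show "F l (h l s / s) - l \<le> 0" if "r < s" for s
        using F_antimono[OF l(1) l(1) ge[of s]] F_sol_props(3)[OF l(1)] that by simp
    qed (use rR in auto)
    then show ?thesis using hd(3)[OF l(1), of r] by (simp add: algebra_simps)
  qed
  have high: "rs + l * (R - r) \<le> h l R" if l: "0 < l" "t0 \<le> l" for l
  proof -
    have ge: "h l s / s \<le> l" if "r \<le> s" for s
    proof -
      have "h l s - l * s \<le> 0"
      proof (rule barrier_forward[where r = r and x = "\<lambda>s. h l s - l * s" and x' = "\<lambda>s. F l (h l s / s) - l"])
        fix s assume s: "r \<le> s"
        show "((\<lambda>s. h l s - l * s) has_real_derivative F l (h l s / s) - l) (at s within {r..})"
          by (rule derivative_eq_intros hd l s refl | simp)+
        assume "0 \<le> h l s - l * s"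
        then have "l \<le> h l s / s" using s r by (simp add: field_simps)
        then show "F l (h l s / s) - l \<le> 0"
          using F_antimono[OF l(1) l(1)] F_sol_props(3)[OF l(1)] by simp
      qed (use that l r hd(3)[OF l(1), of r] in \<open>auto simp: t0_def field_simps\<close>)
      then show ?thesis using that r by (simp add: field_simps)
    qed
    have "l * R - h l R \<le> l * r - h l r"
    proof (rule nonpos_derivative_antimono_forward[where r = r and f = "\<lambda>s. l * s - h l s" and f' = "\<lambda>s. l - F l (h l s / s)"])
      show "((\<lambda>s. l * s - h l s) has_real_derivative l - F l (h l s / s)) (at s within {r..})" if "r \<le> s" for s
        by (rule derivative_eq_intros hd l that refl | simp)+
      show "l - F l (h l s / s) \<le> 0" if "r < s" for s
        using F_antimono[OF l(1), of "h l s / s" l] ge[of s] F_sol_props(3)[OF l(1)] hd[OF l(1), of s] that r by simp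
    qed (use rR in auto)
    then show ?thesis using hd(3)[OF l(1), of r] by (simp add: algebra_simps)
  qed
  \<comment> \<open>\<open>(Rs - rs) / (R - r)\<close> is the mean slope to be attained; taking the
    minimum and maximum with \<open>t0\<close> puts the two parameters on the sides where the
    estimates \<open>low\<close> and \<open>high\<close> apply.\<close>
  define l1 l2 where "l1 = min t0 ((Rs - rs) / (R - r))" and "l2 = max t0 ((Rs - rs) / (R - r))"
  have l12: "0 < l1" "l1 \<le> l2" "l1 \<le> t0" "t0 \<le> l2" "0 < l2" using t0 rR rsRs by (auto simp: l1_def l2_def)
  have "l1 * (R - r) \<le> (Rs - rs) / (R - r) * (R - r)" using rR unfolding l1_def by (intro mult_right_mono) auto
  then have 1: "h l1 R \<le> Rs" using low[OF l12(1,3)] rR by simp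
  have "(Rs - rs) / (R - r) * (R - r) \<le> l2 * (R - r)" using rR unfolding l2_def by (intro mult_right_mono) auto
  then have 2: "Rs \<le> h l2 R" using high[OF l12(5,4)] rR by simp
  have "continuous_on {l1..l2} (\<lambda>l. h l R)"
    by (rule continuous_on_subset[OF H_solution_continuous_parameter[OF r rR rs h]]) (use l12 in auto)
  from IVT'[OF 1 2 l12(2) this] obtain l where "l1 \<le> l" "h l R = Rs" by auto
  moreover from this have "0 < l" using l12 by simp
  moreover have "m = l" if "0 < l" "h l R = Rs" "0 < m" "h m R = Rs" for l m
    using H_solution_parameter_less[OF that(1) _ r rR h[OF that(1)] h[OF that(3)]]
      H_solution_parameter_less[OF that(3) _ r rR h[OF that(3)] h[OF that(1)]] that
    by (cases l m rule: linorder_cases) auto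
  ultimately show ?thesis unfolding h_def by blast
qed

end

section \<open>Calculus of smooth functions\<close>

lemma C_on_cong:
  assumes "open S" "\<And>x. x \<in> S \<Longrightarrow> f x = g x"
  shows "C_on k S f \<longleftrightarrow> C_on k S g"
  using assms(2)
proof (induction k arbitrary: f g)
  case 0
  then show ?case by (simp cong: continuous_on_cong)
next
  case (Suc k)
  have d: "(f has_derivative D) (at x) \<longleftrightarrow> (g has_derivative D) (at x)" if "x \<in> S" for x D
    using has_derivative_transform_within_open[of f D x UNIV S g] has_derivative_transform_within_open[of g D x UNIV S f]
      Suc.prems that assms(1) by auto
  then have "frechet_derivative f (at x) = frechet_derivative g (at x)" if "x \<in> S" for x
    unfolding frechet_derivative_def using that by simp
  then have "C_on k S (\<lambda>x. frechet_derivative f (at x) v) = C_on k S (\<lambda>x. frechet_derivative g (at x) v)" for v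
    by (intro Suc.IH) auto
  then show ?case using d by (simp add: differentiable_def)
qed

lemma C_on_SucI:
  assumes S: "open S" and f: "\<And>x. x \<in> S \<Longrightarrow> (f has_derivative f' x) (at x)" and "\<And>v. C_on k S (\<lambda>x. f' x v)"
  shows "C_on (Suc k) S f"
proof -
  have "f' x = frechet_derivative f (at x)" if "x \<in> S" for x using frechet_derivative_at[OF f[OF that]] .
  then have "C_on k S (\<lambda>x. f' x v) = C_on k S (\<lambda>x. frechet_derivative f (at x) v)" for v
    by (intro C_on_cong[OF S]) auto
  then show ?thesis using assms by (auto simp: differentiable_def)
qed

lemma C_on_SucD:
  assumes "C_on (Suc k) S f" "x \<in> S"
  shows "(f has_derivative frechet_derivative f (at x)) (at x)"
  using assms frechet_derivative_works by auto

lemma C_on_Suc_imp: "C_on (Suc k) S f \<Longrightarrow> C_on k S f"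
proof (induction k arbitrary: f)
  case 0
  then show ?case by (auto intro!: continuous_at_imp_continuous_on differentiable_imp_continuous_within)
next
  case (Suc k)
  then show ?case by (metis C_on.simps(2))
qed

lemma C_on_imp_continuous_on: "C_on k S f \<Longrightarrow> continuous_on S f"
proof (induction k)
  case (Suc k)
  show ?case by (rule Suc.IH[OF C_on_Suc_imp[OF Suc.prems]])
qed simp

lemma C_on_subset: "C_on k S f \<Longrightarrow> T \<subseteq> S \<Longrightarrow> C_on k T f"
  by (induction k arbitrary: f) (auto intro: continuous_on_subset)

lemma C_on_const: "C_on k S (\<lambda>x. c)"
proof (induction k arbitrary: c)
  case (Suc k)
  have "frechet_derivative (\<lambda>x. c) (at x) v = 0" for x v
    using frechet_derivative_at[OF has_derivative_const[of c "at x"]] by metis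
  then show ?case using Suc by simp
qed simp

context
  fixes S :: "'a::real_normed_vector set" assumes S: "open S"
begin

lemma C_on_linear:
  assumes L: "bounded_linear L" and f: "C_on k S f"
  shows "C_on k S (\<lambda>x. L (f x))"
  using f
proof (induction k arbitrary: f)
  case 0
  then show ?case by (simp add: bounded_linear.continuous_on[OF L])
next
  case (Suc k)
  show ?case
    by (rule C_on_SucI[OF S bounded_linear.has_derivative[OF L C_on_SucD[OF Suc.prems]]])
       (use Suc in auto)
qed

lemma C_on_id: "C_on k S (\<lambda>x. x)"
  by (cases k) (auto intro!: C_on_SucI[OF S has_derivative_ident] C_on_const)

lemma C_on_add:
  assumes "C_on k S f" "C_on k S g" shows "C_on k S (\<lambda>x. f x + g x)"
  using assms
proof (induction k arbitrary: f g)
  case (Suc k)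
  show ?case
    by (rule C_on_SucI[OF S has_derivative_add[OF C_on_SucD[OF Suc.prems(1)] C_on_SucD[OF Suc.prems(2)]]])
       (use Suc in auto)
qed (auto intro: continuous_intros)

text \<open>One induction serves products, scalar multiples and inner products: the derivative is a
  sum of two terms of the same bilinear form, each with a factor differentiated once.\<close>

lemma C_on_bilinear:
  assumes B: "bounded_bilinear B" and "C_on k S f" "C_on k S g"
  shows "C_on k S (\<lambda>x. B (f x) (g x))"
  using assms(2,3)
proof (induction k arbitrary: f g)
  case 0
  then show ?case by (auto intro: bounded_bilinear.continuous_on[OF B])
next
  case (Suc k)
  show ?case
  proof (rule C_on_SucI[OF S bounded_bilinear.FDERIV[OF B C_on_SucD[OF Suc.prems(1)] C_on_SucD[OF Suc.prems(2)]]])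
    fix v
    show "C_on k S (\<lambda>x. B (f x) (frechet_derivative g (at x) v) + B (frechet_derivative f (at x) v) (g x))"
      using Suc.prems C_on_Suc_imp[OF Suc.prems(1)] C_on_Suc_imp[OF Suc.prems(2)] by (intro C_on_add Suc.IH) simp_all
  qed
qed

lemmas C_on_mult = C_on_bilinear[OF bounded_bilinear_mult]
lemmas C_on_scaleR = C_on_bilinear[OF bounded_bilinear_scaleR]
lemmas C_on_inner = C_on_bilinear[OF bounded_bilinear_inner]

lemma C_on_minus: "C_on k S f \<Longrightarrow> C_on k S (\<lambda>x. - f x)"
  by (rule C_on_linear[OF bounded_linear_minus[OF bounded_linear_ident]])

lemma C_on_diff: "C_on k S f \<Longrightarrow> C_on k S g \<Longrightarrow> C_on k S (\<lambda>x. f x - g x)"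
  using C_on_add[of k f "\<lambda>x. - g x"] C_on_minus[of k g] by simp

lemma C_on_power:
  fixes f :: "'a \<Rightarrow> 'b::{real_normed_algebra_1}"
  shows "C_on k S f \<Longrightarrow> C_on k S (\<lambda>x. f x ^ m)"
  by (induction m) (auto intro: C_on_const C_on_mult)

text \<open>The outer function lives on the line, so its derivative is multiplication by the value
  at \<open>1\<close>. The chain rule thereby becomes a scaled product, and the induction closes
  with the product rule.\<close>

lemma C_on_compose_real:
  assumes T: "open T" and "C_on k S f" "C_on k T g" "\<And>x. x \<in> S \<Longrightarrow> f x \<in> T"
  shows "C_on k S (\<lambda>x. g (f x :: real))"
  using assms(2-4)
proof (induction k arbitrary: g)
  case 0
  then show ?case by (auto intro: continuous_on_compose2)
next
  case (Suc k)
  show ?case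
  proof (rule C_on_SucI[OF S])
    fix x assume x: "x \<in> S"
    let ?f' = "frechet_derivative f (at x)" and ?g' = "frechet_derivative g (at (f x))"
    have g: "(g has_derivative ?g') (at (f x))" by (rule C_on_SucD[OF Suc.prems(2)]) (use Suc.prems x in auto)
    have "((\<lambda>x. g (f x)) has_derivative (\<lambda>v. ?g' (?f' v))) (at x)"
      by (rule has_derivative_compose[OF C_on_SucD[OF Suc.prems(1) x] g])
    moreover have "?g' (?f' v) = ?f' v *\<^sub>R ?g' 1" for v
      using linear_scale[OF has_derivative_linear[OF g], of "?f' v" 1] by simp
    ultimately show "((\<lambda>x. g (f x)) has_derivative (\<lambda>v. ?f' v *\<^sub>R ?g' 1)) (at x)" by simp
  next
    fix v
    show "C_on k S (\<lambda>x. frechet_derivative f (at x) v *\<^sub>R frechet_derivative g (at (f x)) 1)"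
      using Suc.prems C_on_Suc_imp[OF Suc.prems(1)]
      by (intro C_on_scaleR Suc.IH[of "\<lambda>y. frechet_derivative g (at y) 1"]) auto
  qed
qed

end

lemma C_on_real_SucI:
  fixes f :: "real \<Rightarrow> 'b::real_normed_vector"
  assumes S: "open S" and f: "\<And>x. x \<in> S \<Longrightarrow> (f has_vector_derivative f' x) (at x)" and f': "C_on k S f'"
  shows "C_on (Suc k) S f"
  by (rule C_on_SucI[OF S f[unfolded has_vector_derivative_def]])
     (auto intro!: C_on_scaleR[OF S] C_on_const f')

lemma C_on_inverse_real: "C_on k (- {0}) (inverse :: real \<Rightarrow> real)"
proof (induction k)
  case 0
  then show ?case by (auto intro!: continuous_intros)
next
  case (Suc k)
  have S: "open (- {0} :: real set)" by auto
  show ?case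
  proof (rule C_on_real_SucI[OF S])
    fix x :: real assume "x \<in> - {0}"
    then show "(inverse has_vector_derivative - (inverse x * inverse x)) (at x)"
      using DERIV_inverse[of x UNIV] by (simp add: has_real_derivative_iff_has_vector_derivative[symmetric] numeral_2_eq_2)
  qed (intro C_on_minus[OF S] C_on_mult[OF S] Suc)
qed

lemma C_on_powr_real: "C_on k {0<..} (\<lambda>x::real. x powr c)"
proof (induction k arbitrary: c)
  case 0
  then show ?case by (auto intro!: continuous_intros)
next
  case (Suc k)
  have S: "open ({0<..} :: real set)" by auto
  show ?case
  proof (rule C_on_real_SucI[OF S])
    fix x :: real assume "x \<in> {0<..}"
    then show "((\<lambda>x. x powr c) has_vector_derivative c * x powr (c - 1)) (at x)"
      using has_real_derivative_powr[of x c] by (simp add: has_real_derivative_iff_has_vector_derivative[symmetric])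
  qed (intro C_on_mult[OF S] C_on_const Suc)
qed

lemma C_on_divide:
  fixes f g :: "'a::real_normed_vector \<Rightarrow> real"
  assumes S: "open S" and "C_on k S f" "C_on k S g" "\<And>x. x \<in> S \<Longrightarrow> g x \<noteq> 0"
  shows "C_on k S (\<lambda>x. f x / g x)"
  unfolding divide_inverse
  by (intro C_on_mult[OF S] C_on_compose_real[OF S _ _ C_on_inverse_real]) (use assms in auto)

lemma C_on_powr:
  fixes f :: "'a::real_normed_vector \<Rightarrow> real"
  assumes S: "open S" and "C_on k S f" "\<And>x. x \<in> S \<Longrightarrow> 0 < f x"
  shows "C_on k S (\<lambda>x. f x powr c)"
  by (intro C_on_compose_real[OF S _ _ C_on_powr_real]) (use assms in auto)

lemma C_on_norm:
  fixes S :: "'a::real_inner set"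
  assumes S: "open S" and "0 \<notin> S"
  shows "C_on k S norm"
proof -
  have "C_on k S (\<lambda>x. (x \<bullet> x) powr (1 / 2))"
    by (intro C_on_powr[OF S] C_on_inner[OF S] C_on_id[OF S]) (use assms in auto)
  then show ?thesis
    by (rule iffD1[OF C_on_cong[OF S], rotated]) (simp add: norm_eq_sqrt_inner powr_half_sqrt)
qed

lemma C_on_prod:
  fixes f :: "'i \<Rightarrow> 'a::real_normed_vector \<Rightarrow> 'b::real_normed_field"
  assumes S: "open S" and "\<And>i. i \<in> I \<Longrightarrow> C_on k S (f i)"
  shows "C_on k S (\<lambda>x. \<Prod>i\<in>I. f i x)"
  using assms(2) by (induction I rule: infinite_finite_induct) (auto intro!: C_on_const C_on_mult[OF S])

section \<open>Smooth cut-off functions\<close>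

definition flat_exp :: "real \<Rightarrow> real" where
  "flat_exp x = (if 0 < x then exp (- inverse x) else 0)"

lemma flat_exp_simps: "x \<le> 0 \<Longrightarrow> flat_exp x = 0" "0 \<le> flat_exp x" "flat_exp x \<le> 1"
  by (auto simp: flat_exp_def)

text \<open>The functions \<open>inverse x ^ m * exp (- inverse x)\<close>, continued by zero to the
  left, form a family whose derivatives are combinations of its members, so the induction runs over
  all \<open>m\<close> at once. At the origin the difference quotient of \<open>p m\<close> is
  \<open>p (m + 1)\<close>, which tends to zero since exponential decay beats every power.\<close>

lemma smooth_flat_exp: "C_on k UNIV flat_exp"
proof -
  define p where "p m x = (if 0 < x then inverse x ^ m * exp (- inverse x) else 0)" for m :: nat and x :: real
  have lim: "((\<lambda>x. inverse x ^ m * exp (- inverse x)) \<longlongrightarrow> 0) (at_right (0::real))" for m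
  proof -
    have "((\<lambda>y::real. y ^ m / exp y) \<longlongrightarrow> 0) at_top" by (rule tendsto_power_div_exp_0)
    from filterlim_compose[OF this filterlim_inverse_at_top_right]
    show ?thesis by (simp add: exp_minus field_simps)
  qed
  have lim0: "((p m) \<longlongrightarrow> 0) (at 0)" for m
  proof -
    have "((p m) \<longlongrightarrow> 0) (at_right 0)"
      by (rule Lim_transform_eventually[OF lim[of m]]) (auto simp: p_def eventually_at_right_less eventually_at_filter)
    moreover have "((p m) \<longlongrightarrow> 0) (at_left 0)"
      by (rule tendsto_eventually) (auto simp: p_def eventually_at_filter)
    ultimately show ?thesis by (rule filterlim_split_at_real[rotated])
  qed
  have deriv: "(p m has_real_derivative p (m + 2) x - real m * p (m + 1) x) (at x)" for m x
  proof -
    consider "0 < x" | "x < 0" | "x = 0" by linarith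
    then show ?thesis
    proof cases
      case 1
      have "((\<lambda>x. inverse x ^ m * exp (- inverse x)) has_real_derivative p (m + 2) x - real m * p (m + 1) x) (at x)"
      proof (cases m)
        case 0
        then show ?thesis using 1
          by (auto intro!: derivative_eq_intros simp: p_def power2_eq_square)
      next
        case (Suc j)
        have i: "(inverse has_real_derivative - (inverse x)\<^sup>2) (at x)"
          using 1 DERIV_inverse[of x UNIV] by (simp add: numeral_2_eq_2)
        have "((\<lambda>x. inverse x ^ Suc j * exp (- inverse x)) has_real_derivative
            (1 + real j) * (- (inverse x)\<^sup>2 * inverse x ^ j) * exp (- inverse x)
            + exp (- inverse x) * (- (- (inverse x)\<^sup>2)) * inverse x ^ Suc j) (at x)"
          by (intro DERIV_mult DERIV_power_Suc i DERIV_fun_exp DERIV_minus)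
        then show ?thesis using 1 Suc by (simp add: p_def algebra_simps power2_eq_square)
      qed
      then show ?thesis
        by (rule has_field_derivative_transform_within_open[of _ _ _ "{0<..}"]) (use 1 in \<open>auto simp: p_def\<close>)
    next
      case 2
      have "((\<lambda>x. 0) has_real_derivative 0) (at x)" by simp
      then have "(p m has_real_derivative 0) (at x)"
        by (rule has_field_derivative_transform_within_open[of _ _ _ "{..<0}"]) (use 2 in \<open>auto simp: p_def\<close>)
      then show ?thesis using 2 by (simp add: p_def)
    next
      case 3
      have "(\<lambda>y. (p m y - p m 0) / (y - 0)) = p (m + 1)" by (auto simp: p_def fun_eq_iff divide_inverse)
      then show ?thesis using lim0[of "m + 1"] 3 by (simp add: has_field_derivative_iff p_def)
    qed
  qed
  have "C_on k UNIV (p m)" for m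
  proof (induction k arbitrary: m)
    case 0
    show ?case using DERIV_isCont[OF deriv] by (auto intro: continuous_at_imp_continuous_on)
  next
    case (Suc k)
    have "C_on k UNIV (\<lambda>x. p (m + 2) x + - (real m * p (m + 1) x))"
      by (intro C_on_add C_on_minus C_on_mult C_on_const Suc open_UNIV)
    then show ?case
      by (intro C_on_real_SucI[OF open_UNIV]) (use deriv in \<open>auto simp: has_real_derivative_iff_has_vector_derivative\<close>)
  qed
  moreover have "p 0 = flat_exp" by (simp add: fun_eq_iff p_def flat_exp_def)
  ultimately show ?thesis by metis
qed

text \<open>Scaling the argument of \<open>flat_exp\<close> amounts to taking roots, so the functions below increase to the
  indicator of the open interval.\<close>

definition bump :: "real \<Rightarrow> real \<Rightarrow> nat \<Rightarrow> real \<Rightarrow> real" where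
  "bump a b k x = flat_exp (real k * (x - a)) * flat_exp (real k * (b - x))"

lemma bump_bounds: "0 \<le> bump a b k x" "bump a b k x \<le> 1"
  by (auto simp: bump_def flat_exp_simps intro: mult_le_one)

lemma bump_eq_0: "x \<notin> {a<..<b} \<Longrightarrow> bump a b k x = 0"
  by (auto simp: bump_def flat_exp_simps mult_le_0_iff not_less)

lemma flat_exp_tendsto_1:
  assumes "filterlim f at_top sequentially" shows "(\<lambda>k. flat_exp (f k)) \<longlonglongrightarrow> 1"
proof (rule Lim_transform_eventually)
  have "(\<lambda>k. exp (- inverse (f k))) \<longlonglongrightarrow> exp (- 0)"
    by (intro tendsto_intros tendsto_inverse_0_at_top assms)
  then show "(\<lambda>k. exp (- inverse (f k))) \<longlonglongrightarrow> 1" by simp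
  show "eventually (\<lambda>k. exp (- inverse (f k)) = flat_exp (f k)) sequentially"
    using eventually_compose_filterlim[OF eventually_gt_at_top[of 0] assms]
    by eventually_elim (simp add: flat_exp_def)
qed

lemma bump_tendsto: "(\<lambda>k. bump a b k x) \<longlonglongrightarrow> indicator {a<..<b} x"
proof (cases "x \<in> {a<..<b}")
  case True
  have "filterlim (\<lambda>k. real k * c) at_top sequentially" if "0 < c" for c
    using filterlim_tendsto_pos_mult_at_top[OF tendsto_const that filterlim_real_sequentially] by (simp add: mult.commute)
  then have "(\<lambda>k. bump a b k x) \<longlonglongrightarrow> 1 * 1"
    unfolding bump_def using True by (intro tendsto_mult flat_exp_tendsto_1) auto
  then show ?thesis using True by simp
qed (simp add: bump_eq_0)

lemma C_on_bump:
  assumes S: "open S" and f: "C_on j S f" shows "C_on j S (\<lambda>x. bump a b k (f x))"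
proof -
  show ?thesis unfolding bump_def
    by (intro C_on_mult[OF S] C_on_compose_real[OF S open_UNIV _ smooth_flat_exp] C_on_diff[OF S] C_on_const f) auto
qed

section \<open>Line integrals along monotone homeomorphisms\<close>

text \<open>The order of the end points fixes the orientation. The inverse \<open>K\<close> is
  carried along so that a map and its inverse can be treated by the same statements.\<close>

definition "increasing_homeo r R rs Rs H K \<longleftrightarrow>
  homeomorphism {r..R} {rs..Rs} H K \<and> H r = rs \<and> H R = Rs \<and> r < R \<and> rs < (Rs::real)"
  for r R :: real

lemma increasing_homeo_sym:
  assumes "increasing_homeo r R rs Rs H K" shows "increasing_homeo rs Rs r R K H"
proof -
  have h: "homeomorphism {r..R} {rs..Rs} H K" "H r = rs" "H R = Rs" "r < R" "rs < Rs"
    using assms by (auto simp: increasing_homeo_def)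
  have "K (H r) = r" "K (H R) = R" using homeomorphism_apply1[OF h(1)] h(4) by auto
  then show ?thesis using h homeomorphism_symD[OF h(1)] by (auto simp: increasing_homeo_def)
qed

lemma increasing_homeo_less:
  assumes "increasing_homeo r R rs Rs H K" "r \<le> x" "x < y" "y \<le> R" shows "H x < H y"
proof -
  have h: "homeomorphism {r..R} {rs..Rs} H K" "H r = rs" "H R = Rs" "r < R" "rs < Rs"
    using assms by (auto simp: increasing_homeo_def)
  have inj: "inj_on H {r..R}" using h(1) by (metis homeomorphism_apply1 inj_on_inverseI)
  have cont: "continuous_on {r..R} H" using h(1) by (rule homeomorphism_cont1)
  have sub: "continuous_on {r..y} H" "inj_on H {r..y}"
    using assms by (auto intro: continuous_on_subset[OF cont] inj_on_subset[OF inj])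
  have ry: "H r < H y"
  proof (cases "y = R")
    case False
    then show ?thesis using continuous_inj_imp_mono[of r y R H] cont inj assms h by auto
  qed (use h in simp)
  show ?thesis
  proof (cases "x = r")
    case False
    then show ?thesis using continuous_inj_imp_mono[of r x y H] sub ry assms by auto
  qed (use ry in simp)
qed

lemma increasing_homeo_facts:
  assumes "increasing_homeo r R rs Rs H K"
  shows "continuous_on {r..R} H" "continuous_on {rs..Rs} K" "H r = rs" "H R = Rs" "r < R" "rs < Rs"
    "\<And>s. s \<in> {r..R} \<Longrightarrow> H s \<in> {rs..Rs}" "\<And>s. s \<in> {r..R} \<Longrightarrow> K (H s) = s"
    "\<And>t. t \<in> {rs..Rs} \<Longrightarrow> K t \<in> {r..R}" "\<And>t. t \<in> {rs..Rs} \<Longrightarrow> H (K t) = t"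
  using assms unfolding increasing_homeo_def homeomorphism_def by auto

lemma increasing_homeoI:
  fixes r R rs Rs :: real
  assumes "continuous_on {r..R} H" and mono: "\<And>x y. r \<le> x \<Longrightarrow> x < y \<Longrightarrow> y \<le> R \<Longrightarrow> H x < H y"
    and "H r = rs" "H R = Rs" "r < R"
  obtains K where "increasing_homeo r R rs Rs H K"
proof -
  have le: "H x \<le> H y" if "r \<le> x" "x \<le> y" "y \<le> R" for x y using mono[of x y] that by (cases "x = y") auto
  have "inj_on H {r..R}" by (rule linorder_inj_onI) (use mono in fastforce)+
  moreover have "H ` {r..R} = {rs..Rs}"
  proof (intro equalityI subsetI)
    fix y assume "y \<in> {rs..Rs}"
    then show "y \<in> H ` {r..R}" using IVT'[of H r y R] assms by auto
  qed (use le assms in auto)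
  ultimately obtain K where "homeomorphism {r..R} {rs..Rs} H K"
    using homeomorphism_compact[OF compact_Icc assms(1)] by blast
  then show thesis using that[of K] mono[of r R] assms by (auto simp: increasing_homeo_def)
qed

text \<open>Parametrised by \<open>s + H s\<close>, the graph of \<open>H\<close> is a Lipschitz curve, and the difference of both sides
  has zero derivative along it.\<close>

lemma monotone_line_integral:
  fixes S :: "real \<Rightarrow> real \<Rightarrow> real"
  assumes hom: "increasing_homeo r R rs Rs H K"
    and S: "\<And>s. s \<in> {r..R} \<Longrightarrow>
      ((\<lambda>z. S (fst z) (snd z)) has_derivative (\<lambda>z. p s * fst z + q s * snd z)) (at (s, H s))"
    and p: "continuous_on {r..R} p" and q: "continuous_on {r..R} q"
  shows "integral {r..R} p + integral {rs..Rs} (\<lambda>t. q (K t)) = S R Rs - S r rs"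
proof -
  note h = increasing_homeo_facts[OF hom]
  define X where "X = {r..R} \<times> {rs..Rs}"
  define Phi where "Phi z = S (fst z) (snd z) - integral {r..fst z} p - integral {rs..snd z} (\<lambda>t. q (K t))" for z
  have qK: "continuous_on {rs..Rs} (\<lambda>t. q (K t))"
    by (rule continuous_on_compose2[OF q h(2)]) (use h in auto)
  \<comment> \<open>The derivative vanishes at the points of the graph, where
    \<open>K (H s) = s\<close>, but not around them; constancy is therefore available only along the
    curve itself.\<close>
  have Phi': "(Phi has_derivative (\<lambda>_. 0)) (at (s, H s) within X)" if s: "s \<in> {r..R}" for s
  proof -
    have "((\<lambda>x. integral {r..x} p) has_derivative (\<lambda>x. p s * x)) (at (fst (s, H s)) within fst ` X)"
      using integral_has_real_derivative[OF p s] unfolding has_field_derivative_def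
      by (auto intro!: has_derivative_subset[of _ _ _ "{r..R}" "fst ` X"] simp: X_def)
    from has_derivative_in_compose[OF has_derivative_fst[OF has_derivative_ident] this]
    have 1: "((\<lambda>z. integral {r..fst z} p) has_derivative (\<lambda>z. p s * fst z)) (at (s, H s) within X)" .
    have "((\<lambda>x. integral {rs..x} (\<lambda>t. q (K t))) has_derivative (\<lambda>x. q s * x)) (at (snd (s, H s)) within snd ` X)"
      using integral_has_real_derivative[OF qK h(7)[OF s]] h(8)[OF s] unfolding has_field_derivative_def
      by (auto intro!: has_derivative_subset[of _ _ _ "{rs..Rs}" "snd ` X"] simp: X_def)
    from has_derivative_in_compose[OF has_derivative_snd[OF has_derivative_ident] this]
    have 2: "((\<lambda>z. integral {rs..snd z} (\<lambda>t. q (K t))) has_derivative (\<lambda>z. q s * snd z)) (at (s, H s) within X)" .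
    from has_derivative_diff[OF has_derivative_diff[OF has_derivative_at_withinI[OF S[OF s]] 1] 2]
    show ?thesis unfolding Phi_def by (simp add: algebra_simps)
  qed
  obtain \<sigma> where \<sigma>: "increasing_homeo r R (r + rs) (R + Rs) (\<lambda>s. s + H s) \<sigma>"
  proof (rule increasing_homeoI[of r R "\<lambda>s. s + H s" "r + rs" "R + Rs"])
    show "x + H x < y + H y" if "r \<le> x" "x < y" "y \<le> R" for x y
      using increasing_homeo_less[OF hom that] that by simp
  qed (use h in \<open>auto intro!: continuous_intros\<close>)
  note g = increasing_homeo_facts[OF \<sigma>]
  let ?\<gamma> = "\<lambda>\<xi>. (\<sigma> \<xi>, H (\<sigma> \<xi>))"
  \<comment> \<open>Both coordinates increase along the curve and their sum is the parameter, so
    their increments add up to \<open>y - x\<close>. This Lipschitz bound carries the vanishing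
    derivative over to the composition with the curve.\<close>
  have dist: "norm (?\<gamma> y - ?\<gamma> x) \<le> norm (y - x)" if xy: "x \<in> {r+rs..R+Rs}" "y \<in> {r+rs..R+Rs}" for x y
  proof -
    have *: "\<bar>\<sigma> y - \<sigma> x\<bar> + \<bar>H (\<sigma> y) - H (\<sigma> x)\<bar> = y - x" if "x \<in> {r+rs..R+Rs}" "y \<in> {r+rs..R+Rs}" "x < y" for x y
    proof -
      have "\<sigma> x < \<sigma> y" using increasing_homeo_less[OF increasing_homeo_sym[OF \<sigma>], of x y] that by auto
      moreover from this have "H (\<sigma> x) < H (\<sigma> y)"
        using increasing_homeo_less[OF hom, of "\<sigma> x" "\<sigma> y"] g(9)[OF that(1)] g(9)[OF that(2)] by auto
      ultimately show ?thesis using g(10)[OF that(1)] g(10)[OF that(2)] by simp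
    qed
    have "\<bar>\<sigma> y - \<sigma> x\<bar> + \<bar>H (\<sigma> y) - H (\<sigma> x)\<bar> \<le> \<bar>y - x\<bar>"
      using *[of x y] *[of y x] xy by (cases x y rule: linorder_cases) (auto simp: abs_minus_commute)
    moreover have "norm (?\<gamma> y - ?\<gamma> x) \<le> \<bar>\<sigma> y - \<sigma> x\<bar> + \<bar>H (\<sigma> y) - H (\<sigma> x)\<bar>"
      using norm_Pair_le[of "\<sigma> y - \<sigma> x" "H (\<sigma> y) - H (\<sigma> x)"] by simp
    ultimately show ?thesis by simp
  qed
  have X: "?\<gamma> \<xi> \<in> X" if "\<xi> \<in> {r+rs..R+Rs}" for \<xi> using g(9)[OF that] h(7) by (auto simp: X_def)
  have "\<exists>c. \<forall>\<xi>\<in>{r+rs..R+Rs}. Phi (?\<gamma> \<xi>) = c"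
  proof (rule has_derivative_zero_constant)
    fix \<xi> assume \<xi>: "\<xi> \<in> {r+rs..R+Rs}"
    show "((\<lambda>\<xi>. Phi (?\<gamma> \<xi>)) has_derivative (\<lambda>h. 0)) (at \<xi> within {r+rs..R+Rs})"
      unfolding has_derivative_within_alt
    proof (intro conjI allI impI)
      fix e :: real assume e: "0 < e"
      have "\<exists>d>0. \<forall>y\<in>X. norm (y - ?\<gamma> \<xi>) < d \<longrightarrow> norm (Phi y - Phi (?\<gamma> \<xi>) - 0) \<le> e * norm (y - ?\<gamma> \<xi>)"
        using Phi'[OF g(9)[OF \<xi>]] e unfolding has_derivative_within_alt by blast
      then obtain d where d: "0 < d" "\<And>y. y \<in> X \<Longrightarrow> norm (y - ?\<gamma> \<xi>) < d \<Longrightarrow> norm (Phi y - Phi (?\<gamma> \<xi>)) \<le> e * norm (y - ?\<gamma> \<xi>)"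
        unfolding diff_zero by blast
      have "norm (Phi (?\<gamma> y) - Phi (?\<gamma> \<xi>) - 0) \<le> e * norm (y - \<xi>)"
        if y: "y \<in> {r+rs..R+Rs}" "norm (y - \<xi>) < d" for y
      proof -
        have "norm (Phi (?\<gamma> y) - Phi (?\<gamma> \<xi>)) \<le> e * norm (?\<gamma> y - ?\<gamma> \<xi>)"
          using dist[OF \<xi> y(1)] y(2) by (intro d(2) X y(1)) linarith
        also have "\<dots> \<le> e * norm (y - \<xi>)" using dist[OF \<xi> y(1)] e by (intro mult_left_mono) auto
        finally show ?thesis by simp
      qed
      then show "\<exists>d>0. \<forall>y\<in>{r+rs..R+Rs}. norm (y - \<xi>) < d \<longrightarrow> norm (Phi (?\<gamma> y) - Phi (?\<gamma> \<xi>) - 0) \<le> e * norm (y - \<xi>)"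
        using d(1) by blast
    qed auto
  qed auto
  then have "Phi (?\<gamma> (R + Rs)) = Phi (?\<gamma> (r + rs))" using h by auto
  moreover have "\<sigma> (R + Rs) = R" "\<sigma> (r + rs) = r" using g(8)[of R] g(8)[of r] h by auto
  ultimately show ?thesis using h by (simp add: Phi_def)
qed

section \<open>The calibration\<close>

text \<open>For the energy density \<open>((n-1)t\<^sup>2 + y\<^sup>2)\<^bsup>n/2\<^esup>\<close> with \<open>t = H/s\<close>, \<open>y = H'\<close>, these are the derivative in
  \<open>y\<close> and the value at \<open>0\<close> of the tangent at \<open>y\<close>.\<close>

definition energy_slope :: "nat \<Rightarrow> real \<Rightarrow> real \<Rightarrow> real" where
  "energy_slope n t y = real n * ((real n - 1) * t\<^sup>2 + y\<^sup>2) powr (real n / 2 - 1) * y"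

definition energy_rest :: "nat \<Rightarrow> real \<Rightarrow> real \<Rightarrow> real" where
  "energy_rest n t y = ((real n - 1) * t\<^sup>2 + y\<^sup>2) powr (real n / 2 - 1) * (((real n - 1) * t\<^sup>2 + y\<^sup>2) - real n * y\<^sup>2)"

text \<open>The algebra behind the inverse part of the eikonal derivative, for \<open>m = n\<close>,
  \<open>w = y ^ (- n)\<close>, \<open>q\<close> the power \<open>expo\<close> of \<open>Q\<close>,
  and \<open>g\<close> the slope of the field. Treating the reciprocals as unknowns
  \<open>\<tau>\<close> and \<open>\<eta>\<close> with \<open>t * \<tau> = 1\<close> and
  \<open>y * \<eta> = 1\<close> makes it polynomial. Both sides are affine in \<open>g\<close>, and
  the coefficients \<open>c0\<close> and \<open>c1\<close> are compared separately.\<close>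

lemma lag_B_identity:
  fixes m q Q t y g w \<tau> \<eta> :: real
  assumes Q: "Q = (m - 1) * y\<^sup>2 + t\<^sup>2" and \<tau>: "\<tau> = inverse t" "t \<noteq> 0" and \<eta>: "\<eta> = inverse y" "y \<noteq> 0"
  shows "(((m * (q * Q) * (t + (m - 1) * y * g) * y + q * Q\<^sup>2 * g) * w + q * Q\<^sup>2 * y * (- m * w * g * \<eta>)) * \<tau>
       + q * Q\<^sup>2 * y * w * (- \<tau>\<^sup>2))
      + ((1 - g) * ((m - 1) * (q * Q) * (y\<^sup>2 - t\<^sup>2) * w * \<tau>) + (t - y) *
       (((((m - 1) * ((m - 2) * q * (t + (m - 1) * y * g))) * (y\<^sup>2 - t\<^sup>2) + (m - 1) * (q * Q) * (2 * y * g - 2 * t)) * w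
           + (m - 1) * (q * Q) * (y\<^sup>2 - t\<^sup>2) * (- m * w * g * \<eta>)) * \<tau> + (m - 1) * (q * Q) * (y\<^sup>2 - t\<^sup>2) * w * (- \<tau>\<^sup>2)))
    = m * ((m - 1) * (q * Q) * (y\<^sup>2 - t\<^sup>2) * w / t) + m * (m - 1) * (t - y) *
       (q * ((Q + (m - 2) * y * t) * y * w / t + (t\<^sup>2 + y\<^sup>2) * t * w / y * g))" (is "?L = ?R")
proof -
  define c0 where "c0 = m * Q * t * y * \<tau> - Q\<^sup>2 * y * \<tau>\<^sup>2 + (m - 1) * Q * (y\<^sup>2 - t\<^sup>2) * \<tau> +
    (t - y) * (m - 1) * ((m - 2) * t * (y\<^sup>2 - t\<^sup>2) * \<tau> - 2 * t * Q * \<tau> - Q * (y\<^sup>2 - t\<^sup>2) * \<tau>\<^sup>2)"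
  define c1 where "c1 = m * (m - 1) * Q * y\<^sup>2 * \<tau> + Q\<^sup>2 * \<tau> - m * Q\<^sup>2 * \<eta> * y * \<tau> - (m - 1) * Q * (y\<^sup>2 - t\<^sup>2) * \<tau> +
    (t - y) * (m - 1) * ((m - 2) * (m - 1) * y * (y\<^sup>2 - t\<^sup>2) * \<tau> + 2 * y * Q * \<tau> - m * Q * (y\<^sup>2 - t\<^sup>2) * \<eta> * \<tau>)"
  have "?L = q * w * (c0 + g * c1)" unfolding c0_def c1_def by algebra
  moreover have "c0 = m * (m - 1) * Q * (y\<^sup>2 - t\<^sup>2) * \<tau> + m * (m - 1) * (t - y) * (Q + (m - 2) * y * t) * y * \<tau>"
  proof -
    have "t * \<tau> = 1" using \<tau> by simp
    then show ?thesis unfolding c0_def Q by algebra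
  qed
  moreover have "c1 = m * (m - 1) * (t - y) * (t\<^sup>2 + y\<^sup>2) * t * \<eta>"
  proof -
    have "t * \<tau> = 1" "y * \<eta> = 1" using \<tau> \<eta> by simp_all
    then show ?thesis unfolding c1_def Q by algebra
  qed
  moreover have "?R = q * w * ((m * (m - 1) * Q * (y\<^sup>2 - t\<^sup>2) * \<tau> + m * (m - 1) * (t - y) * (Q + (m - 2) * y * t) * y * \<tau>)
      + g * (m * (m - 1) * (t - y) * (t\<^sup>2 + y\<^sup>2) * t * \<eta>))"
    unfolding divide_inverse \<tau>(1)[symmetric] \<eta>(1)[symmetric] by algebra
  ultimately show ?thesis by simp
qed

context energy_coefficients
begin

text \<open>The energy densities of the map and of its inverse, as functions of
  \<open>t = H / s\<close> and \<open>y = H'\<close> after division by \<open>s ^ (n - 1)\<close>.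
  For \<open>lag_B\<close> the inverse density is pulled back to the source by
  \<open>dH = y ds\<close> and \<open>H = t * s\<close>. The other two functions are the partial
  derivatives in \<open>y\<close>.\<close>

definition "lag_A t y = quad_form t y powr (real n / 2)"
definition "lag_B t y = quad_form y t powr (real n / 2) * y * inverse (y ^ n) / t"
definition "lag_Ay t y = real n * y * quad_form t y powr (real n / 2 - 1)"
definition "lag_By t y = (real n - 1) * quad_form y t powr (real n / 2 - 1) * (y\<^sup>2 - t\<^sup>2) * inverse (y ^ n) / t"

text \<open>The total Lagrangian is \<open>s\<^bsup>n-1\<^esup> L(h/s, y)\<close>, so the potential is sought in the form
  \<open>s\<^sup>n eikonal(h/s)\<close>; its two partial derivatives then force \<open>n eikonal = L + (t - y) L\<^sub>y\<close>.\<close>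

definition "eikonal t y = (a * (lag_A t y + (t - y) * lag_Ay t y) + b * (lag_B t y + (t - y) * lag_By t y)) / n"

lemma quad_powr:
  assumes "0 < t" "0 < y"
  shows "quad_form t y powr (real n / 2 - 1) = quad_form t y powr expo * quad_form t y"
    "quad_form t y powr (real n / 2) = quad_form t y powr expo * (quad_form t y)\<^sup>2"
proof -
  have e: "real n / 2 - 1 = expo + 1" "real n / 2 = expo + 2" by (simp_all add: expo_def field_simps)
  show "quad_form t y powr (real n / 2 - 1) = quad_form t y powr expo * quad_form t y"
    "quad_form t y powr (real n / 2) = quad_form t y powr expo * (quad_form t y)\<^sup>2"
    unfolding e using quad_form_pos[OF assms] by (simp_all add: powr_add)
qed

lemma energy_slope_eq: "energy_slope n t y = lag_Ay t y"
  unfolding energy_slope_def lag_Ay_def quad_form_def by simp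

lemma energy_rest_eq: "0 < t \<Longrightarrow> 0 < y \<Longrightarrow> energy_rest n t y = lag_A t y - y * lag_Ay t y"
proof -
  assume ty: "0 < t" "0 < y"
  let ?p = "quad_form t y powr expo" and ?q = "quad_form t y"
  have "energy_rest n t y = ?p * ?q * (?q - real n * y\<^sup>2)"
    unfolding energy_rest_def quad_form_def[symmetric] quad_powr[OF ty] ..
  also have "\<dots> = ?p * ?q\<^sup>2 - y * (real n * y * (?p * ?q))"
  proof -
    have "p * q * (q - m * y\<^sup>2) = p * q\<^sup>2 - y * (m * y * (p * q))" for p q m :: real
      by (simp add: algebra_simps power2_eq_square)
    then show ?thesis .
  qed
  finally show ?thesis unfolding lag_A_def lag_Ay_def quad_powr[OF ty] .
qed

lemma quad_form_inverse:
  assumes "0 < t" "0 < y" shows "quad_form (1 / t) (1 / y) = quad_form y t / (t * y)\<^sup>2"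
  using assms by (simp add: quad_form_def field_simps)

text \<open>With \<open>f\<close> the energy density, the pulled-back one is
  \<open>L t y = t ^ (n - 1) * y * f (1 / t) (1 / y)\<close>. The factor \<open>y\<close> together
  with the reciprocal slope exchanges the two data of a tangent: the slope of \<open>f\<close> is
  the value at zero of the tangent to \<open>L\<close>, and conversely.\<close>

lemma energy_dual:
  assumes ty: "0 < t" "0 < y"
  shows "t ^ (n - 1) * energy_slope n (1 / t) (1 / y) = lag_B t y - y * lag_By t y"
    "t ^ (n - 1) * energy_rest n (1 / t) (1 / y) = lag_By t y"
proof -
  have Q: "0 < quad_form y t" using quad_form_pos ty by simp
  define j where "j = n - 2"
  have j: "n = Suc (Suc j)" using n3 by (simp add: j_def)
  have "((t * y)\<^sup>2) powr (real n / 2 - 1) = ((t * y) powr 2) powr (real j / 2)"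
  proof -
    have e: "real n / 2 - 1 = real j / 2" by (simp add: j field_simps)
    show ?thesis unfolding e using ty by simp
  qed
  also have "\<dots> = (t * y) ^ j" unfolding powr_powr using ty by (simp add: powr_realpow)
  finally have "((t * y)\<^sup>2) powr (real n / 2 - 1) = (t * y) ^ j" .
  then have p: "quad_form (1 / t) (1 / y) powr (real n / 2 - 1) = quad_form y t powr (real n / 2 - 1) / (t * y) ^ j"
    using ty Q by (simp add: quad_form_inverse powr_divide)
  have q: "quad_form y t powr (real n / 2) = quad_form y t powr (real n / 2 - 1) * quad_form y t"
    using quad_powr[OF ty(2,1)] by (simp add: power2_eq_square)
  define w where "w = quad_form y t powr (real n / 2 - 1)"
  have 1: "quad_form y t - (real n - 1) * (y\<^sup>2 - t\<^sup>2) = real n * t\<^sup>2" by (simp add: quad_form_def algebra_simps)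
  have "lag_B t y - y * lag_By t y = w * (quad_form y t - (real n - 1) * (y\<^sup>2 - t\<^sup>2)) * y * inverse (y ^ n) / t"
    by (simp add: lag_B_def lag_By_def q w_def algebra_simps diff_divide_distrib add_divide_distrib)
  also have "\<dots> = w * real n * t * y / y ^ n" unfolding 1 using ty by (simp add: power2_eq_square divide_inverse)
  also have "\<dots> = t ^ (n - 1) * energy_slope n (1 / t) (1 / y)"
    unfolding energy_slope_eq lag_Ay_def p w_def[symmetric] using ty
    by (simp add: j power_mult_distrib field_simps)
  finally show "t ^ (n - 1) * energy_slope n (1 / t) (1 / y) = lag_B t y - y * lag_By t y" ..
  have 2: "quad_form (1 / t) (1 / y) - real n * (1 / y)\<^sup>2 = (real n - 1) * (y\<^sup>2 - t\<^sup>2) / (t * y)\<^sup>2"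
    using ty by (simp add: quad_form_inverse) (simp add: quad_form_def field_simps)
  have "energy_rest n (1 / t) (1 / y) = w / (t * y) ^ j * ((real n - 1) * (y\<^sup>2 - t\<^sup>2) / (t * y)\<^sup>2)"
    unfolding energy_rest_def quad_form_def[symmetric] p w_def[symmetric] 2 ..
  then show "t ^ (n - 1) * energy_rest n (1 / t) (1 / y) = lag_By t y"
    unfolding lag_By_def w_def[symmetric] using ty
    by (simp add: j power_mult_distrib power2_eq_square field_simps)
qed

text \<open>This is where the differential equation for the slope function enters: it is the integrability condition
  for the field.\<close>

lemma eikonal_deriv:
  assumes l: "0 < l" and t: "0 < t"
  shows "((\<lambda>t. eikonal t (F l t)) has_real_derivative a * lag_Ay t (F l t) + b * lag_By t (F l t)) (at t)"
proof -
  define y where "y = F l t"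
  define g where "g = G t y"
  have y: "0 < y" "(F l has_real_derivative g) (at t)" using F_pos[OF l t] F_deriv[OF l t] by (auto simp: y_def g_def)
  define P p where "P = quad_form t y" and "p = quad_form t y powr expo"
  define Q q where "Q = quad_form y t" and "q = quad_form y t powr expo"
  define w where "w = inverse (y ^ n)"
  have PQ: "0 < P" "0 < Q" using quad_form_pos t y by (auto simp: P_def Q_def)
  have Pd: "((\<lambda>t. quad_form t (F l t)) has_real_derivative 2 * ((real n - 1) * t + y * g)) (at t)"
    unfolding quad_form_def y_def by (rule derivative_eq_intros y refl | simp add: y_def[symmetric])+
  have Qd: "((\<lambda>t. quad_form (F l t) t) has_real_derivative 2 * (t + (real n - 1) * y * g)) (at t)"
    unfolding quad_form_def y_def by (rule derivative_eq_intros y refl | simp add: y_def[symmetric])+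
  have pw: "((\<lambda>t. f t powr c) has_real_derivative c * f t powr (c - 1) * f') (at t)"
    if "(f has_real_derivative f') (at t)" "0 < f t" for f f' c
    by (rule DERIV_chain2[OF has_real_derivative_powr that(1)]) (rule that)
  have e1: "real n / 2 - 1 - 1 = expo" by (simp add: expo_def)
  have P1: "((\<lambda>t. quad_form t (F l t) powr (real n / 2 - 1)) has_real_derivative (real n - 2) * p * ((real n - 1) * t + y * g)) (at t)"
    by (rule DERIV_cong[OF pw[OF Pd, of "real n / 2 - 1"]])
       (use PQ in \<open>simp_all add:  e1 P_def[folded y_def] p_def[folded y_def] flip: y_def, (simp add: field_simps)?\<close>)
  have P2: "((\<lambda>t. quad_form t (F l t) powr (real n / 2)) has_real_derivative real n * (p * P) * ((real n - 1) * t + y * g)) (at t)"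
    by (rule DERIV_cong[OF pw[OF Pd, of "real n / 2"]])
       (use PQ quad_powr(1)[OF t y(1)] in \<open>simp_all add:  e1 P_def[folded y_def] p_def[folded y_def] flip: y_def, (simp add: field_simps)?\<close>)
  have Q1: "((\<lambda>t. quad_form (F l t) t powr (real n / 2 - 1)) has_real_derivative (real n - 2) * q * (t + (real n - 1) * y * g)) (at t)"
    by (rule DERIV_cong[OF pw[OF Qd, of "real n / 2 - 1"]])
       (use PQ in \<open>simp_all add:  e1 Q_def[folded y_def] q_def[folded y_def] flip: y_def, (simp add: field_simps)?\<close>)
  have Q2: "((\<lambda>t. quad_form (F l t) t powr (real n / 2)) has_real_derivative real n * (q * Q) * (t + (real n - 1) * y * g)) (at t)"
    by (rule DERIV_cong[OF pw[OF Qd, of "real n / 2"]])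
       (use PQ quad_powr(1)[OF y(1) t] in \<open>simp_all add:  e1 Q_def[folded y_def] q_def[folded y_def] flip: y_def, (simp add: field_simps)?\<close>)
  have wd: "((\<lambda>t. inverse (F l t ^ n)) has_real_derivative - real n * w * g / y) (at t)"
  proof -
    have pn: "((\<lambda>t. F l t ^ n) has_real_derivative real n * (g * y ^ (n - Suc 0))) (at t)"
      using DERIV_power[OF y(2), of n] by (simp add: y_def)
    have "((\<lambda>t. inverse (F l t ^ n)) has_real_derivative - (inverse (y ^ n) * (real n * (g * y ^ (n - Suc 0))) * inverse (y ^ n))) (at t)"
      using DERIV_inverse_fun[OF pn] y(1) by (simp add: y_def numeral_2_eq_2 mult_ac)
    moreover have "inverse (y ^ n) * (real n * (g * y ^ (n - Suc 0))) * inverse (y ^ n) = real n * w * g / y"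
    proof -
      obtain j where "n = Suc j" using n3 by (cases n) auto
      then show ?thesis using y(1) by (simp add: w_def field_simps)
    qed
    ultimately show ?thesis by simp
  qed
  have ev: "quad_form t (F l t) powr (real n / 2 - 1) = p * P" "quad_form t (F l t) powr (real n / 2) = p * P\<^sup>2"
    "quad_form (F l t) t powr (real n / 2 - 1) = q * Q" "quad_form (F l t) t powr (real n / 2) = q * Q\<^sup>2"
    "inverse (F l t ^ n) = w"
    using quad_powr[OF t y(1)] quad_powr[OF y(1) t] by (simp_all add: p_def P_def q_def Q_def y_def w_def)
  \<comment> \<open>The first term is \<open>n\<close> times \<open>lag_Ay\<close>. Everything else
    is collected behind the factor \<open>n * (n - 1) * (t - y)\<close>, which the inverse part has
    too, so that the remaining brackets can cancel against each other.\<close>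
  have Ad: "((\<lambda>t. lag_A t (F l t) + (t - F l t) * lag_Ay t (F l t)) has_real_derivative
     real n * (real n * y * (p * P)) + real n * (real n - 1) * (t - y) * (p * ((P + (real n - 2) * t * y) + (t\<^sup>2 + y\<^sup>2) * g))) (at t)"
  proof -
    have "((\<lambda>t. lag_A t (F l t) + (t - F l t) * lag_Ay t (F l t)) has_real_derivative
      real n * (p * P) * ((real n - 1) * t + y * g) + ((1 - g) * (real n * y * (p * P)) +
        (real n * g * (p * P) + (real n - 2) * p * ((real n - 1) * t + y * g) * (real n * y)) * (t - y))) (at t)"
      unfolding lag_A_def lag_Ay_def
      by (rule P1 P2 y refl derivative_eq_intros)+ (simp add: ev[folded y_def] y_def[symmetric] algebra_simps)
    moreover have "real n * (p * P) * ((real n - 1) * t + y * g) + ((1 - g) * (real n * y * (p * P)) +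
        (real n * g * (p * P) + (real n - 2) * p * ((real n - 1) * t + y * g) * (real n * y)) * (t - y))
      = real n * (real n * y * (p * P)) + real n * (real n - 1) * (t - y) * (p * ((P + (real n - 2) * t * y) + (t\<^sup>2 + y\<^sup>2) * g))"
    proof -
      have "m * (p * P) * ((m - 1) * t + y * g) + ((1 - g) * (m * y * (p * P)) +
        (m * g * (p * P) + (m - 2) * p * ((m - 1) * t + y * g) * (m * y)) * (t - y))
      = m * (m * y * (p * P)) + m * (m - 1) * (t - y) * (p * ((P + (m - 2) * t * y) + (t\<^sup>2 + y\<^sup>2) * g))"
        if "P = (m - 1) * t\<^sup>2 + y\<^sup>2" for m P p t y g :: real
        unfolding that by algebra
      from this[of P "real n" t y p g] show ?thesis unfolding P_def quad_form_def by simp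
    qed
    ultimately show ?thesis by simp
  qed
  have Bd: "((\<lambda>t. lag_B t (F l t) + (t - F l t) * lag_By t (F l t)) has_real_derivative
     real n * ((real n - 1) * (q * Q) * (y\<^sup>2 - t\<^sup>2) * w / t) + real n * (real n - 1) * (t - y) *
       (q * ((Q + (real n - 2) * y * t) * y * w / t + (t\<^sup>2 + y\<^sup>2) * t * w / y * g))) (at t)"
  proof -
    define \<tau> \<eta> where "\<tau> = inverse t" and "\<eta> = inverse y"
    have \<tau>: "((\<lambda>t. inverse t) has_real_derivative - \<tau>\<^sup>2) (at t)"
      using DERIV_inverse[of t UNIV] t by (simp add: \<tau>_def numeral_2_eq_2)
    have lag_B_inv: "lag_B t y = quad_form y t powr (real n / 2) * y * inverse (y ^ n) * inverse t"
      "lag_By t y = (real n - 1) * quad_form y t powr (real n / 2 - 1) * (y\<^sup>2 - t\<^sup>2) * inverse (y ^ n) * inverse t" for t y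
      unfolding lag_B_def lag_By_def by (rule divide_inverse)+
    let ?m = "real n"
    have wd': "((\<lambda>t. inverse (F l t ^ n)) has_real_derivative - ?m * w * g * \<eta>) (at t)"
      using wd by (simp add: \<eta>_def divide_inverse)
    let ?D = "(((?m * (q * Q) * (t + (?m - 1) * y * g) * y + q * Q\<^sup>2 * g) * w + q * Q\<^sup>2 * y * (- ?m * w * g * \<eta>)) * \<tau>
       + q * Q\<^sup>2 * y * w * (- \<tau>\<^sup>2))
      + ((1 - g) * ((?m - 1) * (q * Q) * (y\<^sup>2 - t\<^sup>2) * w * \<tau>) + (t - y) *
       (((((?m - 1) * ((?m - 2) * q * (t + (?m - 1) * y * g))) * (y\<^sup>2 - t\<^sup>2) + (?m - 1) * (q * Q) * (2 * y * g - 2 * t)) * w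
           + (?m - 1) * (q * Q) * (y\<^sup>2 - t\<^sup>2) * (- ?m * w * g * \<eta>)) * \<tau> + (?m - 1) * (q * Q) * (y\<^sup>2 - t\<^sup>2) * w * (- \<tau>\<^sup>2)))"
    have "((\<lambda>t. lag_B t (F l t) + (t - F l t) * lag_By t (F l t)) has_real_derivative ?D) (at t)"
      unfolding lag_B_inv
      by (rule Q1 Q2 wd' y \<tau> refl derivative_eq_intros)+ (simp add: ev[folded y_def] y_def[symmetric] \<tau>_def[symmetric] algebra_simps)
    moreover have "?D = ?m * ((?m - 1) * (q * Q) * (y\<^sup>2 - t\<^sup>2) * w / t) + ?m * (?m - 1) * (t - y) *
       (q * ((Q + (?m - 2) * y * t) * y * w / t + (t\<^sup>2 + y\<^sup>2) * t * w / y * g))"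
      by (rule lag_B_identity) (use t y in \<open>simp_all add: Q_def quad_form_def \<tau>_def \<eta>_def\<close>)
    ultimately show ?thesis by simp
  qed
  have yn: "1 / y ^ (n - 1) = y * w" "1 / y ^ (n + 1) = w / y"
  proof -
    obtain j where "n = Suc j" using n3 by (cases n) auto
    then show "1 / y ^ (n - 1) = y * w" "1 / y ^ (n + 1) = w / y" using y by (simp_all add: w_def field_simps)
  qed
  \<comment> \<open>The bracket left over in both parts is \<open>U + V + W * g\<close>, and it
    vanishes because \<open>g\<close> is the value of \<open>G\<close>.\<close>
  have ode: "a * (p * ((P + (real n - 2) * t * y) + (t\<^sup>2 + y\<^sup>2) * g)) +
    b * (q * ((Q + (real n - 2) * y * t) * y * w / t + (t\<^sup>2 + y\<^sup>2) * t * w / y * g)) = 0"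
  proof -
    have "W_coef n a b t y * g + (U_coef n a t y + V_coef n b t y) = 0"
      using W_pos[OF t y(1)] by (simp add: g_def G_rhs_def)
    moreover have "U_coef n a t y = a * p * (P + (real n - 2) * t * y)"
      by (simp add: U_eq mixed_form_def p_def P_def)
    moreover have "V_coef n b t y = b * q * (Q + (real n - 2) * y * t) / t * (1 / y ^ (n - 1))"
      by (simp add: V_eq mixed_form_def q_def Q_def)
    moreover have "W_coef n a b t y = (t\<^sup>2 + y\<^sup>2) * (a * p) + (t\<^sup>2 + y\<^sup>2) * (b * (t * q)) * (1 / y ^ (n + 1))"
      by (simp add: W_eq Wa_def Wb_def p_def q_def)
    ultimately show ?thesis unfolding yn using t y(1) by (simp add: algebra_simps add_divide_distrib diff_divide_distrib)
  qed
  have "((\<lambda>t. eikonal t (F l t)) has_real_derivative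
    (a * (real n * (real n * y * (p * P)) + real n * (real n - 1) * (t - y) * (p * ((P + (real n - 2) * t * y) + (t\<^sup>2 + y\<^sup>2) * g)))
     + b * (real n * ((real n - 1) * (q * Q) * (y\<^sup>2 - t\<^sup>2) * w / t) + real n * (real n - 1) * (t - y) *
       (q * ((Q + (real n - 2) * y * t) * y * w / t + (t\<^sup>2 + y\<^sup>2) * t * w / y * g)))) / n) (at t)"
    unfolding eikonal_def by (intro DERIV_cdivide DERIV_add DERIV_cmult Ad Bd)
  moreover have "(a * (real n * (real n * y * (p * P)) + real n * (real n - 1) * (t - y) * (p * ((P + (real n - 2) * t * y) + (t\<^sup>2 + y\<^sup>2) * g)))
     + b * (real n * ((real n - 1) * (q * Q) * (y\<^sup>2 - t\<^sup>2) * w / t) + real n * (real n - 1) * (t - y) *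
       (q * ((Q + (real n - 2) * y * t) * y * w / t + (t\<^sup>2 + y\<^sup>2) * t * w / y * g)))) / n
    = a * (real n * y * (p * P)) + b * ((real n - 1) * (q * Q) * (y\<^sup>2 - t\<^sup>2) * w / t)
     + (real n - 1) * (t - y) * (a * (p * ((P + (real n - 2) * t * y) + (t\<^sup>2 + y\<^sup>2) * g)) +
    b * (q * ((Q + (real n - 2) * y * t) * y * w / t + (t\<^sup>2 + y\<^sup>2) * t * w / y * g)))"
    using n3 by (simp add: algebra_simps add_divide_distrib diff_divide_distrib)
  ultimately have "((\<lambda>t. eikonal t (F l t)) has_real_derivative
    a * (real n * y * (p * P)) + b * ((real n - 1) * (q * Q) * (y\<^sup>2 - t\<^sup>2) * w / t)) (at t)"
    unfolding ode by simp
  then show ?thesis unfolding lag_Ay_def lag_By_def ev unfolding y_def .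
qed

definition "eikonal2 l s h = s ^ n * eikonal (h / s) (F l (h / s))"

text \<open>Homogeneity reduces both partial derivatives to the eikonal. With \<open>L\<close> the
  total Lagrangian, the derivative in \<open>h\<close> is \<open>s ^ (n - 1) * L_y\<close>; the one
  in \<open>s\<close> is \<open>s ^ (n - 1)\<close> times \<open>n * eikonal - t * L_y\<close>,
  which the choice of the eikonal turns into \<open>L - y * L_y\<close>.\<close>

lemma eikonal2_deriv:
  assumes l: "0 < l" and s: "0 < s" and h: "0 < h"
  defines "t \<equiv> h / s"
  shows "((\<lambda>z. eikonal2 l (fst z) (snd z)) has_derivative (\<lambda>z.
    s ^ (n - 1) * (a * (lag_A t (F l t) - F l t * lag_Ay t (F l t)) + b * (lag_B t (F l t) - F l t * lag_By t (F l t))) * fst z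
    + s ^ (n - 1) * (a * lag_Ay t (F l t) + b * lag_By t (F l t)) * snd z)) (at (s, h))"
proof -
  have t: "0 < t" using s h by (simp add: t_def)
  define y where "y = F l t"
  define d where "d = a * lag_Ay t y + b * lag_By t y"
  have "((\<lambda>t. eikonal t (F l t)) has_derivative (\<lambda>x. d * x)) (at (snd (s, h) / fst (s, h)))"
    using eikonal_deriv[OF l t] by (simp add: has_field_derivative_def d_def y_def t_def)
  moreover have "((\<lambda>z. snd z / fst z) has_derivative (\<lambda>z. (snd z * s - h * fst z) / (s * s))) (at (s, h))"
    by (rule has_derivative_eq_rhs[OF has_derivative_divide'[OF has_derivative_snd[OF has_derivative_ident] has_derivative_fst[OF has_derivative_ident]]])
      (use s in auto)
  ultimately have 1: "((\<lambda>z. eikonal (snd z / fst z) (F l (snd z / fst z))) has_derivative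
      (\<lambda>z. d * ((snd z * s - h * fst z) / (s * s)))) (at (s, h))"
    using has_derivative_compose by blast
  have 2: "((\<lambda>z. fst z ^ n) has_derivative (\<lambda>z. real n * s ^ (n - 1) * fst z)) (at (s, h))" for h :: real
    by (rule has_derivative_eq_rhs[OF has_derivative_power[OF has_derivative_fst[OF has_derivative_ident]]])
       (simp add: mult_ac)
  have "((\<lambda>z. eikonal2 l (fst z) (snd z)) has_derivative
     (\<lambda>z. s ^ n * (d * ((snd z * s - h * fst z) / (s * s))) + real n * s ^ (n - 1) * fst z * eikonal t y)) (at (s, h))"
    unfolding eikonal2_def using has_derivative_mult[OF 2 1] by (simp add: t_def y_def)
  moreover have "s ^ n * (d * ((z2 * s - h * z1) / (s * s))) + real n * s ^ (n - 1) * z1 * eikonal t y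
      = s ^ (n - 1) * (a * (lag_A t y - y * lag_Ay t y) + b * (lag_B t y - y * lag_By t y)) * z1 + s ^ (n - 1) * d * z2" for z1 z2
  proof -
    have "s ^ n = s * s ^ (n - 1)" using n3 by (metis Suc_diff_1 Suc_le_lessD less_trans numeral_3_eq_3 power_Suc zero_less_Suc)
    then have "s ^ n * (d * ((z2 * s - h * z1) / (s * s))) = s ^ (n - 1) * d * (z2 - t * z1)"
      using s by (simp add: t_def field_simps)
    moreover have "real n * eikonal t y = (a * (lag_A t y - y * lag_Ay t y) + b * (lag_B t y - y * lag_By t y)) + t * d"
    proof -
      have "real n * eikonal t y = a * (lag_A t y + (t - y) * lag_Ay t y) + b * (lag_B t y + (t - y) * lag_By t y)"
        unfolding eikonal_def using n3 by simp
      then show ?thesis by (simp add: d_def algebra_simps)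
    qed
    then have "real n * s ^ (n - 1) * z1 * eikonal t y = s ^ (n - 1) * z1 * ((a * (lag_A t y - y * lag_Ay t y) + b * (lag_B t y - y * lag_By t y)) + t * d)"
      by (metis (no_types, opaque_lifting) mult.assoc mult.commute)
    ultimately show ?thesis by (simp add: algebra_simps)
  qed
  ultimately show ?thesis unfolding d_def y_def by simp
qed

lemma continuous_on_lag:
  assumes "continuous_on A f" "continuous_on A g" "\<And>z. z \<in> A \<Longrightarrow> 0 < f z" "\<And>z. z \<in> A \<Longrightarrow> 0 < g z"
  shows "continuous_on A (\<lambda>z. energy_slope n (f z) (g z))" "continuous_on A (\<lambda>z. energy_rest n (f z) (g z))"
proof -
  have *: "(real n - 1) * (f z)\<^sup>2 + (g z)\<^sup>2 \<noteq> 0" if "z \<in> A" for z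
    using quad_form_pos[of "f z" "g z"] assms that by (force simp: quad_form_def)
  have c: "continuous_on A (\<lambda>z. (real n - 1) * (f z)\<^sup>2 + (g z)\<^sup>2)" by (intro continuous_intros assms)
  have p: "continuous_on A (\<lambda>z. ((real n - 1) * (f z)\<^sup>2 + (g z)\<^sup>2) powr (real n / 2 - 1))"
    by (rule continuous_on_powr[OF c continuous_on_const]) (use * in blast)
  show "continuous_on A (\<lambda>z. energy_slope n (f z) (g z))" "continuous_on A (\<lambda>z. energy_rest n (f z) (g z))"
    unfolding energy_slope_def energy_rest_def by (intro continuous_intros p c assms)+
qed

text \<open>Each bracket is the linearised energy of one map without the area of the sphere. The
  terms are regrouped by kind: the rest of the map and the slope of the inverse form the
  \<open>ds\<close>-coefficient \<open>p\<close>, the slope of the map and the rest of the inverse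
  the \<open>dH\<close>-coefficient \<open>q\<close>. By duality these are the partial derivatives
  of \<open>eikonal2\<close>.\<close>

lemma calibration_total:
  assumes hom: "increasing_homeo r R rs Rs H K" and r: "0 < r" and rs: "0 < rs" and l: "0 < l"
  defines "y \<equiv> \<lambda>s. F l (H s / s)"
  defines "y' \<equiv> \<lambda>t. 1 / y (K t)"
  shows "a * (integral {rs..Rs} (\<lambda>t. energy_slope n (t / K t) (y (K t)) * K t ^ (n - 1))
            + integral {r..R} (\<lambda>s. energy_rest n (H s / s) (y s) * s ^ (n - 1)))
       + b * (integral {r..R} (\<lambda>s. energy_slope n (s / H s) (y' (H s)) * H s ^ (n - 1))
            + integral {rs..Rs} (\<lambda>t. energy_rest n (K t / t) (y' t) * t ^ (n - 1)))
       = eikonal2 l R Rs - eikonal2 l r rs"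
proof -
  note h = increasing_homeo_facts[OF hom]
  have pos: "0 < s" "0 < H s" "0 < H s / s" "0 < y s" if "s \<in> {r..R}" for s
    using that h(7)[OF that] r rs F_pos[OF l] by (auto simp: y_def)
  have Kpos: "0 < K t" "0 < t" "H (K t) = t" if "t \<in> {rs..Rs}" for t
    using pos(1)[OF h(9)[OF that]] that rs h(10)[OF that] by auto
  have yc: "continuous_on {r..R} y"
    unfolding y_def by (rule continuous_on_compose2[OF F_continuous_on[OF l]])
      (use r pos in \<open>auto intro!: continuous_intros h(1)\<close>)
  define p where "p s = s ^ (n - 1) * (a * (lag_A (H s / s) (y s) - y s * lag_Ay (H s / s) (y s))
       + b * (lag_B (H s / s) (y s) - y s * lag_By (H s / s) (y s)))" for s
  define q where "q s = s ^ (n - 1) * (a * lag_Ay (H s / s) (y s) + b * lag_By (H s / s) (y s))" for s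
  define p1 where "p1 s = energy_rest n (H s / s) (y s) * s ^ (n - 1)" for s
  define p2 where "p2 s = energy_slope n (s / H s) (y' (H s)) * H s ^ (n - 1)" for s
  define q1 where "q1 s = energy_slope n (H s / s) (y s) * s ^ (n - 1)" for s
  define q2 where "q2 s = energy_rest n (s / H s) (1 / y s) * H s ^ (n - 1)" for s
  have hp: "H s ^ (n - 1) = s ^ (n - 1) * (H s / s) ^ (n - 1)" if "s \<in> {r..R}" for s
    using pos(1)[OF that] by (simp add: power_divide)
  have y'H: "y' (H s) = 1 / y s" if "s \<in> {r..R}" for s using h(8)[OF that] by (simp add: y'_def)
  have dual: "s / H s = 1 / (H s / s)" if "s \<in> {r..R}" for s by simp
  have peq: "p s = a * p1 s + b * p2 s" if s: "s \<in> {r..R}" for s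
    unfolding p_def p1_def p2_def hp[OF s] y'H[OF s] dual[OF s] energy_rest_eq[OF pos(3,4)[OF s]]
      energy_dual(1)[OF pos(3,4)[OF s], symmetric]
    by (simp add: algebra_simps)
  have qeq: "q s = a * q1 s + b * q2 s" if s: "s \<in> {r..R}" for s
    unfolding q_def q1_def q2_def hp[OF s] dual[OF s] energy_slope_eq
      energy_dual(2)[OF pos(3,4)[OF s], symmetric]
    by (simp add: algebra_simps)
  have c1: "continuous_on {r..R} p1" "continuous_on {r..R} q1"
    unfolding p1_def q1_def by (intro continuous_intros continuous_on_lag h yc; use pos in force)+
  have c2': "continuous_on {r..R} (\<lambda>s. energy_slope n (s / H s) (1 / y s) * H s ^ (n - 1))"
    and c2: "continuous_on {r..R} q2"
    unfolding q2_def by (intro continuous_intros continuous_on_lag h yc; use pos in force)+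
  have c3: "continuous_on {r..R} p2"
    using c2' by (rule continuous_on_eq) (simp add: p2_def y'H)
  have pc: "continuous_on {r..R} p"
    by (rule continuous_on_eq[of _ "\<lambda>s. a * p1 s + b * p2 s"]) (auto simp: peq intro!: continuous_intros c1 c3)
  have qc: "continuous_on {r..R} q"
    by (rule continuous_on_eq[of _ "\<lambda>s. a * q1 s + b * q2 s"]) (auto simp: qeq intro!: continuous_intros c1 c2)
  have cK: "continuous_on {rs..Rs} (\<lambda>t. f (K t))" if "continuous_on {r..R} f" for f :: "real \<Rightarrow> real"
    by (rule continuous_on_compose2[OF that h(2)]) (use h(9) in auto)
  have "integral {r..R} p + integral {rs..Rs} (\<lambda>t. q (K t)) = eikonal2 l R Rs - eikonal2 l r rs"
    by (rule monotone_line_integral[OF hom _ pc qc])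
       (use eikonal2_deriv[OF l pos(1) pos(2)] in \<open>simp add: p_def q_def y_def\<close>)
  moreover have "integral {r..R} p = a * integral {r..R} p1 + b * integral {r..R} p2"
  proof -
    have "integral {r..R} p = integral {r..R} (\<lambda>s. a * p1 s + b * p2 s)"
      by (rule Henstock_Kurzweil_Integration.integral_cong) (rule peq)
    also have "\<dots> = integral {r..R} (\<lambda>s. a * p1 s) + integral {r..R} (\<lambda>s. b * p2 s)"
      by (intro Henstock_Kurzweil_Integration.integral_add integrable_continuous_interval continuous_intros c1 c3)
    finally show ?thesis by simp
  qed
  moreover have "integral {rs..Rs} (\<lambda>t. q (K t)) = a * integral {rs..Rs} (\<lambda>t. q1 (K t)) + b * integral {rs..Rs} (\<lambda>t. q2 (K t))"
  proof -
    have "integral {rs..Rs} (\<lambda>t. q (K t)) = integral {rs..Rs} (\<lambda>t. a * q1 (K t) + b * q2 (K t))"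
      by (rule Henstock_Kurzweil_Integration.integral_cong) (rule qeq[OF h(9)])
    also have "\<dots> = integral {rs..Rs} (\<lambda>t. a * q1 (K t)) + integral {rs..Rs} (\<lambda>t. b * q2 (K t))"
      by (intro Henstock_Kurzweil_Integration.integral_add integrable_continuous_interval continuous_intros cK c1 c2)
    finally show ?thesis by simp
  qed
  moreover have "integral {rs..Rs} (\<lambda>t. q1 (K t)) = integral {rs..Rs} (\<lambda>t. energy_slope n (t / K t) (y (K t)) * K t ^ (n - 1))"
    by (rule Henstock_Kurzweil_Integration.integral_cong) (simp add: q1_def Kpos)
  moreover have "integral {rs..Rs} (\<lambda>t. q2 (K t)) = integral {rs..Rs} (\<lambda>t. energy_rest n (K t / t) (y' t) * t ^ (n - 1))"
    by (rule Henstock_Kurzweil_Integration.integral_cong) (simp add: q2_def Kpos y'_def)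
  ultimately show ?thesis unfolding p1_def p2_def by (simp add: algebra_simps)
qed

end

section \<open>Regularity\<close>

context energy_coefficients
begin

lemma C_on_G:
  assumes S: "open S" and f: "C_on k S f" and g: "C_on k S g"
    and pos: "\<And>x. x \<in> S \<Longrightarrow> 0 < f x" "\<And>x. x \<in> S \<Longrightarrow> 0 < g x"
  shows "C_on k S (\<lambda>x. G (f x) (g x))"
proof -
  note intros = C_on_mult[OF S] C_on_add[OF S] C_on_power[OF S] C_on_const C_on_minus[OF S]
  have q: "C_on k S (\<lambda>x. quad_form (f x) (g x))" "C_on k S (\<lambda>x. quad_form (g x) (f x))"
    unfolding quad_form_def by (intro intros f g)+
  have p: "C_on k S (\<lambda>x. quad_form (f x) (g x) powr expo)" "C_on k S (\<lambda>x. quad_form (g x) (f x) powr expo)"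
    by (intro C_on_powr[OF S] q; use pos quad_form_pos in auto)+
  have U: "C_on k S (\<lambda>x. U_coef n a (f x) (g x))"
    unfolding U_eq mixed_form_def by (intro intros p q f g)
  have V: "C_on k S (\<lambda>x. V_coef n b (f x) (g x))"
    unfolding V_eq mixed_form_def by (intro C_on_divide[OF S] intros p q f g) (use pos in \<open>force+\<close>)
  have W: "C_on k S (\<lambda>x. W_coef n a b (f x) (g x))"
    unfolding W_eq Wa_def Wb_def by (intro intros C_on_divide[OF S] p q f g) (use pos in \<open>force+\<close>)
  show ?thesis unfolding G_eq
    by (intro C_on_minus[OF S] C_on_divide[OF S] C_on_add[OF S] U V W) (use pos W_pos in force)
qed

text \<open>Bootstrapping: \<open>G\<close> is smooth on the open quadrant, so the equation gains
  one order of regularity at each step. The profile and its inverse are treated in the same way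
  below.\<close>

lemma F_smooth:
  assumes l: "0 < l" shows "C_on k {0<..} (F l)"
proof (induction k)
  case 0
  then show ?case using F_continuous_on[OF l] by simp
next
  case (Suc k)
  have S: "open ({0<..} :: real set)" by simp
  show ?case
  proof (rule C_on_real_SucI[OF S])
    show "(F l has_vector_derivative G t (F l t)) (at t)" if "t \<in> {0<..}" for t
      using F_deriv[OF l, of t] that by (simp add: has_real_derivative_iff_has_vector_derivative)
    show "C_on k {0<..} (\<lambda>t. G t (F l t))"
      by (intro C_on_G[OF S] C_on_id[OF S] Suc) (use F_pos[OF l] in auto)
  qed
qed

lemma H_solution_smooth:
  assumes l: "0 < l" and r: "0 < r" and H: "H_solution l r rs H"
  shows "C_on k {r<..} H"
proof (induction k)
  case 0
  then show ?case using continuous_on_subset[OF H_solution_continuous_on[OF H]] by (auto simp: subset_eq)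
next
  case (Suc k)
  have S: "open ({r<..} :: real set)" "open ({0<..} :: real set)" by auto
  show ?case
  proof (rule C_on_real_SucI[OF S(1)])
    show "(H has_vector_derivative F l (H s / s)) (at s)" if "s \<in> {r<..}" for s
      using H that at_within_Ici_interior[of r s]
      by (auto simp: has_real_derivative_iff_has_vector_derivative[symmetric] H_solution_def dest!: spec[of _ s])
    show "C_on k {r<..} (\<lambda>s. F l (H s / s))"
      by (intro C_on_compose_real[OF S(1) S(2) _ F_smooth[OF l]] C_on_divide[OF S(1)] C_on_id[OF S(1)] Suc)
         (use r H in \<open>auto simp: H_solution_def\<close>)
  qed
qed

lemma H_solution_inverse_deriv:
  assumes l: "0 < l" and r: "0 < r" and rs: "0 < rs" and H: "H_solution l r rs H"
    and hom: "increasing_homeo r R rs Rs H K" and t: "t \<in> {rs<..<Rs}"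
  shows "r < K t" "K t < R" "0 < F l (t / K t)" "(K has_real_derivative inverse (F l (t / K t))) (at t)"
proof -
  note h = increasing_homeo_facts[OF hom]
  show K: "r < K t" "K t < R" using increasing_homeo_less[OF increasing_homeo_sym[OF hom], of rs t]
     increasing_homeo_less[OF increasing_homeo_sym[OF hom], of t Rs] t h(8)[of r] h(8)[of R] h(3-5) by auto
  have HK: "H (K u) = u" if "rs < u" "u < Rs" for u using h(10)[of u] that by auto
  show F: "0 < F l (t / K t)" using K t r rs by (auto intro!: F_pos l)
  have 1: "(H has_real_derivative F l (t / K t)) (at (K t))"
    using H K HK[of t] t at_within_Ici_interior[of r "K t"] by (auto simp: H_solution_def dest!: spec[of _ "K t"])
  have 2: "isCont K t"
    using continuous_on_interior[OF h(2), of t] t by (simp add: interior_atLeastAtMost_real)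
  show "(K has_real_derivative inverse (F l (t / K t))) (at t)"
    by (rule DERIV_inverse_function[OF 1 _ _ _ _ 2, where a = rs and b = Rs]) (use HK F t in auto)
qed

text \<open>The inverse profile solves \<open>K' = 1 / F l (t / K)\<close>, so its smoothness comes
  from its own differential equation.\<close>

lemma H_solution_inverse_smooth:
  assumes l: "0 < l" and r: "0 < r" and rs: "0 < rs" and H: "H_solution l r rs H"
    and hom: "increasing_homeo r R rs Rs H K"
  shows "C_on k {rs<..<Rs} K"
proof (induction k)
  note h = increasing_homeo_facts[OF hom]
  case 0
  then show ?case using continuous_on_subset[OF h(2)] by (auto simp: subset_eq)
next
  case (Suc k)
  have S: "open ({rs<..<Rs} :: real set)" "open ({0<..} :: real set)" by auto
  note K = H_solution_inverse_deriv[OF l r rs H hom]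
  have pos: "0 < K t" "0 < t" if "t \<in> {rs<..<Rs}" for t using K(1)[OF that] that r rs by auto
  show ?case
  proof (rule C_on_real_SucI[OF S(1)])
    show "(K has_vector_derivative inverse (F l (t / K t))) (at t)" if t: "t \<in> {rs<..<Rs}" for t
      using K(4)[OF t] by (simp add: has_real_derivative_iff_has_vector_derivative)
    have "C_on k {rs<..<Rs} (\<lambda>t. F l (t / K t))"
      by (intro C_on_compose_real[OF S(1) S(2) _ F_smooth[OF l]] C_on_divide[OF S(1)] C_on_id[OF S(1)] Suc)
         (use pos in \<open>auto simp: less_imp_neq[symmetric]\<close>)
    then show "C_on k {rs<..<Rs} (\<lambda>t. inverse (F l (t / K t)))"
      by (rule C_on_compose_real[OF S(1) _ _ C_on_inverse_real, rotated]) (use K in force)+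
  qed
qed

end

section \<open>Radial maps between annuli\<close>

lemma norm_radial_map: "0 < norm x \<Longrightarrow> 0 < H (norm x) \<Longrightarrow> norm (radial_map H x) = H (norm x)"
  by (simp add: radial_map_def)

lemma radial_map_inverse:
  assumes hom: "increasing_homeo r R rs Rs H K" and r: "0 < r" and rs: "0 < rs" and x: "x \<in> annulus r R"
  shows "radial_map H x \<in> annulus rs Rs" "radial_map K (radial_map H x) = (x :: real^'n)"
proof -
  note h = increasing_homeo_facts[OF hom]
  have nx: "r < norm x" "norm x < R" "norm x \<in> {r..R}" using x by (auto simp: annulus_def)
  have H: "rs < H (norm x)" "H (norm x) < Rs"
    using increasing_homeo_less[OF hom, of r "norm x"] increasing_homeo_less[OF hom, of "norm x" R] nx h(3,4) by auto
  have n: "norm (radial_map H x) = H (norm x)" by (rule norm_radial_map) (use nx r rs H in linarith)+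
  then show "radial_map H x \<in> annulus rs Rs" using H by (simp add: annulus_def)
  show "radial_map K (radial_map H x) = x"
    unfolding radial_map_def[of K] n h(8)[OF nx(3)] using nx r rs H by (simp add: radial_map_def)
qed

lemma radial_bij:
  assumes hom: "increasing_homeo r R rs Rs H K" and r: "0 < r" and rs: "0 < rs"
    and g: "\<And>x. x \<in> annulus r R \<Longrightarrow> g x = radial_map H (x :: real^'n)"
  shows "bij_betw g (annulus r R) (annulus rs Rs)"
    "\<And>y. y \<in> annulus rs Rs \<Longrightarrow> inv_into (annulus r R) g y = radial_map K y"
proof -
  note i1 = radial_map_inverse[OF hom r rs] and i2 = radial_map_inverse[OF increasing_homeo_sym[OF hom] rs r]
  show b: "bij_betw g (annulus r R) (annulus rs Rs)"
    by (rule bij_betwI[of _ _ _ "radial_map K"]) (auto simp: i1 i2 g)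
  show "inv_into (annulus r R) g y = radial_map K y" if "y \<in> annulus rs Rs" for y
    by (rule inv_into_f_eq) (use b that in \<open>auto simp: bij_betw_def i2 g\<close>)
qed

lemma open_annulus: "open (annulus r R :: 'a::real_normed_vector set)"
proof -
  have "annulus r R = {x :: 'a. r < norm x} \<inter> {x. norm x < R}" by (auto simp: annulus_def)
  then show ?thesis by (auto intro!: open_Int open_Collect_less continuous_intros)
qed

lemma radial_map_smooth:
  assumes r: "0 < r" and H: "C_on k {r<..<R} H"
  shows "C_on k (annulus r R :: (real^'n) set) (radial_map H)"
proof -
  let ?A = "annulus r R :: (real^'n) set"
  have S: "open ?A" by (rule open_annulus)
  have n: "C_on k ?A norm" by (rule C_on_norm[OF S]) (use r in \<open>auto simp: annulus_def\<close>)
  have "C_on k ?A (\<lambda>x. (H (norm x) / norm x) *\<^sub>R x)"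
    by (intro C_on_scaleR[OF S] C_on_divide[OF S] C_on_compose_real[OF S _ n H] n C_on_id[OF S])
       (use r in \<open>auto simp: annulus_def\<close>)
  then show ?thesis by (simp add: radial_map_def[abs_def])
qed

lemma radial_diffeomorphism:
  assumes hom: "increasing_homeo r R rs Rs H K" and r: "0 < r" and rs: "0 < rs"
    and "\<And>k. C_on k {r<..<R} H" "\<And>k. C_on k {rs<..<Rs} K"
  shows "diffeomorphism (annulus r R) (annulus rs Rs) (radial_map H :: real^'n \<Rightarrow> real^'n)"
proof -
  let ?h = "radial_map H :: real^'n \<Rightarrow> real^'n"
  have "smooth_on (annulus rs Rs) (inv_into (annulus r R) ?h)"
    unfolding smooth_on_def
  proof
    fix k
    have "C_on k (annulus rs Rs) (radial_map K :: real^'n \<Rightarrow> real^'n)" by (rule radial_map_smooth) (use assms in auto)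
    then show "C_on k (annulus rs Rs) (inv_into (annulus r R) ?h)"
      using C_on_cong[OF open_annulus, of rs Rs "inv_into (annulus r R) ?h" "radial_map K" k] radial_bij(2)[OF hom r rs, of ?h] by auto
  qed
  then show ?thesis using radial_bij(1)[OF hom r rs, of ?h] radial_map_smooth[OF r assms(4)]
    by (auto simp: diffeomorphism_def smooth_on_def)
qed

section \<open>Weak derivatives\<close>

lemma lebesgue_on_support:
  fixes f :: "'a::euclidean_space \<Rightarrow> 'b::{banach, second_countable_topology}"
  assumes "K \<in> sets lebesgue" "S \<in> sets lebesgue" "K \<subseteq> S" "\<And>x. x \<in> S - K \<Longrightarrow> f x = 0"
  shows "integrable (lebesgue_on S) f \<longleftrightarrow> integrable (lebesgue_on K) f"
    "integral\<^sup>L (lebesgue_on S) f = integral\<^sup>L (lebesgue_on K) f"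
proof -
  have "(\<lambda>x. indicator S x *\<^sub>R f x) = (\<lambda>x. indicator K x *\<^sub>R f x)"
    using assms(3,4) by (force simp: indicator_def)
  then show "integrable (lebesgue_on S) f \<longleftrightarrow> integrable (lebesgue_on K) f"
    "integral\<^sup>L (lebesgue_on S) f = integral\<^sup>L (lebesgue_on K) f"
    using assms by (simp_all add: integrable_restrict_space integral_restrict_space)
qed

lemma continuous_on_integrable_compact:
  fixes f :: "'a::euclidean_space \<Rightarrow> 'b::{banach, second_countable_topology}"
  assumes "compact K" "continuous_on K f"
  shows "integrable (lebesgue_on K) f"
proof -
  have "integrable lborel (\<lambda>x. indicator K x *\<^sub>R f x)" by (rule borel_integrable_compact) (use assms in auto)
  then have "integrable lebesgue (\<lambda>x. indicator K x *\<^sub>R f x)"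
    by (subst integrable_completion) (auto dest: borel_measurable_integrable)
  then show ?thesis using assms by (simp add: integrable_restrict_space lmeasurable_compact fmeasurableD)
qed

lemma AE_lebesgue_on_iff_negligible:
  fixes S :: "'a::euclidean_space set"
  assumes "S \<in> sets lebesgue"
  shows "(AE x in lebesgue_on S. P x) \<longleftrightarrow> negligible {x \<in> S. \<not> P x}"
proof -
  have "(AE x in lebesgue_on S. P x) \<longleftrightarrow> (AE x in lebesgue. x \<in> S \<longrightarrow> P x)"
    using assms by (simp add: AE_restrict_space_iff)
  also have "\<dots> \<longleftrightarrow> {x \<in> space lebesgue. \<not> (x \<in> S \<longrightarrow> P x)} \<in> null_sets lebesgue"
    by (rule completion.AE_iff_null_sets)
  also have "{x \<in> space lebesgue. \<not> (x \<in> S \<longrightarrow> P x)} = {x \<in> S. \<not> P x}" by auto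
  finally show ?thesis by (simp add: negligible_iff_null_sets)
qed

text \<open>Almost every value is the limit of averages over cubes with a corner at the point, and
  these averages vanish. An open set is a countable union of boxes, so null sets inside boxes
  suffice.\<close>

lemma AE_zero_of_box_integrals:
  fixes u :: "'a::euclidean_space \<Rightarrow> real"
  assumes S: "open S"
    and int: "\<And>a b. cbox a b \<subseteq> S \<Longrightarrow> u integrable_on cbox a b"
    and zero: "\<And>a b. cbox a b \<subseteq> S \<Longrightarrow> integral (cbox a b) u = 0"
  shows "AE x in lebesgue_on S. u x = 0"
proof -
  have box: "negligible {x \<in> cbox a b. u x \<noteq> 0}" if ab: "cbox a b \<subseteq> S" for a b
  proof -
    \<comment> \<open>Continued by zero outside one box, the function still has vanishing integral
      over every box, because two boxes intersect in a box.\<close>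
    define f where "f x = (if x \<in> cbox a b then u x else 0)" for x
    have fint: "f integrable_on cbox c d" for c d
      unfolding f_def by (rule integrable_on_subcbox[of _ UNIV]) (use int[OF ab] in \<open>auto simp: integrable_restrict_UNIV\<close>)
    have f0: "integral (cbox c d) f = 0" for c d
    proof -
      have "integral (cbox c d) f = integral (cbox a b \<inter> cbox c d) u"
        unfolding f_def by (rule integral_restrict_Int)
      also have "\<dots> = 0"
        unfolding Int_interval by (rule zero) (use ab in \<open>auto simp flip: Int_interval\<close>)
      finally show ?thesis .
    qed
    obtain N where N: "negligible N"
       "\<And>x e. \<lbrakk>x \<notin> N; 0 < e\<rbrakk> \<Longrightarrow> \<exists>d>0. \<forall>h. 0 < h \<and> h < d \<longrightarrow> norm(integral (cbox x (x + h *\<^sub>R One)) f /\<^sub>R h ^ DIM('a) - f x) < e"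
      using integrable_ccontinuous_explicit[OF fint] by metis
    have "f x = 0" if xN: "x \<notin> N" for x
    proof (rule ccontr)
      assume "f x \<noteq> 0"
      then obtain d where "0 < d" and d: "\<And>h. 0 < h \<and> h < d \<Longrightarrow> norm(integral (cbox x (x + h *\<^sub>R One)) f /\<^sub>R h ^ DIM('a) - f x) < \<bar>f x\<bar>"
        using N(2)[OF xN, of "\<bar>f x\<bar>"] by auto
      then show False using d[of "d / 2"] by (simp add: f0)
    qed
    then have "x \<in> N" if "x \<in> cbox a b" "u x \<noteq> 0" for x using that f_def[of x] by force
    then have "{x \<in> cbox a b. u x \<noteq> 0} \<subseteq> N" by blast
    with N(1) show ?thesis by (rule negligible_subset)
  qed
  obtain \<D> where D: "countable \<D>" "\<D> \<subseteq> Pow S" "\<And>X. X \<in> \<D> \<Longrightarrow> \<exists>a b. X = cbox a b" "\<Union>\<D> = S"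
    by (rule open_countable_Union_open_cbox[OF S]) (rule that)
  have "negligible (\<Union>X\<in>\<D>. {x \<in> X. u x \<noteq> 0})"
  proof (rule negligible_countable_Union)
    show "countable ((\<lambda>X. {x \<in> X. u x \<noteq> 0}) ` \<D>)" using D(1) by simp
    fix T assume "T \<in> (\<lambda>X. {x \<in> X. u x \<noteq> 0}) ` \<D>"
    then obtain X where X: "X \<in> \<D>" "T = {x \<in> X. u x \<noteq> 0}" by auto
    obtain a b where "X = cbox a b" using D(3)[OF X(1)] by blast
    moreover have "X \<subseteq> S" using D X by blast
    ultimately show "negligible T" using box X by auto
  qed
  moreover have "(\<Union>X\<in>\<D>. {x \<in> X. u x \<noteq> 0}) = {x \<in> S. \<not> u x = 0}" using D(4) by auto
  ultimately show ?thesis using S by (simp add: AE_lebesgue_on_iff_negligible lmeasurable_open)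
qed

lemma borel_measurable_lebesgue_on_continuous:
  assumes "continuous_on UNIV f" shows "f \<in> borel_measurable (lebesgue_on S)"
  using assms by (intro measurable_restrict_space1 measurable_completion) (simp add: borel_measurable_continuous_onI)

lemma test_function_integrable:
  fixes u :: "real^'n \<Rightarrow> real"
  assumes S: "open S" and u: "locally_integrable S u" and \<phi>: "continuous_on UNIV \<phi>"
    and K: "compact K" "K \<subseteq> S" "\<And>x. x \<notin> K \<Longrightarrow> \<phi> x = 0"
  shows "integrable (lebesgue_on S) (\<lambda>x. u x * \<phi> x)"
proof -
  have u: "integrable (lebesgue_on K) u" using u K by (auto simp: locally_integrable_def)
  have "bounded (\<phi> ` K)" by (intro compact_imp_bounded compact_continuous_image continuous_on_subset[OF \<phi>] K) auto
  then obtain B where B: "\<And>x. x \<in> K \<Longrightarrow> \<bar>\<phi> x\<bar> \<le> B" by (auto simp: bounded_iff)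
  have "integrable (lebesgue_on K) (\<lambda>x. u x * \<phi> x)"
  proof (rule Bochner_Integration.integrable_bound)
    show "integrable (lebesgue_on K) (\<lambda>x. B * u x)" using u by simp
    show "(\<lambda>x. u x * \<phi> x) \<in> borel_measurable (lebesgue_on K)"
      by (intro borel_measurable_times borel_measurable_integrable[OF u] borel_measurable_lebesgue_on_continuous \<phi>)
    show "AE x in lebesgue_on K. norm (u x * \<phi> x) \<le> norm (B * u x)"
    proof (rule AE_I2)
      fix x assume "x \<in> space (lebesgue_on K)"
      then have "\<bar>\<phi> x\<bar> \<le> \<bar>B\<bar>" using B[of x] by (auto simp: space_restrict_space)
      then show "norm (u x * \<phi> x) \<le> norm (B * u x)" by (simp add: abs_mult mult.commute mult_right_mono)
    qed
  qed
  then show ?thesis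
    using lebesgue_on_support(1)[of K S "\<lambda>x. u x * \<phi> x"] K S by (auto simp: lmeasurable_compact fmeasurableD)
qed

lemma test_functionD:
  assumes "test_function S \<phi>"
  shows "continuous_on UNIV \<phi>" "compact (closure {x. \<phi> x \<noteq> 0})" "closure {x. \<phi> x \<noteq> 0} \<subseteq> S"
    "\<And>x. x \<notin> closure {x. \<phi> x \<noteq> 0} \<Longrightarrow> \<phi> x = 0" "\<And>k. C_on k UNIV \<phi>"
  using assms C_on_imp_continuous_on[of 0 UNIV \<phi>] closure_subset[of "{x. \<phi> x \<noteq> 0}"]
  by (auto simp: test_function_def smooth_on_def)

lemma test_functionI:
  assumes "\<And>k. C_on k UNIV \<phi>" "compact K" "K \<subseteq> S" "\<And>x. x \<notin> K \<Longrightarrow> \<phi> x = 0"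
  shows "test_function S \<phi>"
proof -
  have "closure {x. \<phi> x \<noteq> 0} \<subseteq> K" using assms by (intro closure_minimal) (auto intro: compact_imp_closed)
  then have "compact (closure {x. \<phi> x \<noteq> 0})"
    using assms(2) by (meson closed_closure compact_Int_closed compact_eq_bounded_closed bounded_subset)
  then show ?thesis using assms \<open>closure _ \<subseteq> K\<close> by (auto simp: test_function_def smooth_on_def)
qed

text \<open>The fundamental lemma of the calculus of variations. Products of one-dimensional bumps
  are test functions that tend boundedly to the indicator of an open box, which reduces the claim to
  integrals over boxes.\<close>

lemma AE_zero_of_test_integrals:
  fixes u :: "real^'n \<Rightarrow> real"
  assumes S: "open S" and u: "locally_integrable S u"
    and zero: "\<And>\<phi>. test_function S \<phi> \<Longrightarrow> (LINT x|lebesgue_on S. u x * \<phi> x) = 0"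
  shows "AE x in lebesgue_on S. u x = 0"
proof (rule AE_zero_of_box_integrals[OF S])
  fix p q :: "real^'n" assume pq: "cbox p q \<subseteq> S"
  have ui: "integrable (lebesgue_on (cbox p q)) u" using u pq by (auto simp: locally_integrable_def)
  then show "u integrable_on cbox p q" by (rule integrable_on_lebesgue_on) auto
  define \<phi> where "\<phi> k x = (\<Prod>i\<in>UNIV. bump (p $ i) (q $ i) k (x $ i))" for k and x :: "real^'n"
  have \<phi>_bounds: "0 \<le> \<phi> k x" "\<phi> k x \<le> 1" for k x
    unfolding \<phi>_def by (auto intro!: prod_nonneg prod_le_1 bump_bounds)
  have C: "C_on j UNIV (\<phi> k)" for j k
    unfolding \<phi>_def by (intro C_on_prod[OF open_UNIV] C_on_bump[OF open_UNIV] C_on_linear[OF open_UNIV bounded_linear_vec_nth] C_on_id[OF open_UNIV])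
  have \<phi>0: "\<phi> k x = 0" if "x \<notin> box p q" for k x
    using that bump_eq_0 unfolding \<phi>_def by (force simp: mem_box_cart not_less intro!: prod_zero)
  have test: "test_function S (\<phi> k)" for k
    by (rule test_functionI[OF C compact_cbox pq]) (use \<phi>0 box_subset_cbox in blast)
  have lim: "(\<lambda>k. \<phi> k x) \<longlonglongrightarrow> indicator (box p q) x" for x
  proof -
    have "(\<lambda>k. \<phi> k x) \<longlonglongrightarrow> (\<Prod>i\<in>UNIV. indicator {p $ i<..<q $ i} (x $ i))"
      unfolding \<phi>_def by (intro tendsto_prod bump_tendsto)
    also have "(\<Prod>i\<in>UNIV. indicator {p $ i<..<q $ i} (x $ i)) = (indicator (box p q) x :: real)"
    proof (cases "x \<in> box p q")
      case False
      then have "\<exists>i\<in>UNIV. indicator {p $ i<..<q $ i} (x $ i) = (0::real)" by (auto simp: mem_box_cart indicator_def)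
      then have "(\<Prod>i\<in>UNIV. indicator {p $ i<..<q $ i} (x $ i)) = (0 :: real)" by (intro prod_zero) auto
      then show ?thesis using False by simp
    qed (auto simp: mem_box_cart)
    finally show ?thesis .
  qed
  have int0: "(LINT x|lebesgue_on (cbox p q). u x * \<phi> k x) = 0" for k
    using zero[OF test[of k]] lebesgue_on_support(2)[of "cbox p q" S "\<lambda>x. u x * \<phi> k x"] pq S \<phi>0 box_subset_cbox[of p q]
    by (auto simp: lmeasurable_open)
  have meas: "(\<lambda>x. u x * indicator (box p q) x) \<in> borel_measurable (lebesgue_on (cbox p q))"
    by (intro borel_measurable_times borel_measurable_integrable[OF ui] measurable_restrict_space1 borel_measurable_indicator) auto
  have "(\<lambda>k. LINT x|lebesgue_on (cbox p q). u x * \<phi> k x) \<longlonglongrightarrow> (LINT x|lebesgue_on (cbox p q). u x * indicator (box p q) x)"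
  proof (rule integral_dominated_convergence)
    show "integrable (lebesgue_on (cbox p q)) (\<lambda>x. \<bar>u x\<bar>)" using ui by simp
    show "(\<lambda>x. u x * indicator (box p q) x) \<in> borel_measurable (lebesgue_on (cbox p q))" by (rule meas)
    show "(\<lambda>x. u x * \<phi> k x) \<in> borel_measurable (lebesgue_on (cbox p q))" for k
      by (intro borel_measurable_times borel_measurable_integrable[OF ui] borel_measurable_lebesgue_on_continuous C_on_imp_continuous_on[OF C])
    show "AE x in lebesgue_on (cbox p q). (\<lambda>k. u x * \<phi> k x) \<longlonglongrightarrow> u x * indicator (box p q) x"
      by (intro AE_I2 tendsto_intros lim)
    show "AE x in lebesgue_on (cbox p q). norm (u x * \<phi> k x) \<le> \<bar>u x\<bar>" for k
      using \<phi>_bounds by (intro AE_I2) (simp add: abs_mult mult_left_le)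
  qed
  then have 0: "(LINT x|lebesgue_on (cbox p q). u x * indicator (box p q) x) = 0"
    unfolding int0 by (simp add: LIMSEQ_const_iff)
  have "integrable (lebesgue_on (cbox p q)) (\<lambda>x. u x * indicator (box p q) x)"
    by (rule Bochner_Integration.integrable_bound[OF ui meas]) (auto simp: indicator_def)
  then have "integral (cbox p q) (\<lambda>x. u x * indicator (box p q) x) = 0"
    using lebesgue_integral_eq_integral[of "cbox p q" "\<lambda>x. u x * indicator (box p q) x"] 0 by simp
  moreover have "integral (cbox p q) u = integral (cbox p q) (\<lambda>x. u x * indicator (box p q) x)"
    by (rule integral_spike[OF negligible_frontier_interval[of p q]]) auto
  ultimately show "integral (cbox p q) u = 0" by simp
qed

lemma locally_integrable_nth:
  "locally_integrable S (D :: real^'n \<Rightarrow> real^'m^'k) \<Longrightarrow> locally_integrable S (\<lambda>x. D x $ i $ j)"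
  unfolding locally_integrable_def
proof (intro allI impI)
  fix K assume "\<forall>K. compact K \<and> K \<subseteq> S \<longrightarrow> integrable (lebesgue_on K) D" "compact K \<and> K \<subseteq> S"
  then have "integrable (lebesgue_on K) D" by blast
  from integrable_bounded_linear[OF bounded_linear_vec_nth integrable_bounded_linear[OF bounded_linear_vec_nth this]]
  show "integrable (lebesgue_on K) (\<lambda>x. D x $ i $ j)" .
qed

text \<open>Makes the energy independent of the representative picked by
  \<open>weak_derivative\<close>.\<close>

lemma weak_derivative_unique:
  assumes S: "open S" and 1: "is_weak_derivative S f D1" and 2: "is_weak_derivative S f D2"
  shows "AE x in lebesgue_on S. D1 x = D2 x"
proof -
  have ij: "AE x in lebesgue_on S. D1 x $ i $ j - D2 x $ i $ j = 0" for i j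
  proof (rule AE_zero_of_test_integrals[OF S])
    have l: "locally_integrable S (\<lambda>x. D1 x $ i $ j)" "locally_integrable S (\<lambda>x. D2 x $ i $ j)"
      using 1 2 by (auto simp: is_weak_derivative_def intro: locally_integrable_nth)
    then show "locally_integrable S (\<lambda>x. D1 x $ i $ j - D2 x $ i $ j)" by (auto simp: locally_integrable_def)
    fix \<phi> assume \<phi>: "test_function S \<phi>"
    note t = test_functionD[OF \<phi>]
    have "(LINT x|lebesgue_on S. D1 x $ i $ j * \<phi> x) = (LINT x|lebesgue_on S. D2 x $ i $ j * \<phi> x)"
    proof -
      have "(LINT x|lebesgue_on S. f x $ i * frechet_derivative \<phi> (at x) (axis j 1)) = - (LINT x|lebesgue_on S. D x $ i $ j * \<phi> x)"
        if "is_weak_derivative S f D" for D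
        using that \<phi> unfolding is_weak_derivative_def by blast
      from this[OF 1] this[OF 2] show ?thesis by simp
    qed
    then show "(LINT x|lebesgue_on S. (D1 x $ i $ j - D2 x $ i $ j) * \<phi> x) = 0"
      using test_function_integrable[OF S l(1) t(1-4)] test_function_integrable[OF S l(2) t(1-4)]
      by (simp add: left_diff_distrib)
  qed
  have "AE x in lebesgue_on S. \<forall>i\<in>UNIV. \<forall>j\<in>UNIV. D1 x $ i $ j - D2 x $ i $ j = 0"
    by (intro AE_finite_allI ij) auto
  then show ?thesis by eventually_elim (simp add: vec_eq_iff)
qed

text \<open>Difference quotients in the direction \<open>v\<close> have integral zero by translation
  invariance. They converge to the derivative, are bounded by the mean value theorem, and vanish
  outside one ball, because the step sizes are at most \<open>1\<close>.\<close>

lemma integral_derivative_compact_support: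
  fixes \<psi> :: "'a::euclidean_space \<Rightarrow> real"
  assumes d: "\<And>x. (\<psi> has_derivative \<psi>' x) (at x)" and c: "continuous_on UNIV (\<lambda>x. \<psi>' x v)"
    and K: "compact K" "\<And>x. x \<notin> K \<Longrightarrow> \<psi> x = 0"
  shows "(LINT x|lborel. \<psi>' x v) = 0"
proof -
  have d0: "\<psi>' x v = 0" if "x \<notin> K" for x
  proof -
    have "(\<psi> has_derivative (\<lambda>_. 0)) (at x)"
      by (rule has_derivative_transform_within_open[of "\<lambda>_. 0" _ _ _ "- K"]) (use that K in \<open>auto intro: compact_imp_closed\<close>)
    from has_derivative_unique[OF d this] show ?thesis by simp
  qed
  have "bounded ((\<lambda>x. \<psi>' x v) ` K)" by (intro compact_imp_bounded compact_continuous_image continuous_on_subset[OF c] K) auto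
  then obtain B where B: "\<And>x. x \<in> K \<Longrightarrow> \<bar>\<psi>' x v\<bar> \<le> B" by (auto simp: bounded_iff)
  have B': "\<bar>\<psi>' x v\<bar> \<le> \<bar>B\<bar>" for x using B[of x] d0[of x] by (cases "x \<in> K") auto
  obtain \<rho> where \<rho>: "\<And>x. x \<in> K \<Longrightarrow> norm x \<le> \<rho>" using compact_imp_bounded[OF K(1)] by (auto simp: bounded_iff)
  have c\<psi>: "continuous_on UNIV \<psi>" by (rule has_derivative_continuous_on) (rule d)
  define \<epsilon> where "\<epsilon> k = 1 / real (Suc k)" for k
  have \<epsilon>: "0 < \<epsilon> k" "\<epsilon> k \<le> 1" for k by (auto simp: \<epsilon>_def)
  define q where "q k x = (\<psi> (x + \<epsilon> k *\<^sub>R v) - \<psi> x) / \<epsilon> k" for k x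
  have line: "((\<lambda>h. \<psi> (x + h *\<^sub>R v)) has_real_derivative \<psi>' (x + h *\<^sub>R v) v) (at h)" for x h
  proof -
    have "((\<lambda>h. \<psi> (x + h *\<^sub>R v)) has_derivative (\<lambda>y. \<psi>' (x + h *\<^sub>R v) (y *\<^sub>R v))) (at h)"
      by (rule has_derivative_compose[OF _ d]) (auto intro!: derivative_eq_intros)
    moreover have "\<psi>' (x + h *\<^sub>R v) (y *\<^sub>R v) = \<psi>' (x + h *\<^sub>R v) v * y" for y
      using linear_scale[OF has_derivative_linear[OF d]] by simp
    ultimately show ?thesis by (simp add: has_field_derivative_def)
  qed
  have q_bound: "\<bar>q k x\<bar> \<le> \<bar>B\<bar>" for k x
  proof -
    obtain z where "0 < z" "z < \<epsilon> k" "\<psi> (x + \<epsilon> k *\<^sub>R v) - \<psi> (x + 0 *\<^sub>R v) = (\<epsilon> k - 0) * \<psi>' (x + z *\<^sub>R v) v"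
      using MVT2[OF \<epsilon>(1)[of k], of "\<lambda>h. \<psi> (x + h *\<^sub>R v)" "\<lambda>h. \<psi>' (x + h *\<^sub>R v) v"] line by auto
    then have "q k x = \<psi>' (x + z *\<^sub>R v) v" using \<epsilon>[of k] by (simp add: q_def)
    then show ?thesis using B' by simp
  qed
  have q_supp: "q k x = 0" if "x \<notin> cball 0 (\<rho> + norm v)" for k x
  proof -
    have "norm (x + \<epsilon> k *\<^sub>R v) \<ge> norm x - norm (\<epsilon> k *\<^sub>R v)" by (rule norm_diff_ineq)
    moreover have "norm (\<epsilon> k *\<^sub>R v) \<le> norm v" using \<epsilon>[of k] by (simp add: mult_left_le_one_le)
    ultimately have "x \<notin> K" "x + \<epsilon> k *\<^sub>R v \<notin> K" using \<rho>[of x] \<rho>[of "x + \<epsilon> k *\<^sub>R v"] that norm_ge_zero[of v] by force+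
    then show ?thesis using K by (simp add: q_def)
  qed
  have \<psi>_int: "integrable lborel \<psi>"
  proof -
    have "integrable lborel (\<lambda>x. indicator K x *\<^sub>R \<psi> x)"
      by (rule borel_integrable_compact[OF K(1) continuous_on_subset[OF c\<psi>]]) auto
    moreover have "(\<lambda>x. indicator K x *\<^sub>R \<psi> x) = \<psi>" using K by (auto simp: fun_eq_iff indicator_def)
    ultimately show ?thesis by simp
  qed
  have shift: "integrable lborel (\<lambda>x. \<psi> (x + w))" "(LINT x|lborel. \<psi> (x + w)) = (LINT x|lborel. \<psi> x)" for w
  proof -
    have e: "lborel = distr lborel borel ((+) w)" by (simp add: lborel_distr_plus)
    have "(LINT x|lborel. \<psi> x) = (LINT x|distr lborel borel ((+) w). \<psi> x)" using e by simp
    also have "\<dots> = (LINT x|lborel. \<psi> (w + x))"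
      by (rule integral_distr) (use \<psi>_int in auto)
    finally show "(LINT x|lborel. \<psi> (x + w)) = (LINT x|lborel. \<psi> x)" by (simp add: add.commute)
    have "integrable (distr lborel borel ((+) w)) \<psi>" using e \<psi>_int by simp
    then have "integrable lborel (\<lambda>x. \<psi> (w + x))"
      by (subst (asm) integrable_distr_eq) (use \<psi>_int in auto)
    then show "integrable lborel (\<lambda>x. \<psi> (x + w))" by (simp add: add.commute)
  qed
  have "(\<lambda>k. LINT x|lborel. q k x) \<longlonglongrightarrow> (LINT x|lborel. \<psi>' x v)"
  proof (rule integral_dominated_convergence[where w = "\<lambda>x. \<bar>B\<bar> * indicator (cball 0 (\<rho> + norm v)) x"])
    show "integrable lborel (\<lambda>x. \<bar>B\<bar> * indicator (cball 0 (\<rho> + norm v)) x :: real)"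
      by (intro integrable_mult_right integrable_real_indicator emeasure_lborel_cball_finite) auto
    show "(\<lambda>x. \<psi>' x v) \<in> borel_measurable lborel" using c by (simp add: borel_measurable_continuous_onI)
    show "q k \<in> borel_measurable lborel" for k
      unfolding q_def using shift \<psi>_int by (intro borel_measurable_divide borel_measurable_diff) auto
    show "AE x in lborel. (\<lambda>k. q k x) \<longlonglongrightarrow> \<psi>' x v"
    proof (rule AE_I2)
      fix x
      have "((\<lambda>h. (\<psi> (x + (0 + h) *\<^sub>R v) - \<psi> (x + 0 *\<^sub>R v)) / h) \<longlongrightarrow> \<psi>' (x + 0 *\<^sub>R v) v) (at 0)"
        using line[of x 0] unfolding DERIV_def .
      moreover have "filterlim \<epsilon> (at 0) sequentially"
      proof -
        have "\<epsilon> \<longlonglongrightarrow> 0" unfolding \<epsilon>_def[abs_def] by (rule LIMSEQ_Suc[OF lim_1_over_n])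
        then show ?thesis using \<epsilon>(1) by (auto simp: filterlim_at less_imp_neq[symmetric] intro!: always_eventually)
      qed
      ultimately show "(\<lambda>k. q k x) \<longlonglongrightarrow> \<psi>' x v"
        unfolding q_def using filterlim_compose by fastforce
    qed
    show "AE x in lborel. norm (q k x) \<le> \<bar>B\<bar> * indicator (cball 0 (\<rho> + norm v)) x" for k
      using q_bound q_supp by (intro AE_I2) (auto simp: indicator_def)
  qed
  moreover have "(LINT x|lborel. q k x) = 0" for k
    unfolding q_def using shift \<psi>_int by simp
  ultimately show ?thesis by (simp add: LIMSEQ_const_iff)
qed

text \<open>Integration by parts: the product of a component with a test function, continued by zero
  off \<open>S\<close>, is continuously differentiable along the axis and has compact support, so
  the integral of its derivative vanishes.\<close>

lemma classical_weak_derivative: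
  fixes f :: "real^'n \<Rightarrow> real^'n"
  assumes S: "open S" and f: "\<And>x. x \<in> S \<Longrightarrow> (f has_derivative f' x) (at x)"
    and c: "\<And>v. continuous_on S (\<lambda>x. f' x v)"
  shows "is_weak_derivative S f (\<lambda>x. \<chi> i j. f' x (axis j 1) $ i)"
proof -
  have cf: "continuous_on S f"
    by (rule continuous_at_imp_continuous_on) (use f has_derivative_continuous in blast)
  have cD: "continuous_on S (\<lambda>x. \<chi> i j. f' x (axis j 1) $ i)"
    by (intro continuous_on_vec_lambda continuous_on_component c)
  have li: "locally_integrable S g" if "continuous_on S g" for g :: "real^'n \<Rightarrow> 'b::{banach,second_countable_topology}"
    unfolding locally_integrable_def
    using continuous_on_integrable_compact[OF _ continuous_on_subset[OF that]] by simp
  have "(LINT x|lebesgue_on S. f x $ i * frechet_derivative \<phi> (at x) (axis j 1)) =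
        - (LINT x|lebesgue_on S. f' x (axis j 1) $ i * \<phi> x)" if \<phi>: "test_function S \<phi>" for \<phi> i j
  proof -
    note t = test_functionD[OF \<phi>]
    define K where "K = closure {x. \<phi> x \<noteq> 0}"
    note K = t(2-4)[folded K_def]
    define v where "v = (axis j 1 :: real^'n)"
    have \<phi>': "(\<phi> has_derivative frechet_derivative \<phi> (at x)) (at x)" for x
      using C_on_SucD[OF t(5)[of "Suc 0"]] by auto
    have c\<phi>': "continuous_on UNIV (\<lambda>x. frechet_derivative \<phi> (at x) v)" using t(5)[of "Suc 0"] by simp
    have \<phi>'0: "frechet_derivative \<phi> (at x) v = 0" if "x \<notin> K" for x
    proof -
      have "(\<phi> has_derivative (\<lambda>_. 0)) (at x)"
        by (rule has_derivative_transform_within_open[of "\<lambda>_. 0" _ _ _ "- K"]) (use that K in \<open>auto intro: compact_imp_closed\<close>)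
      from has_derivative_unique[OF \<phi>' this] show ?thesis by simp
    qed
    define \<psi> where "\<psi> x = (if x \<in> S then f x $ i * \<phi> x else 0)" for x
    define \<psi>' where "\<psi>' x w = (if x \<in> S then f x $ i * frechet_derivative \<phi> (at x) w + f' x w $ i * \<phi> x else 0)" for x w
    have 0: "(\<psi> has_derivative \<psi>' x) (at x)" for x
    proof (cases "x \<in> S")
      case True
      have "((\<lambda>x. f x $ i * \<phi> x) has_derivative (\<lambda>w. f x $ i * frechet_derivative \<phi> (at x) w + f' x w $ i * \<phi> x)) (at x)"
        by (intro has_derivative_mult \<phi>' bounded_linear.has_derivative[OF bounded_linear_vec_nth] f True)
      moreover have "(\<lambda>w. f x $ i * frechet_derivative \<phi> (at x) w + f' x w $ i * \<phi> x) = \<psi>' x" using True by (auto simp: \<psi>'_def)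
      ultimately have "((\<lambda>x. f x $ i * \<phi> x) has_derivative \<psi>' x) (at x)" by simp
      then show ?thesis by (rule has_derivative_transform_within_open[OF _ S True]) (simp add: \<psi>_def)
    next
      case False
      have "((\<lambda>_. 0) has_derivative (\<lambda>_. 0)) (at x)" by simp
      moreover have "\<psi>' x = (\<lambda>_. 0)" using False by (auto simp: \<psi>'_def)
      ultimately have "((\<lambda>_. 0) has_derivative \<psi>' x) (at x)" by simp
      then show ?thesis
        by (rule has_derivative_transform_within_open[of _ _ _ _ "- K"])
           (use False K in \<open>auto simp: \<psi>_def intro: compact_imp_closed\<close>)
    qed
    have 1: "continuous_on UNIV (\<lambda>x. \<psi>' x v)"
    proof -
      have "continuous_on S (\<lambda>x. f x $ i * frechet_derivative \<phi> (at x) v + f' x v $ i * \<phi> x)"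
        by (intro continuous_intros cf c continuous_on_component continuous_on_subset[OF t(1)] continuous_on_subset[OF c\<phi>']) auto
      then have "continuous_on S (\<lambda>x. \<psi>' x v)" by (rule continuous_on_eq) (simp add: \<psi>'_def)
      moreover have "continuous_on (- K) (\<lambda>x. \<psi>' x v)"
        by (rule continuous_on_eq[of _ "\<lambda>_. 0"]) (auto simp: \<psi>'_def \<phi>'0 K)
      ultimately have "continuous_on (S \<union> - K) (\<lambda>x. \<psi>' x v)"
        using S K by (intro continuous_on_open_Un) (auto intro: compact_imp_closed)
      moreover have "S \<union> - K = UNIV" using K by auto
      ultimately show ?thesis by simp
    qed
    have z: "(LINT x|lborel. \<psi>' x v) = 0"
      by (rule integral_derivative_compact_support[OF 0 1 K(1)]) (simp add: \<psi>_def K)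
    have "(LINT x|lebesgue_on S. \<psi>' x v) = (LINT x|lebesgue. indicator S x *\<^sub>R \<psi>' x v)"
      using S by (simp add: integral_restrict_space)
    also have "(\<lambda>x. indicator S x *\<^sub>R \<psi>' x v) = (\<lambda>x. \<psi>' x v)" by (auto simp: indicator_def \<psi>'_def)
    also have "(LINT x|lebesgue. \<psi>' x v) = 0"
      using z 1 by (subst integral_completion) (auto simp: borel_measurable_continuous_onI)
    finally have "(LINT x|lebesgue_on S. \<psi>' x v) = 0" .
    moreover have "(LINT x|lebesgue_on S. \<psi>' x v) = (LINT x|lebesgue_on S. f x $ i * frechet_derivative \<phi> (at x) v + f' x v $ i * \<phi> x)"
      by (rule Bochner_Integration.integral_cong) (auto simp: \<psi>'_def space_restrict_space)
    moreover have "integrable (lebesgue_on S) (\<lambda>x. f x $ i * frechet_derivative \<phi> (at x) v)"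
      by (rule test_function_integrable[OF S li c\<phi>' K(1,2) \<phi>'0]) (intro continuous_on_component cf)
    moreover have "integrable (lebesgue_on S) (\<lambda>x. f' x v $ i * \<phi> x)"
      by (rule test_function_integrable[OF S li t(1) K]) (intro continuous_on_component c)
    ultimately show ?thesis by (simp add: v_def)
  qed
  then show ?thesis using li[OF cf] li[OF cD] by (simp add: is_weak_derivative_def)
qed

section \<open>Integrals of radial functions\<close>

definition sphere_area :: "nat \<Rightarrow> real" where
  "sphere_area n = n * unit_ball_vol n"

lemma emeasure_annulus:
  assumes "0 < r" "r \<le> R"
  shows "emeasure lborel (annulus r R :: (real^'n) set) = ennreal (unit_ball_vol CARD('n) * (R ^ CARD('n) - r ^ CARD('n)))"
proof -
  have ann: "annulus r R = ball 0 R - cball (0 :: real^'n) r" by (auto simp: annulus_def)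
  have "emeasure lborel (ball 0 R - ball (0 :: real^'n) r) = emeasure lborel (ball (0 :: real^'n) R) - emeasure lborel (ball (0 :: real^'n) r)"
    using assms by (intro emeasure_Diff) (use emeasure_lborel_ball_finite[of "0 :: real^'n" r] in auto)
  also have "\<dots> = ennreal (unit_ball_vol CARD('n) * (R ^ CARD('n) - r ^ CARD('n)))"
    using assms by (simp add: emeasure_ball ennreal_minus right_diff_distrib power_mono)
  finally have 1: "emeasure lborel (ball 0 R - ball (0 :: real^'n) r) = ennreal (unit_ball_vol CARD('n) * (R ^ CARD('n) - r ^ CARD('n)))" .
  have "emeasure lborel (ball 0 R - cball (0 :: real^'n) r) = emeasure lborel (ball 0 R - ball (0 :: real^'n) r)"
  proof (rule emeasure_eq_AE)
    have "sphere (0 :: real^'n) r \<in> null_sets lborel"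
      using negligible_sphere[of "0 :: real^'n" r]
      by (auto simp: null_sets_completion_iff negligible_iff_null_sets)
    then show "AE x in lborel. x \<in> ball 0 R - cball (0 :: real^'n) r \<longleftrightarrow> x \<in> ball 0 R - ball (0 :: real^'n) r"
      by (rule AE_I') auto
  qed auto
  with 1 show ?thesis by (simp add: ann)
qed

text \<open>Polar coordinates for radial integrands only: the image of Lebesgue measure under the
  norm has density \<open>sphere_area n * s ^ (n - 1)\<close>. It suffices to compare the measures
  of half-lines, and these are volumes of annuli.\<close>

lemma radial_integral:
  fixes f :: "real \<Rightarrow> real"
  assumes r: "0 < r" and rR: "r < R" and f: "continuous_on {r..R} f"
  shows "integrable (lebesgue_on (annulus r R :: (real^'n) set)) (\<lambda>x. f (norm x))" (is ?int)
    "(LINT x|lebesgue_on (annulus r R :: (real^'n) set). f (norm x))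
       = sphere_area CARD('n) * integral {r..R} (\<lambda>s. f s * s ^ (CARD('n) - 1))"
proof -
  let ?A = "annulus r R :: (real^'n) set" and ?n = "CARD('n)"
  \<comment> \<open>Continues \<open>f\<close> by its end values, so that the change of variables
    can be applied to a function continuous on the whole line.\<close>
  define g where "g s = f (max r (min R s))" for s
  have g: "continuous_on UNIV g" unfolding g_def
    by (rule continuous_on_compose2[OF f]) (use rR in \<open>auto intro!: continuous_intros\<close>)
  have gm: "g \<in> borel_measurable borel" using g by (rule borel_measurable_continuous_onI)
  have gf: "g s = f s" if "s \<in> {r..R}" for s using that by (auto simp: g_def)
  have A: "?A \<in> sets borel" by (simp add: open_annulus)
  define w where "w s = sphere_area ?n * s ^ (?n - 1)" for s
  define M where "M = distr (density lborel (indicator ?A)) borel norm"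
  define N where "N = density lborel (\<lambda>s. ennreal (indicator {r<..<R} s * w s))"
  have w0: "0 \<le> w s" if "r < s" for s using that r by (simp add: w_def sphere_area_def)
  have "M = N"
  proof (rule measure_eqI_lessThan)
    show "sets M = sets borel" "sets N = sets borel" by (simp_all add: M_def N_def)
    have key: "emeasure M {x<..} = emeasure N {x<..} \<and> emeasure M {x<..} < \<infinity>" for x
    proof -
      \<comment> \<open>The half-line above \<open>x\<close> meets the interval of radii in
        \<open>(p, R)\<close>, which is empty when \<open>x \<ge> R\<close>.\<close>
      define p where "p = min R (max x r)"
      have p: "0 < p" "p \<le> R" "r \<le> p" using r rR by (auto simp: p_def)
      have "emeasure M {x<..} = emeasure (density lborel (indicator ?A)) (norm -` {x<..})"
        unfolding M_def by (subst emeasure_distr) auto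
      also have "\<dots> = emeasure lborel (?A \<inter> norm -` {x<..})"
        using A by (subst emeasure_density) (auto simp: indicator_inter_arith[symmetric] intro!: measurable_sets_borel[OF borel_measurable_norm])
      also have "?A \<inter> norm -` {x<..} = annulus p R" using r rR by (auto simp: annulus_def p_def)
      finally have M: "emeasure M {x<..} = ennreal (unit_ball_vol ?n * (R ^ ?n - p ^ ?n))"
        using emeasure_annulus[OF p(1,2)] by simp
      have "(w has_integral (unit_ball_vol ?n * R ^ ?n - unit_ball_vol ?n * p ^ ?n)) {p..R}"
        by (rule fundamental_theorem_of_calculus[OF p(2)])
           (auto intro!: derivative_eq_intros simp: has_real_derivative_iff_has_vector_derivative[symmetric] w_def sphere_area_def)
      then have "(w has_integral (unit_ball_vol ?n * (R ^ ?n - p ^ ?n))) {p<..<R}"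
        by (simp add: has_integral_Icc_iff_Ioo right_diff_distrib)
      then have "integral\<^sup>N lborel (\<lambda>s. ennreal (indicator {p<..<R} s * w s)) = ennreal (unit_ball_vol ?n * (R ^ ?n - p ^ ?n))"
        by (intro nn_integral_has_integral_lebesgue) (use p w0 in auto)
      moreover have "emeasure N {x<..} = integral\<^sup>N lborel (\<lambda>s. ennreal (indicator {r<..<R} s * w s) * indicator {x<..} s)"
        unfolding N_def by (subst emeasure_density) (auto simp: w_def)
      moreover have "(\<lambda>s. ennreal (indicator {r<..<R} s * w s) * indicator {x<..} s) = (\<lambda>s. ennreal (indicator {p<..<R} s * w s))"
        by (auto simp: fun_eq_iff indicator_def p_def)
      ultimately show ?thesis using M by simp
    qed
    show "emeasure M {x<..} < \<infinity>" "emeasure M {x<..} = emeasure N {x<..}" for x by (rule conjunct2[OF key] conjunct1[OF key])+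
  qed
  have wg: "continuous_on {r..R} (\<lambda>s. w s * g s)"
    unfolding w_def by (intro continuous_intros continuous_on_subset[OF g]) auto
  have si: "set_integrable lborel {r<..<R} (\<lambda>s. w s * g s)"
    by (rule set_integrable_subset[OF borel_integrable_atLeastAtMost'[OF wg]]) auto
  have iN: "integrable N g"
    unfolding N_def
    by (subst integrable_density) (use si gm w0 in \<open>auto simp: set_integrable_def mult.assoc w_def intro!: AE_I2 split: split_indicator\<close>)
  then have "integrable (density lborel (indicator ?A)) (\<lambda>x. g (norm x))"
    unfolding \<open>M = N\<close>[symmetric] M_def by (subst (asm) integrable_distr_eq) (use gm in auto)
  then have i1: "integrable lborel (\<lambda>x. indicator ?A x *\<^sub>R g (norm x))"
    using integrable_density[of "\<lambda>x. g (norm x)" lborel "indicator ?A :: _ \<Rightarrow> real"] gm A by (simp add: ennreal_indicator)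
  then have i2: "integrable (lebesgue_on ?A) (\<lambda>x. g (norm x))"
    using A by (simp add: integrable_restrict_space integrable_completion)
  moreover have "integrable (lebesgue_on ?A) (\<lambda>x. g (norm x)) \<longleftrightarrow> integrable (lebesgue_on ?A) (\<lambda>x. f (norm x))"
    by (rule Bochner_Integration.integrable_cong) (auto simp: space_restrict_space annulus_def intro!: gf)
  ultimately show ?int by simp
  have "(LINT x|lebesgue_on ?A. f (norm x)) = (LINT x|lebesgue_on ?A. g (norm x))"
    by (rule Bochner_Integration.integral_cong) (auto simp: space_restrict_space annulus_def intro!: gf[symmetric])
  also have "\<dots> = (LINT x|lborel. indicator ?A x *\<^sub>R g (norm x))"
    using A i1 by (simp add: integral_restrict_space integral_completion)
  also have "\<dots> = (LINT x|density lborel (indicator ?A). g (norm x))"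
    using integral_density[of "\<lambda>x. g (norm x)" lborel "indicator ?A :: _ \<Rightarrow> real"] gm A by (simp add: ennreal_indicator)
  also have "\<dots> = (LINT s|N. g s)"
    unfolding \<open>M = N\<close>[symmetric] M_def by (subst integral_distr) (use gm in auto)
  also have "\<dots> = (LINT s : {r<..<R} | lborel. w s * g s)"
    unfolding N_def set_lebesgue_integral_def
    by (subst integral_density) (use gm w0 in \<open>auto simp: mult.assoc w_def intro!: AE_I2 split: split_indicator\<close>)
  also have "\<dots> = integral {r<..<R} (\<lambda>s. w s * g s)" by (rule set_borel_integral_eq_integral(2)[OF si])
  also have "\<dots> = integral {r..R} (\<lambda>s. w s * g s)" by (rule integral_open_interval_real[symmetric])
  also have "\<dots> = integral {r..R} (\<lambda>s. sphere_area ?n * (f s * s ^ (?n - 1)))"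
    by (rule Henstock_Kurzweil_Integration.integral_cong) (simp add: w_def gf)
  finally show "(LINT x|lebesgue_on ?A. f (norm x)) = sphere_area ?n * integral {r..R} (\<lambda>s. f s * s ^ (?n - 1))" by simp
qed

section \<open>The radial part of a weak derivative\<close>

lemma C_on_real_polynomial_function:
  "real_polynomial_function p \<Longrightarrow> C_on k UNIV p"
  by (induction rule: real_polynomial_function.induct)
     (auto intro: C_on_const C_on_add C_on_mult C_on_linear[OF open_UNIV _ C_on_id[OF open_UNIV]])

text \<open>Weierstrass polynomials multiplied by bumps. Uniform convergence is out of reach,
  because \<open>M\<close> need not vanish at the end points; a common bound and pointwise
  convergence inside are what dominated convergence requires.\<close>

lemma smooth_compact_approximation:
  fixes M :: "real \<Rightarrow> real"
  assumes M: "continuous_on {u..v} M"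
  obtains \<psi> :: "nat \<Rightarrow> real \<Rightarrow> real" and B where
    "\<And>k j. C_on j UNIV (\<psi> k)"
    "\<And>k. \<exists>p q. u < p \<and> q < v \<and> (\<forall>x. x \<notin> {p..q} \<longrightarrow> \<psi> k x = 0)"
    "\<And>k x. \<bar>\<psi> k x\<bar> \<le> B" "\<And>x. u < x \<Longrightarrow> x < v \<Longrightarrow> (\<lambda>k. \<psi> k x) \<longlonglongrightarrow> M x"
proof -
  define \<delta> where "\<delta> k = 1 / real (Suc k)" for k
  have \<delta>: "0 < \<delta> k" "\<delta> k \<le> 1" for k by (auto simp: \<delta>_def)
  have "\<exists>g. real_polynomial_function g \<and> (\<forall>x\<in>{u..v}. \<bar>M x - g x\<bar> < \<delta> k)" for k
  proof -
    obtain g where "real_polynomial_function g" "\<And>x. x \<in> {u..v} \<Longrightarrow> \<bar>M x - g x\<bar> < \<delta> k"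
      by (rule Stone_Weierstrass_real_polynomial_function[OF compact_Icc M \<delta>(1)[of k]]) (rule that)
    then show ?thesis by blast
  qed
  then obtain g where g: "\<And>k. real_polynomial_function (g k)" "\<And>k x. x \<in> {u..v} \<Longrightarrow> \<bar>M x - g k x\<bar> < \<delta> k"
    by metis
  have "bounded (M ` {u..v})" by (intro compact_imp_bounded compact_continuous_image M) auto
  then obtain B where "\<forall>y\<in>M ` {u..v}. norm y \<le> B" unfolding bounded_iff by blast
  then have B: "\<bar>M x\<bar> \<le> B" if "x \<in> {u..v}" for x using that by simp
  \<comment> \<open>As \<open>Suc k * \<delta> k = 1\<close>, shrinking the interval merely shifts
    the arguments of \<open>flat_exp\<close> by one, and they still tend to infinity.\<close>
  define \<beta> where "\<beta> k = bump (u + \<delta> k) (v - \<delta> k) (Suc k)" for k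
  define \<psi> where "\<psi> k x = \<beta> k x * g k x" for k x
  have 0: "\<psi> k x = 0" if "x \<notin> {u + \<delta> k..v - \<delta> k}" for k x
    using that bump_eq_0[of x "u + \<delta> k" "v - \<delta> k" "Suc k"] by (auto simp: \<psi>_def \<beta>_def)
  show thesis
  proof
    show "C_on j UNIV (\<psi> k)" for k j
      unfolding \<psi>_def \<beta>_def
      by (intro C_on_mult[OF open_UNIV] C_on_bump[OF open_UNIV] C_on_id[OF open_UNIV] C_on_real_polynomial_function g)
    show "\<exists>p q. u < p \<and> q < v \<and> (\<forall>x. x \<notin> {p..q} \<longrightarrow> \<psi> k x = 0)" for k
      using 0 \<delta>[of k] by (intro exI[of _ "u + \<delta> k"] exI[of _ "v - \<delta> k"]) auto
    show "\<bar>\<psi> k x\<bar> \<le> \<bar>B\<bar> + 1" for k x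
    proof (cases "x \<in> {u + \<delta> k..v - \<delta> k}")
      case True
      then have x: "x \<in> {u..v}" using \<delta>[of k] by auto
      have "\<bar>\<psi> k x\<bar> \<le> 1 * \<bar>g k x\<bar>"
        unfolding \<psi>_def abs_mult \<beta>_def using bump_bounds by (intro mult_right_mono) auto
      then show ?thesis using g(2)[OF x, of k] B[OF x] \<delta>[of k] by auto
    qed (simp add: 0)
    fix x assume x: "u < x" "x < v"
    have \<beta>: "(\<lambda>k. \<beta> k x) \<longlonglongrightarrow> 1 * 1"
    proof -
      have lim: "filterlim (\<lambda>k. real (Suc k) * c - 1) at_top sequentially" if "0 < c" for c
      proof -
        have "filterlim (\<lambda>k. c * real (Suc k)) at_top sequentially"
          by (rule filterlim_tendsto_pos_mult_at_top[OF tendsto_const that filterlim_compose[OF filterlim_real_sequentially filterlim_Suc]])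
        from filterlim_tendsto_add_at_top[OF tendsto_const[of "- 1"] this] show ?thesis by (simp add: mult.commute)
      qed
      have "\<beta> k x = flat_exp (real (Suc k) * (x - u) - 1) * flat_exp (real (Suc k) * (v - x) - 1)" for k
      proof -
        have "real (Suc k) * (x - (u + \<delta> k)) = real (Suc k) * (x - u) - 1"
          "real (Suc k) * (v - \<delta> k - x) = real (Suc k) * (v - x) - 1"
          unfolding \<delta>_def by (simp_all add: field_simps del: of_nat_Suc)
        then show ?thesis unfolding \<beta>_def bump_def by simp
      qed
      then show ?thesis using x by (simp only:) (intro tendsto_mult flat_exp_tendsto_1 lim; simp)
    qed
    have "(\<lambda>k. M x - g k x) \<longlonglongrightarrow> 0"
    proof (rule Lim_null_comparison)
      show "eventually (\<lambda>k. norm (M x - g k x) \<le> \<delta> k) sequentially"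
        using g(2)[of x] x by (auto intro!: always_eventually less_imp_le)
      show "\<delta> \<longlonglongrightarrow> 0" unfolding \<delta>_def[abs_def] by (rule LIMSEQ_Suc[OF lim_1_over_n])
    qed
    from tendsto_diff[OF tendsto_const[of "M x"] this] have "(\<lambda>k. g k x) \<longlonglongrightarrow> M x" by simp
    from tendsto_mult[OF \<beta> this] show "(\<lambda>k. \<psi> k x) \<longlonglongrightarrow> M x" by (simp add: \<psi>_def)
  qed
qed

text \<open>The matrix \<open>c I + d x x^T\<close>. With \<open>c = t\<close> and
  \<open>d = (y - t) / |x|^2\<close> it has the eigenvalue \<open>y\<close> in the direction of
  \<open>x\<close> and \<open>t\<close> orthogonally to it, as the differential of a radial map
  does.\<close>

definition radial_matrix :: "real \<Rightarrow> real \<Rightarrow> real^'n \<Rightarrow> real^'n^'n" where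
  "radial_matrix c d x = (\<chi> i j. c * (if i = j then 1 else 0) + d * (x $ i * x $ j))"

lemma inner_matrix: "(X :: real^'n^'n) \<bullet> Y = (\<Sum>i\<in>UNIV. \<Sum>j\<in>UNIV. X $ i $ j * Y $ i $ j)"
  by (simp add: inner_vec_def)

lemma inner_self_vec: "(\<Sum>j\<in>UNIV. x $ j * x $ j) = x \<bullet> (x :: real^'n)"
  by (simp add: inner_vec_def)

text \<open>The entries of the matrix field are used as test functions, so the pairing becomes minus
  the integral of \<open>g\<close> against the row-wise divergence of the field. That integrand is
  radial, and one integration by parts against the monotone profile removes the derivatives of the
  two coefficients. They are functions of \<open>x \<bullet> x\<close> because this, unlike the
  norm, is smooth at the origin.\<close>

lemma weak_derivative_radial_smooth:
  fixes g :: "real^'n \<Rightarrow> real^'n"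
  assumes n: "2 \<le> CARD('n)" and hom: "increasing_homeo r R rs Rs H K" and r: "0 < r"
    and g: "\<And>x. x \<in> annulus r R \<Longrightarrow> g x = radial_map H x"
    and D: "is_weak_derivative (annulus r R) g D"
    and \<psi>: "\<And>k. C_on k UNIV \<psi>1" "\<And>k. C_on k UNIV \<psi>2" "r\<^sup>2 < p" "q < R\<^sup>2"
      "\<And>x. x \<notin> {p..q} \<Longrightarrow> \<psi>1 x = 0" "\<And>x. x \<notin> {p..q} \<Longrightarrow> \<psi>2 x = 0"
  shows "(LINT x|lebesgue_on (annulus r R). D x \<bullet> radial_matrix (\<psi>2 (x \<bullet> x)) (\<psi>1 (x \<bullet> x)) x) =
    sphere_area CARD('n) * (integral {rs..Rs} (\<lambda>t. (\<psi>2 ((K t)\<^sup>2) + \<psi>1 ((K t)\<^sup>2) * (K t)\<^sup>2) * K t ^ (CARD('n) - 1))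
      + (real CARD('n) - 1) * integral {r..R} (\<lambda>s. \<psi>2 (s\<^sup>2) * H s * s ^ (CARD('n) - 2)))"
proof -
  let ?A = "annulus r R :: (real^'n) set" and ?n = "CARD('n)"
  note h = increasing_homeo_facts[OF hom]
  have A: "open ?A" by (rule open_annulus)
  define d1 where "d1 y = frechet_derivative \<psi>1 (at y) 1" for y
  define d2 where "d2 y = frechet_derivative \<psi>2 (at y) 1" for y
  have DERIV: "(\<psi> has_real_derivative frechet_derivative \<psi> (at y) 1) (at y)" if "\<And>k. C_on k UNIV \<psi>" for \<psi> :: "real \<Rightarrow> real" and y
  proof -
    have d: "(\<psi> has_derivative frechet_derivative \<psi> (at y)) (at y)" using C_on_SucD[OF that[of "Suc 0"]] by auto
    have "frechet_derivative \<psi> (at y) = (*) (frechet_derivative \<psi> (at y) 1)"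
    proof
      fix v
      have "frechet_derivative \<psi> (at y) (v *\<^sub>R 1) = v *\<^sub>R frechet_derivative \<psi> (at y) 1"
        by (rule linear_scale[OF has_derivative_linear[OF d]])
      then show "frechet_derivative \<psi> (at y) v = frechet_derivative \<psi> (at y) 1 * v" by (simp only: real_scaleR_def mult_1_right mult_1_left mult.commute)
    qed
    then show ?thesis using d unfolding has_field_derivative_def by (simp only:)
  qed
  have d: "(\<psi>1 has_real_derivative d1 y) (at y)" "(\<psi>2 has_real_derivative d2 y) (at y)" for y
    unfolding d1_def d2_def by (rule DERIV \<psi>)+
  have cd: "continuous_on UNIV d1" "continuous_on UNIV d2"
    using \<psi>(1)[of "Suc 0"] \<psi>(2)[of "Suc 0"] by (auto simp: d1_def[abs_def] d2_def[abs_def])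
  have c\<psi>: "continuous_on UNIV \<psi>1" "continuous_on UNIV \<psi>2"
    using \<psi>(1)[of 0] \<psi>(2)[of 0] by auto
  define C where "C = {x :: real^'n. x \<bullet> x \<in> {p..q}}"
  have C: "compact C" "C \<subseteq> ?A"
  proof -
    have "C = (\<lambda>x. x \<bullet> x) -` {p..q}" by (auto simp: C_def)
    then have "closed C" by (auto intro!: closed_vimage continuous_intros)
    have C': "r < norm x \<and> norm x < R" if "x \<in> C" for x
    proof -
      have "r\<^sup>2 < (norm x)\<^sup>2" "(norm x)\<^sup>2 < R\<^sup>2" using that \<psi>(3,4) unfolding C_def power2_norm_eq_inner by simp_all
      then show ?thesis
        using r h(5) power_less_imp_less_base[of r 2 "norm x"] power_less_imp_less_base[of "norm x" 2 R] by simp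
    qed
    then show "C \<subseteq> ?A" by (auto simp: annulus_def)
    have "bounded C" using C' by (intro boundedI[of C R]) (auto intro: less_imp_le)
    with \<open>closed C\<close> show "compact C" by (simp add: compact_eq_bounded_closed)
  qed
  define \<phi> where "\<phi> i j x = radial_matrix (\<psi>2 (x \<bullet> x)) (\<psi>1 (x \<bullet> x)) x $ i $ j" for i j and x :: "real^'n"
  have \<phi>_eq: "\<phi> i j x = \<psi>2 (x \<bullet> x) * (if i = j then 1 else 0) + \<psi>1 (x \<bullet> x) * (x $ i * x $ j)" for i j x
    by (simp add: \<phi>_def radial_matrix_def)
  have \<phi>0: "\<phi> i j x = 0" if "x \<notin> C" for i j x using that \<psi>(5,6) by (simp add: \<phi>_eq C_def)
  have nth: "C_on k UNIV (\<lambda>x :: real^'n. x $ i)" for k i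
    by (intro C_on_linear[OF open_UNIV bounded_linear_vec_nth] C_on_id[OF open_UNIV])
  have xx: "C_on k UNIV (\<lambda>x :: real^'n. x \<bullet> x)" for k
    by (intro C_on_inner[OF open_UNIV] C_on_id[OF open_UNIV])
  have test: "test_function ?A (\<phi> i j)" for i j
  proof (rule test_functionI[OF _ C \<phi>0])
    show "C_on k UNIV (\<phi> i j)" for k
      unfolding \<phi>_eq[abs_def]
      by (intro C_on_add[OF open_UNIV] C_on_mult[OF open_UNIV] C_on_const nth C_on_compose_real[OF open_UNIV open_UNIV xx] \<psi>) auto
  qed auto
  define \<phi>' where "\<phi>' i j x = d2 (x \<bullet> x) * (2 * x $ j) * (if i = j then 1 else 0) + (d1 (x \<bullet> x) * (2 * x $ j) * (x $ i * x $ j)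
      + \<psi>1 (x \<bullet> x) * ((if i = j then 1 else 0) * x $ j + x $ i))" for i j and x :: "real^'n"
  have \<phi>': "frechet_derivative (\<phi> i j) (at x) (axis j 1) = \<phi>' i j x" for i j x
  proof -
    have q: "((\<lambda>x. x \<bullet> x) has_derivative (\<lambda>v. 2 * (x \<bullet> v))) (at x)" for x :: "real^'n"
      by (rule has_derivative_eq_rhs[OF has_derivative_inner[OF has_derivative_ident has_derivative_ident]]) (simp add: inner_commute)
    have c: "((\<lambda>x. x $ i) has_derivative (\<lambda>v. v $ i)) (at x)" for x :: "real^'n" and i
      by (rule bounded_linear_imp_has_derivative[OF bounded_linear_vec_nth])
    have p: "((\<lambda>x. \<psi>1 (x \<bullet> x)) has_derivative (\<lambda>v. d1 (x \<bullet> x) * (2 * (x \<bullet> v)))) (at x)"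
      "((\<lambda>x. \<psi>2 (x \<bullet> x)) has_derivative (\<lambda>v. d2 (x \<bullet> x) * (2 * (x \<bullet> v)))) (at x)"
      using has_derivative_compose[OF q d(1)[unfolded has_field_derivative_def]] has_derivative_compose[OF q d(2)[unfolded has_field_derivative_def]] by auto
    have "(\<phi> i j has_derivative (\<lambda>v. d2 (x \<bullet> x) * (2 * (x \<bullet> v)) * (if i = j then 1 else 0) +
        (\<psi>1 (x \<bullet> x) * (x $ i * v $ j + v $ i * x $ j) + d1 (x \<bullet> x) * (2 * (x \<bullet> v)) * (x $ i * x $ j)))) (at x)"
      unfolding \<phi>_eq[abs_def] by (intro has_derivative_add has_derivative_mult has_derivative_mult_left p c)
    from fun_cong[OF frechet_derivative_at[OF this], of "axis j 1", symmetric]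
    have e: "frechet_derivative (\<phi> i j) (at x) (axis j 1) = d2 (x \<bullet> x) * (2 * (x \<bullet> axis j 1)) * (if i = j then 1 else 0) +
        (\<psi>1 (x \<bullet> x) * (x $ i * axis j 1 $ j + axis j 1 $ i * x $ j) + d1 (x \<bullet> x) * (2 * (x \<bullet> axis j 1)) * (x $ i * x $ j))" .
    show ?thesis unfolding e \<phi>'_def inner_axis by (simp add: axis_def algebra_simps)
  qed
  have c\<phi>': "continuous_on UNIV (\<phi>' i j)" for i j
    unfolding \<phi>'_def by (intro continuous_intros continuous_on_compose2[OF cd(1)] continuous_on_compose2[OF cd(2)] continuous_on_compose2[OF c\<psi>(1)]) auto
  have \<phi>'0: "\<phi>' i j x = 0" if "x \<notin> C" for i j x
  proof -
    have "(\<phi> i j has_derivative (\<lambda>_. 0)) (at x)"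
      by (rule has_derivative_transform_within_open[of "\<lambda>_. 0" _ _ _ "- C"]) (use that C(1) \<phi>0 in \<open>auto intro: compact_imp_closed\<close>)
    from frechet_derivative_at[OF this] show ?thesis using \<phi>'[of i j x] by (metis)
  qed
  have lD: "locally_integrable ?A (\<lambda>x. D x $ i $ j)" for i j
    using D by (auto simp: is_weak_derivative_def intro: locally_integrable_nth)
  have lg: "locally_integrable ?A (\<lambda>x. g x $ i)" for i
    unfolding locally_integrable_def
  proof (intro allI impI)
    fix L assume "compact L \<and> L \<subseteq> ?A"
    then have "integrable (lebesgue_on L) g" using D by (auto simp: is_weak_derivative_def locally_integrable_def)
    then show "integrable (lebesgue_on L) (\<lambda>x. g x $ i)" by (rule integrable_bounded_linear[OF bounded_linear_vec_nth])
  qed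
  have iD: "integrable (lebesgue_on ?A) (\<lambda>x. D x $ i $ j * \<phi> i j x)" for i j
    by (rule test_function_integrable[OF A lD _ C \<phi>0]) (use test_functionD(1)[OF test] in auto)
  have ig: "integrable (lebesgue_on ?A) (\<lambda>x. g x $ i * \<phi>' i j x)" for i j
    by (rule test_function_integrable[OF A lg c\<phi>' C \<phi>'0])
  \<comment> \<open>The inner product of \<open>g\<close> with the divergence of the matrix field,
    at radius \<open>s\<close>.\<close>
  define \<rho> where "\<rho> s = H s * s * (2 * d2 (s\<^sup>2) + 2 * s\<^sup>2 * d1 (s\<^sup>2) + (real ?n + 1) * \<psi>1 (s\<^sup>2))" for s
  have sum: "(\<Sum>i\<in>UNIV. \<Sum>j\<in>UNIV. g x $ i * \<phi>' i j x) = \<rho> (norm x)" if x: "x \<in> ?A" for x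
  proof -
    have s0: "0 < norm x" using x r by (auto simp: annulus_def)
    define Q where "Q = x \<bullet> x"
    have in1: "(\<Sum>j\<in>UNIV. \<phi>' i j x) = (2 * d2 Q + 2 * d1 Q * Q + \<psi>1 Q + real ?n * \<psi>1 Q) * x $ i" for i
    proof -
      have "(\<Sum>j\<in>UNIV. \<phi>' i j x) = (\<Sum>j\<in>UNIV. (if i = j then (2 * d2 Q + \<psi>1 Q) * x $ j else 0) + (2 * d1 Q * x $ i) * (x $ j * x $ j) + \<psi>1 Q * x $ i)"
        by (rule sum.cong) (auto simp: \<phi>'_def Q_def algebra_simps)
      also have "\<dots> = (2 * d2 Q + \<psi>1 Q) * x $ i + (2 * d1 Q * x $ i) * Q + real ?n * (\<psi>1 Q * x $ i)"
        unfolding sum.distrib sum_distrib_left[symmetric] inner_self_vec by (simp add: Q_def)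
      finally show ?thesis by (simp add: algebra_simps)
    qed
    have "(\<Sum>i\<in>UNIV. \<Sum>j\<in>UNIV. g x $ i * \<phi>' i j x) = (\<Sum>i\<in>UNIV. g x $ i * (\<Sum>j\<in>UNIV. \<phi>' i j x))"
      by (simp add: sum_distrib_left)
    also have "\<dots> = (\<Sum>i\<in>UNIV. (H (norm x) / norm x * (2 * d2 Q + 2 * d1 Q * Q + \<psi>1 Q + real ?n * \<psi>1 Q)) * (x $ i * x $ i))"
      unfolding in1 g[OF x] radial_map_def by (rule sum.cong) (auto simp: algebra_simps)
    also have "\<dots> = (H (norm x) / norm x * (2 * d2 Q + 2 * d1 Q * Q + \<psi>1 Q + real ?n * \<psi>1 Q)) * Q"
      unfolding sum_distrib_left[symmetric] inner_self_vec by (simp add: Q_def)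
    also have "Q = (norm x)\<^sup>2" by (simp add: Q_def power2_norm_eq_inner)
    finally show ?thesis using s0 by (simp add: \<rho>_def power2_eq_square algebra_simps)
  qed
  have "(LINT x|lebesgue_on ?A. D x \<bullet> radial_matrix (\<psi>2 (x \<bullet> x)) (\<psi>1 (x \<bullet> x)) x)
      = (\<Sum>i\<in>UNIV. \<Sum>j\<in>UNIV. LINT x|lebesgue_on ?A. D x $ i $ j * \<phi> i j x)"
    unfolding inner_matrix \<phi>_def[symmetric] using iD by (subst Bochner_Integration.integral_sum, force)+ simp
  also have "\<dots> = (\<Sum>i\<in>UNIV. \<Sum>j\<in>UNIV. - (LINT x|lebesgue_on ?A. g x $ i * \<phi>' i j x))"
  proof (intro sum.cong refl)
    fix i j
    have "(LINT x|lebesgue_on ?A. g x $ i * frechet_derivative (\<phi> i j) (at x) (axis j 1)) = - (LINT x|lebesgue_on ?A. D x $ i $ j * \<phi> i j x)"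
      using D test unfolding is_weak_derivative_def by blast
    then show "(LINT x|lebesgue_on ?A. D x $ i $ j * \<phi> i j x) = - (LINT x|lebesgue_on ?A. g x $ i * \<phi>' i j x)"
      by (simp add: \<phi>')
  qed
  also have "\<dots> = - (LINT x|lebesgue_on ?A. (\<Sum>i\<in>UNIV. \<Sum>j\<in>UNIV. g x $ i * \<phi>' i j x))"
    using ig by (subst Bochner_Integration.integral_sum, force)+ (simp add: sum_negf)
  also have "(LINT x|lebesgue_on ?A. (\<Sum>i\<in>UNIV. \<Sum>j\<in>UNIV. g x $ i * \<phi>' i j x)) = (LINT x|lebesgue_on ?A. \<rho> (norm x))"
    by (rule Bochner_Integration.integral_cong) (auto simp: space_restrict_space sum)
  also have "\<dots> = sphere_area ?n * integral {r..R} (\<lambda>s. \<rho> s * s ^ (?n - 1))"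
  proof (rule radial_integral(2)[OF r h(5)])
    show "continuous_on {r..R} \<rho>" unfolding \<rho>_def
      by (intro continuous_intros h(1) continuous_on_compose2[OF cd(1)] continuous_on_compose2[OF cd(2)] continuous_on_compose2[OF c\<psi>(1)]) auto
  qed
  finally have 1: "(LINT x|lebesgue_on ?A. D x \<bullet> radial_matrix (\<psi>2 (x \<bullet> x)) (\<psi>1 (x \<bullet> x)) x)
    = - (sphere_area ?n * integral {r..R} (\<lambda>s. \<rho> s * s ^ (?n - 1)))" .
  \<comment> \<open>The radial eigenvalue of the field times the density \<open>s ^ (n - 1)\<close>.
    Its derivative absorbs all of \<open>\<rho>\<close> except the tangential term with
    \<open>\<psi>2\<close>.\<close>
  define f where "f s = (\<psi>2 (s\<^sup>2) + \<psi>1 (s\<^sup>2) * s\<^sup>2) * s ^ (?n - 1)" for s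
  define f' where "f' s = (2 * s * d2 (s\<^sup>2) + 2 * s * d1 (s\<^sup>2) * s\<^sup>2 + \<psi>1 (s\<^sup>2) * (2 * s)) * s ^ (?n - 1)
      + (\<psi>2 (s\<^sup>2) + \<psi>1 (s\<^sup>2) * s\<^sup>2) * ((real ?n - 1) * s ^ (?n - 2))" for s
  have f': "(f has_real_derivative f' s) (at s)" for s
  proof -
    have p: "((\<lambda>s. \<psi>1 (s\<^sup>2)) has_real_derivative d1 (s\<^sup>2) * (2 * s)) (at s)" "((\<lambda>s. \<psi>2 (s\<^sup>2)) has_real_derivative d2 (s\<^sup>2) * (2 * s)) (at s)"
      by (rule DERIV_chain2[OF d(1)] DERIV_chain2[OF d(2)]; auto intro!: derivative_eq_intros)+
    have e: "real (?n - Suc 0) = real ?n - 1" "?n - Suc 0 - Suc 0 = ?n - 2" using n by auto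
    have "((\<lambda>s. s ^ (?n - 1)) has_real_derivative (real ?n - 1) * s ^ (?n - 2)) (at s)"
      using DERIV_power[OF DERIV_ident, of "?n - 1" s UNIV] by (simp add: e numeral_2_eq_2)
    from DERIV_mult[OF DERIV_add[OF p(2) DERIV_mult[OF p(1) DERIV_power[OF DERIV_ident, of 2]]] this]
    show ?thesis unfolding f_def f'_def by (simp add: algebra_simps)
  qed
  have cf': "continuous_on {r..R} f'" "continuous_on {r..R} f"
    unfolding f'_def f_def
    by (intro continuous_intros continuous_on_compose2[OF cd(1)] continuous_on_compose2[OF cd(2)] continuous_on_compose2[OF c\<psi>(1)] continuous_on_compose2[OF c\<psi>(2)]; auto)+
  \<comment> \<open>Stieltjes integration by parts: the potential \<open>h * f s\<close> has
    differential \<open>h * f' s ds + f s dh\<close>, and \<open>dh\<close> along the graph is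
    integrated over the target interval.\<close>
  have "integral {r..R} (\<lambda>s. H s * f' s) + integral {rs..Rs} (\<lambda>t. f (K t)) = Rs * f R - rs * f r"
  proof (rule monotone_line_integral[OF hom, where S = "\<lambda>s h. h * f s" and q = f])
    fix s assume "s \<in> {r..R}"
    have "(f has_derivative (\<lambda>x. f' s * x)) (at (fst (s, H s)))"
      using f'[of s] by (simp add: has_field_derivative_def)
    from has_derivative_compose[OF has_derivative_fst[OF has_derivative_ident] this]
    have "((\<lambda>z. f (fst z)) has_derivative (\<lambda>z. f' s * fst z)) (at (s, H s))" .
    from has_derivative_mult[OF has_derivative_snd[OF has_derivative_ident] this]
    show "((\<lambda>z. snd z * f (fst z)) has_derivative (\<lambda>z. H s * f' s * fst z + f s * snd z)) (at (s, H s))"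
      by (simp add: mult_ac)
  qed (auto intro!: continuous_intros cf' h)
  moreover have "f R = 0" "f r = 0" using \<psi>(3-6) by (auto simp: f_def)
  ultimately have 2: "integral {r..R} (\<lambda>s. H s * f' s) = - integral {rs..Rs} (\<lambda>t. f (K t))" by simp
  have "\<rho> s * s ^ (?n - 1) = H s * f' s - (real ?n - 1) * (\<psi>2 (s\<^sup>2) * H s * s ^ (?n - 2))" for s
  proof -
    have "?n - 1 = Suc (?n - 2)" using n by simp
    then have "s ^ (?n - 1) = s * s ^ (?n - 2)" by (simp only: power_Suc)
    then show ?thesis unfolding \<rho>_def f'_def by (simp add: algebra_simps power2_eq_square)
  qed
  then have "integral {r..R} (\<lambda>s. \<rho> s * s ^ (?n - 1)) = integral {r..R} (\<lambda>s. H s * f' s - (real ?n - 1) * (\<psi>2 (s\<^sup>2) * H s * s ^ (?n - 2)))" by simp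
  also have "\<dots> = integral {r..R} (\<lambda>s. H s * f' s) - integral {r..R} (\<lambda>s. (real ?n - 1) * (\<psi>2 (s\<^sup>2) * H s * s ^ (?n - 2)))"
    by (intro Henstock_Kurzweil_Integration.integral_diff integrable_continuous_interval continuous_intros h cf' continuous_on_compose2[OF c\<psi>(2)]) auto
  finally have 3: "integral {r..R} (\<lambda>s. \<rho> s * s ^ (?n - 1)) = - integral {rs..Rs} (\<lambda>t. f (K t))
     - (real ?n - 1) * integral {r..R} (\<lambda>s. \<psi>2 (s\<^sup>2) * H s * s ^ (?n - 2))"
    using 2 by simp
  show ?thesis unfolding 1 3 f_def by (simp add: algebra_simps)
qed

text \<open>Passage from smooth compactly supported coefficients to continuous ones on the closed
  interval. Since \<open>D\<close> is integrable on the whole annulus and the approximations are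
  bounded, the sum of the absolute values of its entries provides a majorant up to the
  boundary.\<close>

lemma weak_derivative_radial_functional:
  fixes g :: "real^'n \<Rightarrow> real^'n"
  assumes n: "2 \<le> CARD('n)" and hom: "increasing_homeo r R rs Rs H K" and r: "0 < r"
    and g: "\<And>x. x \<in> annulus r R \<Longrightarrow> g x = radial_map H x"
    and D: "is_weak_derivative (annulus r R) g D" and Di: "integrable (lebesgue_on (annulus r R)) D"
    and m1: "continuous_on {r..R} m1" and m2: "continuous_on {r..R} m2"
  shows "integrable (lebesgue_on (annulus r R)) (\<lambda>x. D x \<bullet> radial_matrix (m2 (norm x)) (m1 (norm x) / (norm x)\<^sup>2) x)"
    "(LINT x|lebesgue_on (annulus r R). D x \<bullet> radial_matrix (m2 (norm x)) (m1 (norm x) / (norm x)\<^sup>2) x) =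
    sphere_area CARD('n) * (integral {rs..Rs} (\<lambda>t. (m2 (K t) + m1 (K t)) * K t ^ (CARD('n) - 1))
      + (real CARD('n) - 1) * integral {r..R} (\<lambda>s. m2 s * H s * s ^ (CARD('n) - 2)))"
proof -
  let ?A = "annulus r R :: (real^'n) set" and ?n = "CARD('n)"
  note h = increasing_homeo_facts[OF hom]
  define M1 where "M1 q = m1 (sqrt q) / q" for q
  define M2 where "M2 q = m2 (sqrt q)" for q
  have sq: "sqrt q \<in> {r..R}" "0 < q" if "q \<in> {r\<^sup>2..R\<^sup>2}" for q
  proof -
    show "sqrt q \<in> {r..R}" using that real_le_rsqrt[of r q] real_le_lsqrt[of R q] r h(5) by simp
    have "0 < r\<^sup>2" using r by simp
    then show "0 < q" using that unfolding atLeastAtMost_iff by linarith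
  qed
  have cM: "continuous_on {r\<^sup>2..R\<^sup>2} M1" "continuous_on {r\<^sup>2..R\<^sup>2} M2"
    unfolding M1_def M2_def
    by (intro continuous_intros continuous_on_compose2[OF m1] continuous_on_compose2[OF m2]; use sq in force)+
  obtain \<psi>1 B1 where \<psi>1: "\<And>k j. C_on j UNIV (\<psi>1 k)"
    "\<And>k. \<exists>p q. r\<^sup>2 < p \<and> q < R\<^sup>2 \<and> (\<forall>x. x \<notin> {p..q} \<longrightarrow> \<psi>1 k x = 0)"
    "\<And>k x. \<bar>\<psi>1 k x\<bar> \<le> B1" "\<And>x. r\<^sup>2 < x \<Longrightarrow> x < R\<^sup>2 \<Longrightarrow> (\<lambda>k. \<psi>1 k x) \<longlonglongrightarrow> M1 x"
    by (rule smooth_compact_approximation[OF cM(1)]) (rule that)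
  obtain \<psi>2 B2 where \<psi>2: "\<And>k j. C_on j UNIV (\<psi>2 k)"
    "\<And>k. \<exists>p q. r\<^sup>2 < p \<and> q < R\<^sup>2 \<and> (\<forall>x. x \<notin> {p..q} \<longrightarrow> \<psi>2 k x = 0)"
    "\<And>k x. \<bar>\<psi>2 k x\<bar> \<le> B2" "\<And>x. r\<^sup>2 < x \<Longrightarrow> x < R\<^sup>2 \<Longrightarrow> (\<lambda>k. \<psi>2 k x) \<longlonglongrightarrow> M2 x"
    by (rule smooth_compact_approximation[OF cM(2)]) (rule that)
  have B0: "0 \<le> B1" "0 \<le> B2" using \<psi>1(3)[of 0 0] \<psi>2(3)[of 0 0] by auto
  define L where "L k = sphere_area ?n * (integral {rs..Rs} (\<lambda>t. (\<psi>2 k ((K t)\<^sup>2) + \<psi>1 k ((K t)\<^sup>2) * (K t)\<^sup>2) * K t ^ (?n - 1))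
      + (real ?n - 1) * integral {r..R} (\<lambda>s. \<psi>2 k (s\<^sup>2) * H s * s ^ (?n - 2)))" for k
  have eq: "(LINT x|lebesgue_on ?A. D x \<bullet> radial_matrix (\<psi>2 k (x \<bullet> x)) (\<psi>1 k (x \<bullet> x)) x) = L k" for k
  proof -
    obtain p1 q1 where 1: "r\<^sup>2 < p1" "q1 < R\<^sup>2" "\<And>x. x \<notin> {p1..q1} \<Longrightarrow> \<psi>1 k x = 0" using \<psi>1(2)[of k] by blast
    obtain p2 q2 where 2: "r\<^sup>2 < p2" "q2 < R\<^sup>2" "\<And>x. x \<notin> {p2..q2} \<Longrightarrow> \<psi>2 k x = 0" using \<psi>2(2)[of k] by blast
    show ?thesis unfolding L_def
      by (rule weak_derivative_radial_smooth[OF n hom r g D \<psi>1(1) \<psi>2(1), of "min p1 p2" "max q1 q2"])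
        (use 1 2 in \<open>auto simp: min_le_iff_disj le_max_iff_disj\<close>)
  qed
  define X where "X x = D x \<bullet> radial_matrix (m2 (norm x)) (m1 (norm x) / (norm x)\<^sup>2) x" for x
  define Xk where "Xk k x = D x \<bullet> radial_matrix (\<psi>2 k (x \<bullet> x)) (\<psi>1 k (x \<bullet> x)) x" for k x
  define w where "w x = (B2 + B1 * R\<^sup>2) * (\<Sum>i\<in>UNIV. \<Sum>j\<in>UNIV. \<bar>D x $ i $ j\<bar>)" for x
  have Dij: "integrable (lebesgue_on ?A) (\<lambda>x. D x $ i $ j)" for i j
    by (intro integrable_bounded_linear[OF bounded_linear_vec_nth] Di)
  have wi: "integrable (lebesgue_on ?A) w" unfolding w_def
    by (intro integrable_mult_right Bochner_Integration.integrable_sum integrable_abs Dij)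
  have lim: "(\<lambda>k. Xk k x) \<longlonglongrightarrow> X x" if x: "x \<in> ?A" for x
  proof -
    have xx: "r\<^sup>2 < x \<bullet> x" "x \<bullet> x < R\<^sup>2"
      using x r by (auto simp: annulus_def power2_norm_eq_inner[symmetric] intro!: power_strict_mono)
    have "(\<lambda>k. Xk k x) \<longlonglongrightarrow> D x \<bullet> radial_matrix (M2 (x \<bullet> x)) (M1 (x \<bullet> x)) x"
      unfolding Xk_def inner_matrix radial_matrix_def
      by (simp only: vec_lambda_beta) (intro tendsto_intros \<psi>1(4) \<psi>2(4) xx)
    moreover have "M2 (x \<bullet> x) = m2 (norm x)" "M1 (x \<bullet> x) = m1 (norm x) / (norm x)\<^sup>2"
      by (simp_all add: M1_def M2_def norm_eq_sqrt_inner)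
    ultimately show ?thesis by (simp add: X_def)
  qed
  have bound: "norm (Xk k x) \<le> w x" if x: "x \<in> ?A" for k x
  proof -
    have nx: "norm x < R" using x by (simp add: annulus_def)
    have "\<bar>radial_matrix (\<psi>2 k (x \<bullet> x)) (\<psi>1 k (x \<bullet> x)) x $ i $ j\<bar> \<le> B2 + B1 * R\<^sup>2" for i j
    proof -
      have "\<bar>x $ i * x $ j\<bar> \<le> R * R"
        unfolding abs_mult using component_le_norm_cart[of x i] component_le_norm_cart[of x j] nx by (intro mult_mono) auto
      then have "\<bar>\<psi>1 k (x \<bullet> x)\<bar> * \<bar>x $ i * x $ j\<bar> \<le> B1 * R\<^sup>2"
        using \<psi>1(3)[of k "x \<bullet> x"] B0 by (intro mult_mono) (auto simp: power2_eq_square)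
      moreover have "\<bar>\<psi>2 k (x \<bullet> x) * (if i = j then 1 else 0)\<bar> \<le> B2" using \<psi>2(3)[of k "x \<bullet> x"] B0 by auto
      ultimately show ?thesis
        using abs_triangle_ineq[of "\<psi>2 k (x \<bullet> x) * (if i = j then 1 else 0)" "\<psi>1 k (x \<bullet> x) * (x $ i * x $ j)"]
        unfolding radial_matrix_def vec_lambda_beta abs_mult[of "\<psi>1 k (x \<bullet> x)"] by linarith
    qed
    then have "\<bar>D x $ i $ j * radial_matrix (\<psi>2 k (x \<bullet> x)) (\<psi>1 k (x \<bullet> x)) x $ i $ j\<bar> \<le> (B2 + B1 * R\<^sup>2) * \<bar>D x $ i $ j\<bar>" for i j
      unfolding abs_mult by (subst mult.commute) (intro mult_right_mono, auto)
    then have "(\<Sum>i\<in>UNIV. \<Sum>j\<in>UNIV. \<bar>D x $ i $ j * radial_matrix (\<psi>2 k (x \<bullet> x)) (\<psi>1 k (x \<bullet> x)) x $ i $ j\<bar>) \<le> w x"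
      unfolding w_def sum_distrib_left by (intro sum_mono)
    moreover have "\<bar>Xk k x\<bar> \<le> (\<Sum>i\<in>UNIV. \<Sum>j\<in>UNIV. \<bar>D x $ i $ j * radial_matrix (\<psi>2 k (x \<bullet> x)) (\<psi>1 k (x \<bullet> x)) x $ i $ j\<bar>)"
      unfolding Xk_def inner_matrix by (intro order_trans[OF sum_abs] sum_mono sum_abs)
    ultimately show ?thesis by simp
  qed
  have Dm: "D \<in> borel_measurable (lebesgue_on ?A)" using Di by (rule borel_measurable_integrable)
  have Am: "?A \<in> sets lebesgue" by (simp add: open_annulus)
  have \<psi>m: "(\<lambda>x. \<psi> (x \<bullet> x)) \<in> borel_measurable (lebesgue_on ?A)" if "\<And>j. C_on j UNIV \<psi>" for \<psi> :: "real \<Rightarrow> real"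
    by (intro borel_measurable_lebesgue_on_continuous continuous_on_compose2[OF C_on_imp_continuous_on[OF that[of 0]]] continuous_intros) auto
  have Xkm: "Xk k \<in> borel_measurable (lebesgue_on ?A)" for k
    unfolding Xk_def inner_matrix radial_matrix_def vec_lambda_beta
    by (intro borel_measurable_sum borel_measurable_times borel_measurable_add borel_measurable_const \<psi>m \<psi>1 \<psi>2
         borel_measurable_integrable[OF Dij] borel_measurable_lebesgue_on_continuous continuous_intros)
  have Xm: "X \<in> borel_measurable (lebesgue_on ?A)"
    by (rule borel_measurable_LIMSEQ_metric[OF Xkm]) (use lim in \<open>auto simp: space_restrict_space\<close>)
  have ae: "AE x in lebesgue_on ?A. (\<lambda>k. Xk k x) \<longlonglongrightarrow> X x" "\<And>k. AE x in lebesgue_on ?A. norm (Xk k x) \<le> w x"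
    using lim bound by (auto intro!: AE_I2 simp: space_restrict_space)
  have "integrable (lebesgue_on ?A) X" by (rule integrable_dominated_convergence[OF Xm Xkm wi ae])
  then show "integrable (lebesgue_on ?A) (\<lambda>x. D x \<bullet> radial_matrix (m2 (norm x)) (m1 (norm x) / (norm x)\<^sup>2) x)"
    by (simp add: X_def[abs_def])
  have lim1: "L \<longlonglongrightarrow> (LINT x|lebesgue_on ?A. X x)"
    using integral_dominated_convergence[OF Xm Xkm wi ae] by (simp add: Xk_def eq)
  have z: "\<psi>1 k (r\<^sup>2) = 0" "\<psi>2 k (r\<^sup>2) = 0" "\<psi>1 k (R\<^sup>2) = 0" "\<psi>2 k (R\<^sup>2) = 0" for k
    using \<psi>1(2)[of k] \<psi>2(2)[of k] by force+
  have sq2: "r\<^sup>2 < s\<^sup>2" "s\<^sup>2 < R\<^sup>2" "M2 (s\<^sup>2) = m2 s" "M1 (s\<^sup>2) * s\<^sup>2 = m1 s" if "r < s" "s < R" for s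
    using that r by (auto simp: M1_def M2_def intro!: power_strict_mono)
  have c\<psi>: "continuous_on UNIV (\<psi>1 k)" "continuous_on UNIV (\<psi>2 k)" for k
    using C_on_imp_continuous_on \<psi>1(1) \<psi>2(1) by blast+
  let ?f = "\<lambda>k t. (\<psi>2 k ((K t)\<^sup>2) + \<psi>1 k ((K t)\<^sup>2) * (K t)\<^sup>2) * K t ^ (?n - 1)"
  let ?F = "\<lambda>t. (m2 (K t) + m1 (K t)) * K t ^ (?n - 1)"
  \<comment> \<open>All approximations vanish at the end points, so the pointwise limit is zero
    there; the integral does not notice two points.\<close>
  have "(\<lambda>k. integral {rs..Rs} (?f k)) \<longlonglongrightarrow> integral {rs..Rs} (\<lambda>t. if t \<in> {rs<..<Rs} then ?F t else 0)"
  proof (rule dominated_convergence(2)[where h = "\<lambda>t. (B2 + B1 * R\<^sup>2) * R ^ (?n - 1)"])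
    show "?f k integrable_on {rs..Rs}" for k
      by (intro integrable_continuous_interval continuous_intros h continuous_on_compose2[OF c\<psi>(1)] continuous_on_compose2[OF c\<psi>(2)]) auto
    show "norm (?f k t) \<le> (B2 + B1 * R\<^sup>2) * R ^ (?n - 1)" if t: "t \<in> {rs..Rs}" for k t
    proof -
      have K: "0 < K t" "K t \<le> R" using h(9)[OF t] r by auto
      have "\<bar>\<psi>1 k ((K t)\<^sup>2) * (K t)\<^sup>2\<bar> \<le> B1 * R\<^sup>2"
        unfolding abs_mult using \<psi>1(3)[of k "(K t)\<^sup>2"] K B0 by (intro mult_mono) (auto intro!: power_mono)
      then have "\<bar>\<psi>2 k ((K t)\<^sup>2) + \<psi>1 k ((K t)\<^sup>2) * (K t)\<^sup>2\<bar> \<le> B2 + B1 * R\<^sup>2"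
        using \<psi>2(3)[of k "(K t)\<^sup>2"] by linarith
      then show ?thesis unfolding real_norm_def abs_mult using K B0
        by (intro mult_mono) (auto intro!: power_mono)
    qed
    show "(\<lambda>k. ?f k t) \<longlonglongrightarrow> (if t \<in> {rs<..<Rs} then ?F t else 0)" if t: "t \<in> {rs..Rs}" for t
    proof (cases "t \<in> {rs<..<Rs}")
      case True
      have K: "r < K t" "K t < R"
        using increasing_homeo_less[OF increasing_homeo_sym[OF hom], of rs t]
          increasing_homeo_less[OF increasing_homeo_sym[OF hom], of t Rs] True h(8)[of r] h(8)[of R] h(3-5) by auto
      have "(\<lambda>k. ?f k t) \<longlonglongrightarrow> (M2 ((K t)\<^sup>2) + M1 ((K t)\<^sup>2) * (K t)\<^sup>2) * K t ^ (?n - 1)"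
        by (intro tendsto_intros \<psi>1(4) \<psi>2(4) sq2(1,2) K)
      then show ?thesis using True sq2(3,4)[OF K] by simp
    next
      case False
      then have "t = rs \<or> t = Rs" using t by auto
      then have "K t = r \<or> K t = R" using h(8)[of r] h(8)[of R] h(3-5) by auto
      then show ?thesis using False z by auto
    qed
  qed auto
  moreover have "integral {rs..Rs} (\<lambda>t. if t \<in> {rs<..<Rs} then ?F t else 0) = integral {rs..Rs} ?F"
    by (rule integral_spike[of "{rs, Rs}"]) auto
  ultimately have l1: "(\<lambda>k. integral {rs..Rs} (?f k)) \<longlonglongrightarrow> integral {rs..Rs} ?F" by simp
  let ?g = "\<lambda>k s. \<psi>2 k (s\<^sup>2) * H s * s ^ (?n - 2)"
  let ?G = "\<lambda>s. m2 s * H s * s ^ (?n - 2)"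
  have "(\<lambda>k. integral {r..R} (?g k)) \<longlonglongrightarrow> integral {r..R} (\<lambda>s. if s \<in> {r<..<R} then ?G s else 0)"
  proof (rule dominated_convergence(2)[where h = "\<lambda>s. B2 * \<bar>H s\<bar> * R ^ (?n - 2)"])
    show "?g k integrable_on {r..R}" for k
      by (intro integrable_continuous_interval continuous_intros h continuous_on_compose2[OF c\<psi>(2)]) auto
    show "(\<lambda>s. B2 * \<bar>H s\<bar> * R ^ (?n - 2)) integrable_on {r..R}"
      by (intro integrable_continuous_interval continuous_intros h)
    show "norm (?g k s) \<le> B2 * \<bar>H s\<bar> * R ^ (?n - 2)" if s: "s \<in> {r..R}" for k s
      unfolding real_norm_def abs_mult using s r \<psi>2(3)[of k "s\<^sup>2"] B0 by (intro mult_mono) (auto intro!: power_mono)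
    show "(\<lambda>k. ?g k s) \<longlonglongrightarrow> (if s \<in> {r<..<R} then ?G s else 0)" if s: "s \<in> {r..R}" for s
    proof (cases "s \<in> {r<..<R}")
      case True
      then have "(\<lambda>k. ?g k s) \<longlonglongrightarrow> M2 (s\<^sup>2) * H s * s ^ (?n - 2)"
        by (intro tendsto_intros \<psi>2(4) sq2(1,2)) auto
      then show ?thesis using True sq2(3)[of s] by simp
    next
      case False
      then have "s = r \<or> s = R" using s by auto
      then show ?thesis using False z by auto
    qed
  qed
  moreover have "integral {r..R} (\<lambda>s. if s \<in> {r<..<R} then ?G s else 0) = integral {r..R} ?G"
    by (rule integral_spike[of "{r, R}"]) auto
  ultimately have l2: "(\<lambda>k. integral {r..R} (?g k)) \<longlonglongrightarrow> integral {r..R} ?G" by simp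
  have "L \<longlonglongrightarrow> sphere_area ?n * (integral {rs..Rs} ?F + (real ?n - 1) * integral {r..R} ?G)"
    unfolding L_def by (intro tendsto_intros l1 l2)
  from LIMSEQ_unique[OF lim1 this]
  show "(LINT x|lebesgue_on ?A. D x \<bullet> radial_matrix (m2 (norm x)) (m1 (norm x) / (norm x)\<^sup>2) x) =
    sphere_area ?n * (integral {rs..Rs} ?F + (real ?n - 1) * integral {r..R} ?G)"
    by (simp add: X_def)
qed

section \<open>Lower bound for the energy\<close>

lemma hs_norm_eq_norm: "hs_norm X = norm X"
proof -
  have "trace (transpose X ** X) = (\<Sum>i\<in>UNIV. \<Sum>k\<in>UNIV. X $ k $ i * X $ k $ i)"
    by (simp add: trace_def matrix_matrix_mult_def transpose_def)
  also have "\<dots> = X \<bullet> X" unfolding inner_matrix by (rule sum.swap)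
  finally show ?thesis by (simp add: hs_norm_def norm_eq_sqrt_inner)
qed

text \<open>Convexity of the \<open>n\<close>-th power of the norm: Bernoulli's inequality for the
  ratio of the norms, then Cauchy-Schwarz to replace their product by the inner product.\<close>

lemma norm_power_supporting_hyperplane:
  fixes X Y :: "'a::real_inner"
  assumes "Y \<noteq> 0" "2 \<le> n"
  shows "norm Y ^ n + real n * norm Y ^ (n - 2) * (X \<bullet> Y - norm Y ^ 2) \<le> norm X ^ n"
proof -
  define x y where "x = norm X" and "y = norm Y"
  have y: "0 < y" "0 \<le> x" using assms by (auto simp: x_def y_def)
  have yn: "y ^ n = y ^ (n - 2) * y\<^sup>2" unfolding power_add[symmetric] le_add_diff_inverse2[OF assms(2)] ..
  have "1 + real n * (x / y - 1) \<le> (1 + (x / y - 1)) ^ n"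
    by (rule Bernoulli_inequality) (use y in simp)
  then have "y ^ n * (1 + real n * (x / y - 1)) \<le> y ^ n * (x / y) ^ n"
    using y by (intro mult_left_mono) auto
  then have "y ^ n + real n * (y ^ n * (x / y) - y ^ n) \<le> x ^ n"
    using y by (simp add: power_divide algebra_simps)
  moreover have z: "y ^ n * (x / y) = y ^ (n - 2) * (x * y)" using y by (simp add: yn power2_eq_square)
  have "real n * (y ^ (n - 2) * (X \<bullet> Y)) \<le> real n * (y ^ n * (x / y))"
    unfolding z using y norm_cauchy_schwarz[of X Y] by (intro mult_left_mono) (auto simp: x_def y_def)
  ultimately have "y ^ n + (real n * (y ^ (n - 2) * (X \<bullet> Y)) - real n * y ^ n) \<le> x ^ n"
    unfolding right_diff_distrib by linarith
  then have "y ^ n + (real n * (y ^ (n - 2) * (X \<bullet> Y)) - real n * (y ^ (n - 2) * y\<^sup>2)) \<le> x ^ n"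
    unfolding yn[symmetric] .
  then show ?thesis by (simp add: x_def y_def algebra_simps)
qed

lemma radial_matrix_scale: "c *\<^sub>R radial_matrix t d x = radial_matrix (c * t) (c * d) x"
  by (simp add: radial_matrix_def vec_eq_iff algebra_simps)

text \<open>Sums the squares of the eigenvalues: \<open>t\<close> with multiplicity
  \<open>n - 1\<close>, and \<open>y\<close>.\<close>

lemma norm_radial_matrix:
  fixes x :: "real^'n"
  assumes "x \<noteq> 0"
  shows "(norm (radial_matrix t ((y - t) / (norm x)\<^sup>2) x))\<^sup>2 = (real CARD('n) - 1) * t\<^sup>2 + y\<^sup>2"
proof -
  define d where "d = (y - t) / (norm x)\<^sup>2"
  let ?X = "radial_matrix t d x"
  have "(norm ?X)\<^sup>2 = (\<Sum>i\<in>UNIV. \<Sum>j\<in>UNIV. (if i = j then t\<^sup>2 + 2 * t * d * (x $ j * x $ j) else 0) + d\<^sup>2 * (x $ i * x $ i) * (x $ j * x $ j))"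
    unfolding power2_norm_eq_inner inner_matrix radial_matrix_def vec_lambda_beta
    by (intro sum.cong refl) (auto simp: power2_eq_square algebra_simps)
  also have "\<dots> = real CARD('n) * t\<^sup>2 + 2 * t * d * (x \<bullet> x) + d\<^sup>2 * (x \<bullet> x) * (x \<bullet> x)"
    unfolding sum.distrib sum_distrib_left[symmetric] sum_distrib_right[symmetric] inner_self_vec
    by (simp add: sum.distrib inner_self_vec flip: sum_distrib_left)
  also have "\<dots> = real CARD('n) * t\<^sup>2 + 2 * t * (d * (norm x)\<^sup>2) + (d * (norm x)\<^sup>2)\<^sup>2"
    unfolding power2_norm_eq_inner by (simp add: power2_eq_square)
  also have "d * (norm x)\<^sup>2 = y - t" using assms by (simp add: d_def)
  finally show ?thesis unfolding d_def by (simp add: power2_eq_square algebra_simps)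
qed

text \<open>The supporting hyperplane is taken at the differential \<open>X0\<close> of a fictitious
  radial map with the tangential stretch \<open>H / s\<close> of \<open>g\<close> but the prescribed
  radial stretch \<open>y\<close>. It is affine in \<open>D\<close> with a radial coefficient
  matrix, so its integral can be evaluated for a weak derivative. There is equality when
  \<open>D\<close> is \<open>X0\<close>.\<close>

lemma energy_lower_bound:
  fixes g :: "real^'n \<Rightarrow> real^'n"
  assumes n: "2 \<le> CARD('n)" and hom: "increasing_homeo r R rs Rs H K" and r: "0 < r"
    and g: "\<And>x. x \<in> annulus r R \<Longrightarrow> g x = radial_map H x"
    and D: "is_weak_derivative (annulus r R) g D" and Di: "integrable (lebesgue_on (annulus r R)) D"
    and Dn: "integrable (lebesgue_on (annulus r R)) (\<lambda>x. norm (D x) ^ CARD('n))"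
    and y: "continuous_on {r..R} y" "\<And>s. s \<in> {r..R} \<Longrightarrow> 0 < y s"
  defines "I \<equiv> sphere_area CARD('n) *
      (integral {rs..Rs} (\<lambda>t. energy_slope CARD('n) (t / K t) (y (K t)) * K t ^ (CARD('n) - 1))
     + integral {r..R} (\<lambda>s. energy_rest CARD('n) (H s / s) (y s) * s ^ (CARD('n) - 1)))"
  shows "I \<le> (LINT x|lebesgue_on (annulus r R). norm (D x) ^ CARD('n))"
    and "(\<And>x. x \<in> annulus r R \<Longrightarrow>
           D x = radial_matrix (H (norm x) / norm x) ((y (norm x) - H (norm x) / norm x) / (norm x)\<^sup>2) x) \<Longrightarrow>
         (LINT x|lebesgue_on (annulus r R). norm (D x) ^ CARD('n)) = I"
proof -
  let ?A = "annulus r R :: (real^'n) set" and ?n = "CARD('n)"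
  note h = increasing_homeo_facts[OF hom]
  define t where "t s = H s / s" for s
  define P where "P s = (real ?n - 1) * (t s)\<^sup>2 + (y s)\<^sup>2" for s
  define c where "c s = P s powr (real ?n / 2 - 1)" for s
  define X0 where "X0 x = radial_matrix (t (norm x)) ((y (norm x) - t (norm x)) / (norm x)\<^sup>2) x" for x :: "real^'n"
  define m1 m2 where "m1 s = real ?n * c s * (y s - t s)" and "m2 s = real ?n * c s * t s" for s
  have Ppos: "0 < P s" if "s \<in> {r..R}" for s
    unfolding P_def using n y(2)[OF that] by (intro add_nonneg_pos) auto
  have ct: "continuous_on {r..R} t" unfolding t_def by (intro continuous_intros h) (use r in auto)
  have cP: "continuous_on {r..R} P" unfolding P_def by (intro continuous_intros ct y)
  have cc: "continuous_on {r..R} c" unfolding c_def by (intro continuous_intros cP) (use Ppos in force)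
  have cm: "continuous_on {r..R} m1" "continuous_on {r..R} m2"
    unfolding m1_def m2_def by (intro continuous_intros cc ct y)+
  define Z where "Z x = D x \<bullet> radial_matrix (m2 (norm x)) (m1 (norm x) / (norm x)\<^sup>2) x - (real ?n - 1) * (c (norm x) * P (norm x))" for x
  have X0n: "norm (X0 x) ^ 2 = P (norm x)" "norm (X0 x) ^ (?n - 2) = c (norm x)" "norm (X0 x) ^ ?n = c (norm x) * P (norm x)"
    "real ?n * c (norm x) * (D x \<bullet> X0 x) = D x \<bullet> radial_matrix (m2 (norm x)) (m1 (norm x) / (norm x)\<^sup>2) x"
    "X0 x \<noteq> 0" if x: "x \<in> ?A" for x
  proof -
    have s: "norm x \<in> {r..R}" "x \<noteq> 0" using x r by (auto simp: annulus_def)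
    show 1: "norm (X0 x) ^ 2 = P (norm x)" unfolding X0_def P_def by (rule norm_radial_matrix[OF s(2)])
    then show X0: "X0 x \<noteq> 0" using Ppos[OF s(1)] by auto
    have e: "2 * (real ?n / 2 - 1) = real (?n - 2)" using n by (simp add: of_nat_diff)
    have "c (norm x) = ((norm (X0 x)) powr 2) powr (real ?n / 2 - 1)" unfolding c_def 1[symmetric] using X0 by simp
    also have "\<dots> = norm (X0 x) ^ (?n - 2)" unfolding powr_powr e using X0 by (simp add: powr_realpow)
    finally show 2: "norm (X0 x) ^ (?n - 2) = c (norm x)" ..
    have "norm (X0 x) ^ ?n = norm (X0 x) ^ (?n - 2) * norm (X0 x) ^ 2" unfolding power_add[symmetric] le_add_diff_inverse2[OF n] ..
    then show "norm (X0 x) ^ ?n = c (norm x) * P (norm x)" unfolding 1 2 .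
    show "real ?n * c (norm x) * (D x \<bullet> X0 x) = D x \<bullet> radial_matrix (m2 (norm x)) (m1 (norm x) / (norm x)\<^sup>2) x"
      unfolding inner_scaleR_right[symmetric] X0_def radial_matrix_scale m1_def m2_def by (simp add: mult.assoc)
  qed
  have Zle: "Z x \<le> norm (D x) ^ ?n" if x: "x \<in> ?A" for x
    using norm_power_supporting_hyperplane[OF X0n(5)[OF x] n, of "D x"] X0n(1-4)[OF x]
    by (simp add: Z_def algebra_simps)
  have Zeq: "Z x = norm (D x) ^ ?n" if x: "x \<in> ?A" and "D x = X0 x" for x
  proof -
    have "real ?n * c (norm x) * (norm (X0 x))\<^sup>2 = D x \<bullet> radial_matrix (m2 (norm x)) (m1 (norm x) / (norm x)\<^sup>2) x"
      using X0n(4)[OF x] that(2) by (simp add: power2_norm_eq_inner)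
    then show ?thesis using X0n(1-3)[OF x] that(2) by (simp add: Z_def algebra_simps)
  qed
  note fn = weak_derivative_radial_functional[OF n hom r g D Di cm]
  have cPc: "continuous_on {r..R} (\<lambda>s. c s * P s)" by (intro continuous_intros cc cP)
  note ri = radial_integral[OF r h(5) cPc, where 'n = 'n]
  have iZ: "integrable (lebesgue_on ?A) Z" unfolding Z_def
    by (intro Bochner_Integration.integrable_diff fn(1) integrable_mult_right ri(1))
  have "(LINT x|lebesgue_on ?A. Z x) = sphere_area ?n * (integral {rs..Rs} (\<lambda>t. (m2 (K t) + m1 (K t)) * K t ^ (?n - 1))
      + (real ?n - 1) * integral {r..R} (\<lambda>s. m2 s * H s * s ^ (?n - 2)))
      - (real ?n - 1) * (sphere_area ?n * integral {r..R} (\<lambda>s. c s * P s * s ^ (?n - 1)))"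
    unfolding Z_def using fn ri by (subst Bochner_Integration.integral_diff) auto
  also have "\<dots> = sphere_area ?n * (integral {rs..Rs} (\<lambda>t. (m2 (K t) + m1 (K t)) * K t ^ (?n - 1))
      + (integral {r..R} (\<lambda>s. (real ?n - 1) * (m2 s * H s * s ^ (?n - 2))) - integral {r..R} (\<lambda>s. (real ?n - 1) * (c s * P s * s ^ (?n - 1)))))"
    unfolding Henstock_Kurzweil_Integration.integral_mult_right by (simp add: algebra_simps)
  also have "integral {r..R} (\<lambda>s. (real ?n - 1) * (m2 s * H s * s ^ (?n - 2))) - integral {r..R} (\<lambda>s. (real ?n - 1) * (c s * P s * s ^ (?n - 1)))
     = integral {r..R} (\<lambda>s. (real ?n - 1) * (m2 s * H s * s ^ (?n - 2)) - (real ?n - 1) * (c s * P s * s ^ (?n - 1)))"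
    by (intro Henstock_Kurzweil_Integration.integral_diff[symmetric] integrable_continuous_interval continuous_intros cm cc cP h)
  \<comment> \<open>By \<open>P = (n - 1) * t^2 + y^2\<close> the tangential part of the pairing
    combines with the constant term: \<open>(n - 1) * (n * t^2 - P) = P - n * y^2\<close>.\<close>
  also have "\<dots> = integral {r..R} (\<lambda>s. energy_rest ?n (H s / s) (y s) * s ^ (?n - 1))"
  proof (rule Henstock_Kurzweil_Integration.integral_cong)
    fix s assume s: "s \<in> {r..R}"
    have s0: "0 < s" using s r by auto
    have "?n - 1 = Suc (?n - 2)" using n by simp
    then have e: "s ^ (?n - 1) = s * s ^ (?n - 2)" by (simp only: power_Suc)
    have Hs: "H s = t s * s" using s0 by (simp add: t_def)
    have er: "energy_rest ?n (H s / s) (y s) = c s * (P s - real ?n * (y s)\<^sup>2)"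
      by (simp add: energy_rest_def c_def P_def t_def)
    have "(real ?n - 1) * (real ?n * c s * t s * (t s * s)) - (real ?n - 1) * (c s * P s * s) = c s * (P s - real ?n * (y s)\<^sup>2) * s"
      unfolding P_def by (simp add: power2_eq_square algebra_simps)
    then have "((real ?n - 1) * (real ?n * c s * t s * (t s * s)) - (real ?n - 1) * (c s * P s * s)) * s ^ (?n - 2) = c s * (P s - real ?n * (y s)\<^sup>2) * s * s ^ (?n - 2)"
      by simp
    then show "(real ?n - 1) * (m2 s * H s * s ^ (?n - 2)) - (real ?n - 1) * (c s * P s * s ^ (?n - 1)) = energy_rest ?n (H s / s) (y s) * s ^ (?n - 1)"
      unfolding er unfolding e m2_def Hs by (simp add: algebra_simps)
  qed
  also have "integral {rs..Rs} (\<lambda>t. (m2 (K t) + m1 (K t)) * K t ^ (?n - 1)) = integral {rs..Rs} (\<lambda>t. energy_slope ?n (t / K t) (y (K t)) * K t ^ (?n - 1))"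
  proof (rule Henstock_Kurzweil_Integration.integral_cong)
    fix u assume u: "u \<in> {rs..Rs}"
    have "m2 (K u) + m1 (K u) = real ?n * c (K u) * y (K u)" by (simp add: m1_def m2_def algebra_simps)
    also have "\<dots> = energy_slope ?n (u / K u) (y (K u))"
      using h(10)[OF u] by (simp add: energy_slope_def c_def P_def t_def)
    finally show "(m2 (K u) + m1 (K u)) * K u ^ (?n - 1) = energy_slope ?n (u / K u) (y (K u)) * K u ^ (?n - 1)" by simp
  qed
  finally have ZI: "(LINT x|lebesgue_on ?A. Z x) = I" by (simp add: I_def)
  show "I \<le> (LINT x|lebesgue_on ?A. norm (D x) ^ ?n)"
    unfolding ZI[symmetric] by (rule integral_mono[OF iZ Dn]) (simp add: space_restrict_space Zle)
  show "(LINT x|lebesgue_on ?A. norm (D x) ^ ?n) = I"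
    if "\<And>x. x \<in> ?A \<Longrightarrow> D x = radial_matrix (H (norm x) / norm x) ((y (norm x) - H (norm x) / norm x) / (norm x)\<^sup>2) x"
    unfolding ZI[symmetric]
  proof (rule Bochner_Integration.integral_cong[OF refl])
    fix x assume "x \<in> space (lebesgue_on ?A)"
    then have x: "x \<in> ?A" by (simp add: space_restrict_space)
    have "D x = X0 x" unfolding X0_def t_def by (rule that[OF x])
    then show "norm (D x) ^ ?n = Z x" using Zeq[OF x] by simp
  qed
qed

section \<open>Sobolev regularity and energy of radial maps\<close>

lemma L_space_AE:
  fixes D :: "real^'n \<Rightarrow> real^'m^'k"
  assumes S: "S \<in> sets lebesgue" and ae: "AE x in lebesgue_on S. D x = D' x" and D: "D \<in> L_space p S"
  shows "D' \<in> L_space p S" "(LINT x|lebesgue_on S. norm (D' x) ^ p) = (LINT x|lebesgue_on S. norm (D x) ^ p)"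
proof -
  have D: "D \<in> borel_measurable (lebesgue_on S)" "integrable (lebesgue_on S) (\<lambda>x. norm (D x) ^ p)"
    using D by (auto simp: L_space_def)
  have "(\<lambda>x. indicator S x *\<^sub>R D x) \<in> borel_measurable lebesgue"
    using D(1) S by (subst (asm) borel_measurable_restrict_space_iff) auto
  moreover have "AE x in lebesgue. indicator S x *\<^sub>R D x = indicator S x *\<^sub>R D' x"
  proof -
    have "AE x in lebesgue. x \<in> S \<longrightarrow> D x = D' x" using ae S by (simp add: AE_restrict_space_iff)
    then show ?thesis by eventually_elim (auto simp: indicator_def)
  qed
  ultimately have "(\<lambda>x. indicator S x *\<^sub>R D' x) \<in> borel_measurable lebesgue" by (rule borel_measurable_AE)
  then have D': "D' \<in> borel_measurable (lebesgue_on S)" using S by (subst borel_measurable_restrict_space_iff) auto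
  have ae': "AE x in lebesgue_on S. norm (D x) ^ p = norm (D' x) ^ p" using ae by eventually_elim simp
  have m: "(\<lambda>x. norm (D x) ^ p) \<in> borel_measurable (lebesgue_on S)" "(\<lambda>x. norm (D' x) ^ p) \<in> borel_measurable (lebesgue_on S)"
    using D(1) D' by (auto intro: borel_measurable_power borel_measurable_norm[THEN measurable_compose[rotated]])
  have "integrable (lebesgue_on S) (\<lambda>x. norm (D' x) ^ p)"
    using D(2) integrable_cong_AE[OF m ae'] by simp
  then show "D' \<in> L_space p S" using D' by (simp add: L_space_def)
  show "(LINT x|lebesgue_on S. norm (D' x) ^ p) = (LINT x|lebesgue_on S. norm (D x) ^ p)"
    by (rule integral_cong_AE[OF m ae', symmetric])
qed

text \<open>Membership in the Sobolev space provides some derivative in the right Lebesgue space,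
  whereas \<open>weak_derivative\<close> picks an arbitrary one; uniqueness almost everywhere
  transfers measurability and integrability.\<close>

lemma W1_space_weak_derivative:
  assumes S: "open S" and f: "f \<in> W1_space p S"
  shows "is_weak_derivative S f (weak_derivative S f)" "weak_derivative S f \<in> L_space p S"
proof -
  obtain D where D: "is_weak_derivative S f D" "D \<in> L_space p S" using f by (auto simp: W1_space_def)
  then show w: "is_weak_derivative S f (weak_derivative S f)"
    unfolding weak_derivative_def by (metis someI_ex)
  show "weak_derivative S f \<in> L_space p S"
    by (rule L_space_AE(1)[OF _ weak_derivative_unique[OF S D(1) w] D(2)]) (use S in simp)
qed

text \<open>On a set of finite measure \<open>t \<le> 1 + t ^ p\<close> suffices. Integrability up
  to the boundary of the annulus is what the limit of the test fields relies on.\<close>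

lemma L_space_integrable:
  fixes f :: "real^'n \<Rightarrow> 'b::{banach, second_countable_topology}"
  assumes S: "S \<in> lmeasurable" and f: "f \<in> L_space p S" and p: "1 \<le> p"
  shows "integrable (lebesgue_on S) f"
proof (rule Bochner_Integration.integrable_bound)
  have "integrable (lebesgue_on S) (\<lambda>x. 1 :: real)"
    using S by (subst integrable_restrict_space) (auto simp: fmeasurable_def)
  then show "integrable (lebesgue_on S) (\<lambda>x. 1 + norm (f x) ^ p)" using f by (auto simp: L_space_def)
  show "f \<in> borel_measurable (lebesgue_on S)" using f by (simp add: L_space_def)
  have "t \<le> 1 + t ^ p" if "0 \<le> t" for t :: real
  proof (cases "1 \<le> t")
    case True
    then show ?thesis using self_le_power[of t p] p by simp
  next
    case False
    then show ?thesis using zero_le_power[OF that, of p] by linarith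
  qed
  then show "AE x in lebesgue_on S. norm (f x) \<le> norm (1 + norm (f x) ^ p)" by (intro AE_I2) (auto simp: abs_of_nonneg)
qed

lemma annulus_lmeasurable: "(annulus r R :: (real^'n) set) \<in> lmeasurable"
proof (rule bounded_set_imp_lmeasurable)
  show "bounded (annulus r R :: (real^'n) set)" by (rule boundedI[of _ R]) (simp add: annulus_def)
  show "(annulus r R :: (real^'n) set) \<in> sets lebesgue" by (simp add: open_annulus)
qed

lemma measure_annulus_pos:
  assumes "0 < r" "r < R" shows "0 < measure lebesgue (annulus r R :: (real^'n) set)"
proof -
  have "measure lebesgue (annulus r R :: (real^'n) set) = measure lborel (annulus r R :: (real^'n) set)"
    by (rule measure_completion) (simp add: open_annulus)
  also have "\<dots> = unit_ball_vol CARD('n) * (R ^ CARD('n) - r ^ CARD('n))"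
    using emeasure_annulus[of r R, where 'n = 'n] assms by (simp add: measure_def power_mono less_imp_le)
  also have "\<dots> > 0" using assms by (intro mult_pos_pos) (auto intro: power_strict_mono)
  finally show ?thesis .
qed

lemma is_weak_derivative_cong:
  assumes f: "\<And>x. x \<in> S \<Longrightarrow> f x = g x" and D: "is_weak_derivative S f D"
  shows "is_weak_derivative S g D"
proof -
  have "integrable (lebesgue_on K) f \<longleftrightarrow> integrable (lebesgue_on K) g" if "K \<subseteq> S" for K
    by (rule Bochner_Integration.integrable_cong) (use f that in \<open>auto simp: space_restrict_space\<close>)
  moreover have "(LINT x|lebesgue_on S. f x $ i * frechet_derivative \<phi> (at x) (axis j 1)) =
      (LINT x|lebesgue_on S. g x $ i * frechet_derivative \<phi> (at x) (axis j 1))" for \<phi> i j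
    by (rule Bochner_Integration.integral_cong) (use f in \<open>auto simp: space_restrict_space\<close>)
  ultimately show ?thesis using D by (simp add: is_weak_derivative_def locally_integrable_def)
qed

lemma radial_map_derivative:
  fixes x :: "real^'n"
  assumes H: "(H has_real_derivative y) (at (norm x))" and x: "x \<noteq> 0"
  shows "(radial_map H has_derivative (\<lambda>v. (H (norm x) / norm x) *\<^sub>R v + ((y - H (norm x) / norm x) / (norm x)\<^sup>2 * (x \<bullet> v)) *\<^sub>R x)) (at x)"
proof -
  let ?s = "norm x"
  have s: "0 < ?s" using x by simp
  have "((\<lambda>s. H s / s) has_real_derivative (y * ?s - H ?s) / (?s * ?s)) (at ?s)"
    using DERIV_divide[OF H DERIV_ident] s by simp
  from has_derivative_compose[OF has_derivative_norm[OF x] this[unfolded has_field_derivative_def]]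
  have "((\<lambda>x. H (norm x) / norm x) has_derivative (\<lambda>v. (y * ?s - H ?s) / (?s * ?s) * (sgn x \<bullet> v))) (at x)" by (simp add: inner_commute)
  from has_derivative_scaleR[OF this has_derivative_ident]
  have "(radial_map H has_derivative (\<lambda>v. (H ?s / ?s) *\<^sub>R v + ((y * ?s - H ?s) / (?s * ?s) * (sgn x \<bullet> v)) *\<^sub>R x)) (at x)"
    by (simp add: radial_map_def[abs_def])
  moreover have "(y * ?s - H ?s) / (?s * ?s) * (sgn x \<bullet> v) = (y - H ?s / ?s) / ?s\<^sup>2 * (x \<bullet> v)" for v
    using s by (simp add: sgn_div_norm power2_eq_square field_simps)
  ultimately show ?thesis by simp
qed

text \<open>The derivative of the profile is assumed only inside the interval, but its continuous
  extension \<open>y\<close> to the closed interval keeps the differential bounded up to the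
  boundary of the annulus.\<close>

lemma radial_map_W1:
  fixes f :: "real^'n \<Rightarrow> real^'n"
  assumes r: "0 < r" and rR: "r < R" and H: "continuous_on {r..R} H" and y: "continuous_on {r..R} y"
    and d: "\<And>s. r < s \<Longrightarrow> s < R \<Longrightarrow> (H has_real_derivative y s) (at s)"
    and f: "\<And>x. x \<in> annulus r R \<Longrightarrow> f x = radial_map H x"
  defines "D \<equiv> \<lambda>x. radial_matrix (H (norm x) / norm x) ((y (norm x) - H (norm x) / norm x) / (norm x)\<^sup>2) x"
  shows "is_weak_derivative (annulus r R) f D" "D \<in> L_space p (annulus r R)" "f \<in> W1_space p (annulus r R)"
proof -
  let ?A = "annulus r R :: (real^'n) set"
  have A: "open ?A" "?A \<in> sets lebesgue" by (simp_all add: open_annulus)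
  have xA: "norm x \<in> {r..R}" "r < norm x" "norm x < R" "x \<noteq> 0" if "x \<in> ?A" for x using that r by (auto simp: annulus_def)
  define f' where "f' x v = (H (norm x) / norm x) *\<^sub>R v + ((y (norm x) - H (norm x) / norm x) / (norm x)\<^sup>2 * (x \<bullet> v)) *\<^sub>R x" for x v :: "real^'n"
  have cH: "continuous_on ?A (\<lambda>x. H (norm x))" "continuous_on ?A (\<lambda>x. y (norm x))"
    by (intro continuous_on_compose2[OF H] continuous_on_compose2[OF y] continuous_intros; use xA in auto)+
  have cf': "continuous_on ?A (\<lambda>x. f' x v)" for v
    unfolding f'_def by (intro continuous_intros cH) (use xA in auto)
  have "is_weak_derivative ?A (radial_map H) (\<lambda>x. \<chi> i j. f' x (axis j 1) $ i)"
  proof (rule classical_weak_derivative[OF A(1) _ cf'])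
    fix x assume x: "x \<in> ?A"
    show "(radial_map H has_derivative f' x) (at x)"
      using radial_map_derivative[OF d[OF xA(2,3)[OF x]] xA(4)[OF x]] by (simp add: f'_def[abs_def])
  qed
  moreover have "(\<lambda>x. \<chi> i j. f' x (axis j 1) $ i) = D"
    unfolding D_def f'_def radial_matrix_def inner_axis by (auto simp: fun_eq_iff vec_eq_iff axis_def)
  ultimately have w: "is_weak_derivative ?A (radial_map H) D" by simp
  then show wf: "is_weak_derivative ?A f D" by (rule is_weak_derivative_cong[rotated]) (simp add: f)
  have cD: "continuous_on ?A D"
    unfolding D_def radial_matrix_def
    by (intro continuous_on_vec_lambda continuous_intros cH continuous_on_component) (use xA in auto)
  define N where "N s = sqrt ((real CARD('n) - 1) * (H s / s)\<^sup>2 + (y s)\<^sup>2)" for s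
  have ND: "norm (D x) = N (norm x)" if "x \<in> ?A" for x
    unfolding D_def N_def using norm_radial_matrix[OF xA(4)[OF that], of "H (norm x) / norm x" "y (norm x)"]
    by (metis norm_ge_zero real_sqrt_unique)
  have "continuous_on {r..R} (\<lambda>s. N s ^ p)"
    unfolding N_def by (intro continuous_intros H y) (use r in auto)
  from radial_integral(1)[OF r rR this, where 'n = 'n]
  have "integrable (lebesgue_on ?A) (\<lambda>x. norm (D x) ^ p)"
    by (subst Bochner_Integration.integrable_cong[OF refl, of _ _ "\<lambda>x. N (norm x) ^ p"]) (simp_all add: ND space_restrict_space)
  then show LD: "D \<in> L_space p ?A"
    using continuous_imp_measurable_on_sets_lebesgue[OF cD A(2)] by (simp add: L_space_def)
  have fH: "norm (f x) = \<bar>H (norm x)\<bar>" if "x \<in> ?A" for x using f[OF that] xA(4)[OF that] by (simp add: radial_map_def)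
  have "continuous_on {r..R} (\<lambda>s. \<bar>H s\<bar> ^ p)" by (intro continuous_intros H)
  from radial_integral(1)[OF r rR this, where 'n = 'n]
  have "integrable (lebesgue_on ?A) (\<lambda>x. norm (f x) ^ p)"
    by (subst Bochner_Integration.integrable_cong[OF refl, of _ _ "\<lambda>x. \<bar>H (norm x)\<bar> ^ p"]) (simp_all add: fH space_restrict_space)
  moreover have "continuous_on ?A f"
  proof (rule continuous_on_eq)
    show "continuous_on ?A (radial_map H)" unfolding radial_map_def by (intro continuous_intros cH) (use xA in auto)
  qed (simp add: f)
  then have "f \<in> borel_measurable (lebesgue_on ?A)" by (rule continuous_imp_measurable_on_sets_lebesgue[OF _ A(2)])
  ultimately show "f \<in> W1_space p ?A" using wf LD by (auto simp: W1_space_def L_space_def)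
qed

text \<open>Stated for an arbitrary positive slope function, because it is applied to a map with
  slopes \<open>F l (H / s)\<close> and to its inverse with the reciprocal slopes. The second claim
  is the equality case, where the profile follows the prescribed slopes.\<close>

lemma W1_energy_lower_bound:
  fixes g :: "real^'n \<Rightarrow> real^'n"
  assumes n: "2 \<le> CARD('n)" and hom: "increasing_homeo r R rs Rs H K" and r: "0 < r"
    and g: "\<And>x. x \<in> annulus r R \<Longrightarrow> g x = radial_map H x" and W: "g \<in> W1_space CARD('n) (annulus r R)"
    and y: "continuous_on {r..R} y" "\<And>s. s \<in> {r..R} \<Longrightarrow> 0 < y s"
  defines "I \<equiv> sphere_area CARD('n) *
      (integral {rs..Rs} (\<lambda>t. energy_slope CARD('n) (t / K t) (y (K t)) * K t ^ (CARD('n) - 1))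
     + integral {r..R} (\<lambda>s. energy_rest CARD('n) (H s / s) (y s) * s ^ (CARD('n) - 1)))"
  shows "I \<le> (LINT x|lebesgue_on (annulus r R). hs_norm (weak_derivative (annulus r R) g x) ^ CARD('n))"
    and "(\<And>s. r < s \<Longrightarrow> s < R \<Longrightarrow> (H has_real_derivative y s) (at s)) \<Longrightarrow>
      (LINT x|lebesgue_on (annulus r R). hs_norm (weak_derivative (annulus r R) g x) ^ CARD('n)) = I"
proof -
  let ?A = "annulus r R :: (real^'n) set"
  note h = increasing_homeo_facts[OF hom]
  have A: "open ?A" "?A \<in> sets lebesgue" by (simp_all add: open_annulus)
  have p: "1 \<le> CARD('n)" using n by simp
  note w = W1_space_weak_derivative[OF A(1) W]
  have i: "integrable (lebesgue_on ?A) D" "integrable (lebesgue_on ?A) (\<lambda>x. norm (D x) ^ CARD('n))"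
    if "D \<in> L_space CARD('n) ?A" for D :: "real^'n \<Rightarrow> real^'n^'n"
    using L_space_integrable[OF annulus_lmeasurable that p] that by (auto simp: L_space_def)
  show "I \<le> (LINT x|lebesgue_on ?A. hs_norm (weak_derivative ?A g x) ^ CARD('n))"
    unfolding hs_norm_eq_norm I_def by (rule energy_lower_bound(1)[OF n hom r g w(1) i[OF w(2)] y])
  assume d: "\<And>s. r < s \<Longrightarrow> s < R \<Longrightarrow> (H has_real_derivative y s) (at s)"
  define D where "D x = radial_matrix (H (norm x) / norm x) ((y (norm x) - H (norm x) / norm x) / (norm x)\<^sup>2) x" for x :: "real^'n"
  note D = radial_map_W1(1)[OF r h(5) h(1) y(1) d g, folded D_def]
    radial_map_W1(2)[OF r h(5) h(1) y(1) d g, of "CARD('n)", folded D_def]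
  have "(LINT x|lebesgue_on ?A. norm (weak_derivative ?A g x) ^ CARD('n)) = (LINT x|lebesgue_on ?A. norm (D x) ^ CARD('n))"
    by (rule L_space_AE(2)[OF A(2) weak_derivative_unique[OF A(1) D(1) w(1)] D(2)])
  also have "\<dots> = I"
    unfolding I_def by (rule energy_lower_bound(2)[OF n hom r g D(1) i[OF D(2)] y]) (auto simp: D_def)
  finally show "(LINT x|lebesgue_on ?A. hs_norm (weak_derivative ?A g x) ^ CARD('n)) = I"
    unfolding hs_norm_eq_norm .
qed

section \<open>Minimality of the profile that follows the slope field\<close>

theorem theorem1p2:
  fixes \<alpha> \<beta> r R rs Rs :: real
  assumes "3 \<le> CARD('n::finite)"
    and "0 < r" and "r < R" and "0 < rs" and "rs < Rs"
    and "\<alpha> > 0" and "\<beta> > 0" and "\<alpha> + \<beta> = 1"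
  shows "\<exists>h \<in> (radial_maps r R rs Rs :: (real^'n \<Rightarrow> real^'n) set).
           h = h_star \<alpha> \<beta> r R rs Rs \<and>
           diffeomorphism (annulus r R) (annulus rs Rs) h \<and>
           (\<forall>g \<in> (radial_maps r R rs Rs :: (real^'n \<Rightarrow> real^'n) set).
              total_energy \<alpha> \<beta> (annulus r R) (annulus rs Rs) h
                \<le> total_energy \<alpha> \<beta> (annulus r R) (annulus rs Rs) g)"
proof -
  let ?A = "annulus r R :: (real^'n) set" and ?B = "annulus rs Rs :: (real^'n) set"
  let ?n = "CARD('n)"
  note r = \<open>0 < r\<close> and rR = \<open>r < R\<close> and rs = \<open>0 < rs\<close> and rsRs = \<open>rs < Rs\<close>
  have n: "2 \<le> ?n" using assms(1) by simp
  define a where "a = \<alpha> / measure lebesgue ?B"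
  define b where "b = \<beta> / measure lebesgue ?A"
  have ab: "0 < a" "0 < b"
    unfolding a_def b_def using assms by (auto intro!: divide_pos_pos measure_annulus_pos)
  interpret energy_coefficients ?n a b by unfold_locales (use assms ab in auto)
  define l where "l = lambda_star ?n a b r R rs Rs"
  have l: "0 < l" "H_sol ?n a b r rs l R = Rs"
    using theI'[OF H_solution_end_value[OF r rR rs rsRs]] by (simp_all add: l_def lambda_star_def)
  define H where "H = H_sol ?n a b r rs l"
  have H: "H_solution l r rs H" unfolding H_def by (rule H_sol_solution[OF l(1) r rs])
  define h where "h = (radial_map H :: real^'n \<Rightarrow> real^'n)"
  have h_star: "h = h_star \<alpha> \<beta> r R rs Rs"
    by (simp add: h_def H_def l_def a_def b_def h_star_def Let_def)
  obtain K where hom: "increasing_homeo r R rs Rs H K"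
  proof (rule increasing_homeoI[of r R H rs Rs])
    show "continuous_on {r..R} H" by (rule continuous_on_subset[OF H_solution_continuous_on[OF H]]) auto
    show "H x < H y" if "r \<le> x" "x < y" "y \<le> R" for x y
      using H_solution_strict_mono[OF l(1) r H that(1,2)] .
    show "H r = rs" "H R = Rs" using H l(2) by (simp_all add: H_solution_def H_def)
  qed (use rR in auto)
  note f = increasing_homeo_facts[OF hom]
  define energy where "energy = sphere_area ?n * (eikonal2 l R Rs - eikonal2 l r rs)"
  \<comment> \<open>The same field, with the parameter of the minimizer, is evaluated along the
    graph of every competitor. Only for the minimizing profile is this value the derivative.\<close>
  define y where "y H s = F l (H s / s)" for H s
  have y: "continuous_on {r..R} (y H)" "\<And>s. s \<in> {r..R} \<Longrightarrow> 0 < y H s"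
     "continuous_on {rs..Rs} (\<lambda>t. 1 / y H (K t))" "\<And>t. t \<in> {rs..Rs} \<Longrightarrow> 0 < 1 / y H (K t)"
    if hom: "increasing_homeo r R rs Rs H K" for H K
  proof -
    note f = increasing_homeo_facts[OF hom]
    have pos: "0 < H s / s" "s \<noteq> 0" if "s \<in> {r..R}" for s using f(7)[OF that] that r rs by auto
    show c: "continuous_on {r..R} (y H)"
      unfolding y_def by (rule continuous_on_compose2[OF F_continuous_on[OF l(1)]])
        (use pos r in \<open>auto intro!: continuous_intros f(1)\<close>)
    show p: "0 < y H s" if "s \<in> {r..R}" for s unfolding y_def by (rule F_pos[OF l(1) pos(1)[OF that]])
    show "0 < 1 / y H (K t)" if "t \<in> {rs..Rs}" for t using p[OF f(9)[OF that]] by simp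
    show "continuous_on {rs..Rs} (\<lambda>t. 1 / y H (K t))"
      by (intro continuous_intros continuous_on_compose2[OF c f(2)]) (use p f(9) in force)+
  qed
  define E1 where "E1 H K = sphere_area ?n *
      (integral {rs..Rs} (\<lambda>t. energy_slope ?n (t / K t) (y H (K t)) * K t ^ (?n - 1))
     + integral {r..R} (\<lambda>s. energy_rest ?n (H s / s) (y H s) * s ^ (?n - 1)))" for H K
  define E2 where "E2 H K = sphere_area ?n *
      (integral {r..R} (\<lambda>s. energy_slope ?n (s / H s) (1 / y H (K (H s))) * H s ^ (?n - 1))
     + integral {rs..Rs} (\<lambda>t. energy_rest ?n (K t / t) (1 / y H (K t)) * t ^ (?n - 1)))" for H K
  \<comment> \<open>The weighted sum of the two bounds depends on \<open>H\<close> only through the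
    common end points, so all competitors share the bound \<open>energy\<close>.\<close>
  have total: "a * E1 H K + b * E2 H K = energy" if "increasing_homeo r R rs Rs H K" for H K
    unfolding E1_def E2_def energy_def y_def calibration_total[OF that r rs l(1), symmetric]
    by (simp add: algebra_simps)
  have energy_eq: "total_energy \<alpha> \<beta> ?A ?B g =
      a * (LINT x|lebesgue_on ?A. hs_norm (weak_derivative ?A g x) ^ ?n)
      + b * (LINT x|lebesgue_on ?B. hs_norm (weak_derivative ?B (inv_into ?A g) x) ^ ?n)" for g
    by (simp add: total_energy_def a_def b_def)
  have lower: "energy \<le> total_energy \<alpha> \<beta> ?A ?B g" if "g \<in> radial_maps r R rs Rs" for g :: "real^'n \<Rightarrow> real^'n"
  proof -
    have W: "g \<in> W1_space ?n ?A" "inv_into ?A g \<in> W1_space ?n ?B"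
      using that by (simp_all add: radial_maps_def)
    have "\<exists>H K. homeomorphism {r..R} {rs..Rs} H K \<and> H r = rs \<and> H R = Rs \<and> (\<forall>x\<in>?A. g x = radial_map H x)"
      using that by (simp add: radial_maps_def)
    then obtain Hg Kg where Hg: "homeomorphism {r..R} {rs..Rs} Hg Kg \<and> Hg r = rs \<and> Hg R = Rs"
      and "\<forall>x\<in>?A. g x = radial_map Hg x" by blast
    then have g: "g x = radial_map Hg x" if "x \<in> ?A" for x using that by blast
    have hg: "increasing_homeo r R rs Rs Hg Kg" using Hg rR rsRs by (simp add: increasing_homeo_def)
    note yg = y[OF hg]
    have "E1 Hg Kg \<le> (LINT x|lebesgue_on ?A. hs_norm (weak_derivative ?A g x) ^ ?n)"
      unfolding E1_def by (rule W1_energy_lower_bound(1)[OF n hg r g W(1) yg(1,2)])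
    moreover have "E2 Hg Kg \<le> (LINT x|lebesgue_on ?B. hs_norm (weak_derivative ?B (inv_into ?A g) x) ^ ?n)"
      unfolding E2_def
      by (rule W1_energy_lower_bound(1)[OF n increasing_homeo_sym[OF hg] rs radial_bij(2)[OF hg r rs g] W(2) yg(3,4)])
    ultimately have "a * E1 Hg Kg + b * E2 Hg Kg \<le> total_energy \<alpha> \<beta> ?A ?B g"
      unfolding energy_eq using ab by (intro add_mono mult_left_mono) auto
    then show ?thesis using total[OF hg] by simp
  qed
  note yh = y[OF hom]
  have dH: "(H has_real_derivative y H s) (at s)" if "r < s" "s < R" for s
    using H that at_within_Ici_interior[OF that(1)] by (auto simp: H_solution_def y_def dest!: spec[of _ s])
  have dK: "(K has_real_derivative 1 / y H (K t)) (at t)" if "rs < t" "t < Rs" for t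
    using H_solution_inverse_deriv(4)[OF l(1) r rs H hom, of t] f(10)[of t] that
    by (simp add: y_def inverse_eq_divide)
  have hH: "h x = radial_map H x" for x by (simp add: h_def)
  note inv = radial_bij(2)[OF hom r rs hH]
  \<comment> \<open>Both maps have derivatives of their profiles that extend continuously to the
    closed intervals: \<open>F l (H / s)\<close>, and its reciprocal along \<open>K\<close>.\<close>
  have Wh: "h \<in> W1_space ?n ?A" "inv_into ?A h \<in> W1_space ?n ?B"
    by (rule radial_map_W1(3)[OF r rR f(1) yh(1) dH hH] radial_map_W1(3)[OF rs rsRs f(2) yh(3) dK inv]; assumption)+
  have h: "h \<in> radial_maps r R rs Rs"
    using hom hH Wh unfolding radial_maps_def increasing_homeo_def by auto
  have upper: "total_energy \<alpha> \<beta> ?A ?B h = energy"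
  proof -
    have "(LINT x|lebesgue_on ?A. hs_norm (weak_derivative ?A h x) ^ ?n) = E1 H K"
      unfolding E1_def by (rule W1_energy_lower_bound(2)[OF n hom r hH Wh(1) yh(1,2) dH])
    moreover have "(LINT x|lebesgue_on ?B. hs_norm (weak_derivative ?B (inv_into ?A h) x) ^ ?n) = E2 H K"
      unfolding E2_def
      by (rule W1_energy_lower_bound(2)[OF n increasing_homeo_sym[OF hom] rs inv Wh(2) yh(3,4) dK])
    ultimately show ?thesis unfolding energy_eq by (simp add: total[OF hom])
  qed
  have "C_on k {r<..<R} H" for k by (rule C_on_subset[OF H_solution_smooth[OF l(1) r H]]) auto
  then have "diffeomorphism ?A ?B h"
    unfolding h_def by (rule radial_diffeomorphism[OF hom r rs _ H_solution_inverse_smooth[OF l(1) r rs H hom]])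
  then show ?thesis using h h_star lower upper by (intro bexI[of _ h]) auto
qed

end
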